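(* The sheaf of nil radicals need not be coherent on adic Noetherian formal schemes: there exists an adic Noetherian formal scheme $X$ such that the sheaf of ideals $$U\longmapsto \mathcal N(U)=\text{nil radical of }\mathcal O_X(U)$$ is not a coherent sheaf of $\mathcal O_X$-modules.
   Context: An adic Noetherian formal scheme is a formal scheme covered by finitely many affine formal schemes $\mathrm{Spf}(A)$ with $A$ Noetherian and complete in an $I$-adic topology. *)

theory Defs
  imports
    "HOL-Analysis.Function_Topology"
    "HOL-Analysis.Product_Topology"
    "HOL-Algebra.Ideal_Product"
    "HOL-Algebra.Ring_Divisibility"
begin

section \<open>Topologically ringed spaces\<close>

text \<open>
  Sheaf data are total functions on all subsets of the space; only their values on open sets
  carry meaning.  Restriction to an open subspace therefore only changes the topology.
\<close>

definition sheaf_of_sets ::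
  "'p topology \<Rightarrow> ('p set \<Rightarrow> 's set) \<Rightarrow> ('p set \<Rightarrow> 'p set \<Rightarrow> 's \<Rightarrow> 's) \<Rightarrow> bool" where
  "sheaf_of_sets T F \<rho> \<longleftrightarrow>
     (\<forall>U V. openin T U \<and> openin T V \<and> V \<subseteq> U \<longrightarrow> \<rho> U V \<in> F U \<rightarrow> F V) \<and>
     (\<forall>U. openin T U \<longrightarrow> (\<forall>s\<in>F U. \<rho> U U s = s)) \<and>
     (\<forall>U V W. openin T U \<and> openin T V \<and> openin T W \<and> W \<subseteq> V \<and> V \<subseteq> U \<longrightarrow>
        (\<forall>s\<in>F U. \<rho> V W (\<rho> U V s) = \<rho> U W s)) \<and>
     (\<forall>\<U> s. (\<forall>U\<in>\<U>. openin T U \<and> s U \<in> F U) \<and>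
            (\<forall>U\<in>\<U>. \<forall>V\<in>\<U>. \<rho> U (U \<inter> V) (s U) = \<rho> V (U \<inter> V) (s V)) \<longrightarrow>
        (\<exists>!t. t \<in> F (\<Union>\<U>) \<and> (\<forall>U\<in>\<U>. \<rho> (\<Union>\<U>) U t = s U)))"

record ('p, 's) top_ringed_space =
  base :: "'p topology"
  sect :: "'p set \<Rightarrow> 's ring"
  res :: "'p set \<Rightarrow> 'p set \<Rightarrow> 's \<Rightarrow> 's"
  sect_top :: "'p set \<Rightarrow> 's topology"

definition topological_ring :: "'s ring \<Rightarrow> 's topology \<Rightarrow> bool" where
  "topological_ring R T \<longleftrightarrow>
     ring R \<and> topspace T = carrier R \<and>
     continuous_map (prod_topology T T) T (\<lambda>(x, y). x \<oplus>\<^bsub>R\<^esub> y) \<and>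
     continuous_map T T (a_inv R) \<and>
     continuous_map (prod_topology T T) T (\<lambda>(x, y). x \<otimes>\<^bsub>R\<^esub> y)"

text \<open>
  The last clause says that the topology on the sections over a union is the initial one for the
  restriction maps to the members of the covering; together with the gluing axiom this is the
  sheaf condition in the category of topological rings.
\<close>

definition topologically_ringed_space :: "('p, 's) top_ringed_space \<Rightarrow> bool" where
  "topologically_ringed_space \<X> \<longleftrightarrow>
     sheaf_of_sets (base \<X>) (\<lambda>U. carrier (sect \<X> U)) (res \<X>) \<and>
     (\<forall>U. openin (base \<X>) U \<longrightarrow>
        cring (sect \<X> U) \<and> topological_ring (sect \<X> U) (sect_top \<X> U)) \<and>
     (\<forall>U V. openin (base \<X>) U \<and> openin (base \<X>) V \<and> V \<subseteq> U \<longrightarrow>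
        res \<X> U V \<in> ring_hom (sect \<X> U) (sect \<X> V)) \<and>
     (\<forall>\<U>. (\<forall>U\<in>\<U>. openin (base \<X>) U) \<longrightarrow>
        embedding_map (sect_top \<X> (\<Union>\<U>)) (product_topology (sect_top \<X>) \<U>)
          (\<lambda>s. \<lambda>U\<in>\<U>. res \<X> (\<Union>\<U>) U s))"

definition open_subspace ::
  "('p, 's) top_ringed_space \<Rightarrow> 'p set \<Rightarrow> ('p, 's) top_ringed_space" where
  "open_subspace \<X> U = \<X>\<lparr>base := subtopology (base \<X>) U\<rparr>"

definition iso_top_ringed_space ::
  "('p, 's) top_ringed_space \<Rightarrow> ('q, 't) top_ringed_space \<Rightarrow> bool" where
  "iso_top_ringed_space \<X> Y \<longleftrightarrow>
     (\<exists>h \<psi>. homeomorphic_map (base \<X>) (base Y) h \<and>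
        (let pre = (\<lambda>V. {x \<in> topspace (base \<X>). h x \<in> V}) in
          (\<forall>V. openin (base Y) V \<longrightarrow>
             \<psi> V \<in> ring_iso (sect Y V) (sect \<X> (pre V)) \<and>
             homeomorphic_map (sect_top Y V) (sect_top \<X> (pre V)) (\<psi> V)) \<and>
          (\<forall>V W. openin (base Y) V \<and> openin (base Y) W \<and> W \<subseteq> V \<longrightarrow>
             (\<forall>s\<in>carrier (sect Y V).
                \<psi> W (res Y V W s) = res \<X> (pre V) (pre W) (\<psi> V s)))))"


section \<open>The structure sheaf of an affine scheme\<close>

text \<open>The fraction \<open>a / s\<close> in the localization of \<open>R\<close> at the multiplicative set \<open>S\<close>.\<close>

definition fraction :: "'a ring \<Rightarrow> 'a set \<Rightarrow> 'a \<Rightarrow> 'a \<Rightarrow> ('a \<times> 'a) set" where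
  "fraction R S a s =
     {(b, t). b \<in> carrier R \<and> t \<in> S \<and>
        (\<exists>u\<in>S. u \<otimes>\<^bsub>R\<^esub> (a \<otimes>\<^bsub>R\<^esub> t) = u \<otimes>\<^bsub>R\<^esub> (b \<otimes>\<^bsub>R\<^esub> s))}"

definition rep :: "('a \<times> 'a) set \<Rightarrow> 'a \<times> 'a" where
  "rep c = (SOME p. p \<in> c)"

definition localization :: "'a ring \<Rightarrow> 'a set \<Rightarrow> ('a \<times> 'a) set ring" where
  "localization R S =
     \<lparr>carrier = {fraction R S a s | a s. a \<in> carrier R \<and> s \<in> S},
      monoid.mult = (\<lambda>c d. let (a, s) = rep c; (b, t) = rep d
                     in fraction R S (a \<otimes>\<^bsub>R\<^esub> b) (s \<otimes>\<^bsub>R\<^esub> t)),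
      one = fraction R S \<one>\<^bsub>R\<^esub> \<one>\<^bsub>R\<^esub>,
      zero = fraction R S \<zero>\<^bsub>R\<^esub> \<one>\<^bsub>R\<^esub>,
      add = (\<lambda>c d. let (a, s) = rep c; (b, t) = rep d
                    in fraction R S ((a \<otimes>\<^bsub>R\<^esub> t) \<oplus>\<^bsub>R\<^esub> (b \<otimes>\<^bsub>R\<^esub> s)) (s \<otimes>\<^bsub>R\<^esub> t))\<rparr>"

abbreviation frac_at :: "'a ring \<Rightarrow> 'a set \<Rightarrow> 'a \<Rightarrow> 'a \<Rightarrow> ('a \<times> 'a) set" where
  "frac_at R P \<equiv> fraction R (carrier R - P)"

abbreviation local_ring_at :: "'a ring \<Rightarrow> 'a set \<Rightarrow> ('a \<times> 'a) set ring" where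
  "local_ring_at R P \<equiv> localization R (carrier R - P)"

definition spec :: "'a ring \<Rightarrow> 'a set set" where
  "spec R = {P. primeideal P R}"

definition zariski :: "'a ring \<Rightarrow> 'a set topology" where
  "zariski R = topology_generated_by {{P \<in> spec R. f \<notin> P} | f. f \<in> carrier R}"

text \<open>
  The ring of sections of the structure sheaf of the spectrum of \<open>R\<close> over the open set \<open>U\<close>:
  families of germs that are locally given by fractions.
\<close>

definition spec_sect :: "'a ring \<Rightarrow> 'a set set \<Rightarrow> ('a set \<Rightarrow> ('a \<times> 'a) set) ring" where
  "spec_sect R U =
     \<lparr>carrier = {s \<in> \<Pi>\<^sub>E P\<in>U. carrier (local_ring_at R P).
         \<forall>P\<in>U. \<exists>V a f. openin (zariski R) V \<and> P \<in> V \<and> V \<subseteq> U \<and>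
           a \<in> carrier R \<and> f \<in> carrier R \<and>
           (\<forall>Q\<in>V. f \<notin> Q \<and> s Q = frac_at R Q a f)},
      monoid.mult = (\<lambda>s t. \<lambda>P\<in>U. s P \<otimes>\<^bsub>local_ring_at R P\<^esub> t P),
      one = (\<lambda>P\<in>U. \<one>\<^bsub>local_ring_at R P\<^esub>),
      zero = (\<lambda>P\<in>U. \<zero>\<^bsub>local_ring_at R P\<^esub>),
      add = (\<lambda>s t. \<lambda>P\<in>U. s P \<oplus>\<^bsub>local_ring_at R P\<^esub> t P)\<rparr>"

text \<open>
  The morphism of affine schemes induced by a ring homomorphism \<open>\<phi>\<close> from \<open>R\<close> to \<open>S\<close>: the
  contraction of primes, the preimage of an open set, and the pullback of a section over \<open>U\<close>
  to the preimage of \<open>U\<close>.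
\<close>

definition contract :: "'a ring \<Rightarrow> ('a \<Rightarrow> 'b) \<Rightarrow> 'b set \<Rightarrow> 'a set" where
  "contract R \<phi> Q = {x \<in> carrier R. \<phi> x \<in> Q}"

definition spec_preimage ::
  "'a ring \<Rightarrow> 'b ring \<Rightarrow> ('a \<Rightarrow> 'b) \<Rightarrow> 'a set set \<Rightarrow> 'b set set" where
  "spec_preimage R S \<phi> U = {Q \<in> spec S. contract R \<phi> Q \<in> U}"

definition spec_pullback ::
  "'a ring \<Rightarrow> 'b ring \<Rightarrow> ('a \<Rightarrow> 'b) \<Rightarrow> 'a set set \<Rightarrow>
   ('a set \<Rightarrow> ('a \<times> 'a) set) \<Rightarrow> 'b set \<Rightarrow> ('b \<times> 'b) set" where
  "spec_pullback R S \<phi> U s =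
     (\<lambda>Q\<in>spec_preimage R S \<phi> U.
        let (a, f) = rep (s (contract R \<phi> Q)) in frac_at S Q (\<phi> a) (\<phi> f))"


section \<open>Adic rings and formal spectra\<close>

primrec ideal_power :: "'a ring \<Rightarrow> 'a set \<Rightarrow> nat \<Rightarrow> 'a set" where
  "ideal_power A I 0 = carrier A"
| "ideal_power A I (Suc n) = ideal_prod A (ideal_power A I n) I"

text \<open>
  The quotient of \<open>A\<close> by the power of \<open>I\<close> with exponent \<open>n + 1\<close>, the projection onto it, and
  the transition map to it from the quotient with index \<open>n + 1\<close>; the latter sends the coset
  \<open>C\<close> to the coset of the larger ideal that contains \<open>C\<close>.
\<close>

definition thick :: "'a ring \<Rightarrow> 'a set \<Rightarrow> nat \<Rightarrow> 'a set ring" where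
  "thick A I n = A Quot (ideal_power A I (Suc n))"

definition to_thick :: "'a ring \<Rightarrow> 'a set \<Rightarrow> nat \<Rightarrow> 'a \<Rightarrow> 'a set" where
  "to_thick A I n a = ideal_power A I (Suc n) +>\<^bsub>A\<^esub> a"

definition thick_step :: "'a ring \<Rightarrow> 'a set \<Rightarrow> nat \<Rightarrow> 'a set \<Rightarrow> 'a set" where
  "thick_step A I n C = ideal_power A I (Suc n) <+>\<^bsub>A\<^esub> C"

text \<open>
  Completeness includes separatedness: \<open>A\<close> maps bijectively to the limit of its quotients by
  the powers of \<open>I\<close>.
\<close>

definition adically_complete :: "'a ring \<Rightarrow> 'a set \<Rightarrow> bool" where
  "adically_complete A I \<longleftrightarrow>
     (\<forall>c. (\<forall>n. c n \<in> carrier (thick A I n)) \<and> (\<forall>n. thick_step A I n (c (Suc n)) = c n) \<longrightarrow>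
        (\<exists>!a. a \<in> carrier A \<and> (\<forall>n. to_thick A I n a = c n)))"

definition noetherian_adic_ring :: "'a ring \<Rightarrow> 'a set \<Rightarrow> bool" where
  "noetherian_adic_ring A I \<longleftrightarrow>
     cring A \<and> noetherian_ring A \<and> ideal I A \<and> adically_complete A I"

text \<open>The underlying space: the open primes of \<open>A\<close>, that is, those containing \<open>I\<close>.\<close>

definition spf_base :: "'a ring \<Rightarrow> 'a set \<Rightarrow> 'a set topology" where
  "spf_base A I = subtopology (zariski A) {P. I \<subseteq> P}"

text \<open>
  The open subset \<open>U\<close> of the formal spectrum, regarded as an open subset of the spectrum of
  \<open>thick A I n\<close>, which has the same underlying space.
\<close>

definition thick_open :: "'a ring \<Rightarrow> 'a set \<Rightarrow> nat \<Rightarrow> 'a set set \<Rightarrow> 'a set set set" where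
  "thick_open A I n U = spec_preimage A (thick A I n) (to_thick A I n) U"

type_synonym 'a spf_section = "nat \<Rightarrow> 'a set set \<Rightarrow> ('a set \<times> 'a set) set"

text \<open>The sections over \<open>U\<close>: the limit over \<open>n\<close> of those on the spectra of the \<open>thick A I n\<close>.\<close>

definition spf_sect :: "'a ring \<Rightarrow> 'a set \<Rightarrow> 'a set set \<Rightarrow> 'a spf_section ring" where
  "spf_sect A I U =
     (let O\<^sub>n = (\<lambda>n. spec_sect (thick A I n) (thick_open A I n U)) in
      \<lparr>carrier = {s. (\<forall>n. s n \<in> carrier (O\<^sub>n n)) \<and>
          (\<forall>n. spec_pullback (thick A I (Suc n)) (thick A I n) (thick_step A I n)
                  (thick_open A I (Suc n) U) (s (Suc n)) = s n)},
       monoid.mult = (\<lambda>s t n. s n \<otimes>\<^bsub>O\<^sub>n n\<^esub> t n),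
       one = (\<lambda>n. \<one>\<^bsub>O\<^sub>n n\<^esub>),
       zero = (\<lambda>n. \<zero>\<^bsub>O\<^sub>n n\<^esub>),
       add = (\<lambda>s t n. s n \<oplus>\<^bsub>O\<^sub>n n\<^esub> t n)\<rparr>)"

definition spf_res ::
  "'a ring \<Rightarrow> 'a set \<Rightarrow> 'a set set \<Rightarrow> 'a set set \<Rightarrow> 'a spf_section \<Rightarrow> 'a spf_section" where
  "spf_res A I U V s = (\<lambda>n. restrict (s n) (thick_open A I n V))"

text \<open>
  The limit topology, where each structure sheaf in the system is pseudo-discrete: its sections
  over quasi-compact open sets are discrete.  So the topology on the sections over \<open>U\<close> is the
  coarsest one for which every map to the discrete set of sections over \<open>V\<close> at level \<open>n\<close> is
  continuous, for every quasi-compact open subset \<open>V\<close> of \<open>U\<close>.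
\<close>

definition spf_sect_top ::
  "'a ring \<Rightarrow> 'a set \<Rightarrow> 'a set set \<Rightarrow> 'a spf_section topology" where
  "spf_sect_top A I U =
     topology_generated_by
       {{s \<in> carrier (spf_sect A I U). spf_res A I U V s n = t} | V n t.
          openin (spf_base A I) V \<and> compactin (spf_base A I) V \<and> V \<subseteq> U \<and>
          t \<in> carrier (spec_sect (thick A I n) (thick_open A I n V))}"

definition Spf :: "'a ring \<Rightarrow> 'a set \<Rightarrow> ('a set, 'a spf_section) top_ringed_space" where
  "Spf A I =
     \<lparr>base = spf_base A I, sect = spf_sect A I, res = spf_res A I,
      sect_top = spf_sect_top A I\<rparr>"

text \<open>
  The type argument is the universe of the rings \<open>A\<close> in the affine charts.  Such a ring is
  isomorphic to the ring of sections over its chart, so the argument only bounds cardinalities.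
\<close>

definition adic_noetherian_formal_scheme ::
  "'a itself \<Rightarrow> ('p, 's) top_ringed_space \<Rightarrow> bool" where
  "adic_noetherian_formal_scheme (_ :: 'a itself) \<X> \<longleftrightarrow>
     topologically_ringed_space \<X> \<and>
     (\<exists>\<U>. finite \<U> \<and> (\<forall>U\<in>\<U>. openin (base \<X>) U) \<and> \<Union>\<U> = topspace (base \<X>) \<and>
        (\<forall>U\<in>\<U>. \<exists>(A :: 'a ring) I. noetherian_adic_ring A I \<and>
           iso_top_ringed_space (open_subspace \<X> U) (Spf A I)))"


section \<open>Sheaves of modules and coherence\<close>

record ('p, 's, 'm) mod_sheaf =
  msect :: "'p set \<Rightarrow> ('s, 'm) module"
  mres :: "'p set \<Rightarrow> 'p set \<Rightarrow> 'm \<Rightarrow> 'm"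

definition sheaf_of_modules ::
  "('p, 's) top_ringed_space \<Rightarrow> ('p, 's, 'm) mod_sheaf \<Rightarrow> bool" where
  "sheaf_of_modules \<X> F \<longleftrightarrow>
     sheaf_of_sets (base \<X>) (\<lambda>U. carrier (msect F U)) (mres F) \<and>
     (\<forall>U. openin (base \<X>) U \<longrightarrow> module (sect \<X> U) (msect F U)) \<and>
     (\<forall>U V. openin (base \<X>) U \<and> openin (base \<X>) V \<and> V \<subseteq> U \<longrightarrow>
        (\<forall>x\<in>carrier (msect F U). \<forall>y\<in>carrier (msect F U).
           mres F U V (x \<oplus>\<^bsub>msect F U\<^esub> y) = mres F U V x \<oplus>\<^bsub>msect F V\<^esub> mres F U V y) \<and>
        (\<forall>a\<in>carrier (sect \<X> U). \<forall>x\<in>carrier (msect F U).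
           mres F U V (a \<odot>\<^bsub>msect F U\<^esub> x) = res \<X> U V a \<odot>\<^bsub>msect F V\<^esub> mres F U V x))"

definition mod_sheaf_hom ::
  "('p, 's) top_ringed_space \<Rightarrow> ('p, 's, 'm) mod_sheaf \<Rightarrow> ('p, 's, 'k) mod_sheaf \<Rightarrow>
   ('p set \<Rightarrow> 'm \<Rightarrow> 'k) \<Rightarrow> bool" where
  "mod_sheaf_hom \<X> F G \<phi> \<longleftrightarrow>
     (\<forall>U. openin (base \<X>) U \<longrightarrow>
        \<phi> U \<in> carrier (msect F U) \<rightarrow> carrier (msect G U) \<and>
        (\<forall>x\<in>carrier (msect F U). \<forall>y\<in>carrier (msect F U).
           \<phi> U (x \<oplus>\<^bsub>msect F U\<^esub> y) = \<phi> U x \<oplus>\<^bsub>msect G U\<^esub> \<phi> U y) \<and>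
        (\<forall>a\<in>carrier (sect \<X> U). \<forall>x\<in>carrier (msect F U).
           \<phi> U (a \<odot>\<^bsub>msect F U\<^esub> x) = a \<odot>\<^bsub>msect G U\<^esub> \<phi> U x)) \<and>
     (\<forall>U V. openin (base \<X>) U \<and> openin (base \<X>) V \<and> V \<subseteq> U \<longrightarrow>
        (\<forall>x\<in>carrier (msect F U). \<phi> V (mres F U V x) = mres G U V (\<phi> U x)))"

text \<open>Surjectivity as a morphism of sheaves: sections lift locally.\<close>

definition mod_sheaf_surj ::
  "('p, 's) top_ringed_space \<Rightarrow> ('p, 's, 'm) mod_sheaf \<Rightarrow> ('p, 's, 'k) mod_sheaf \<Rightarrow>
   ('p set \<Rightarrow> 'm \<Rightarrow> 'k) \<Rightarrow> bool" where
  "mod_sheaf_surj \<X> F G \<phi> \<longleftrightarrow>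
     (\<forall>U. openin (base \<X>) U \<longrightarrow>
        (\<forall>t\<in>carrier (msect G U). \<forall>x\<in>U. \<exists>V. openin (base \<X>) V \<and> x \<in> V \<and> V \<subseteq> U \<and>
           (\<exists>s\<in>carrier (msect F V). \<phi> V s = mres G U V t)))"

definition mod_sheaf_kernel ::
  "('p, 's, 'm) mod_sheaf \<Rightarrow> ('p, 's, 'k) mod_sheaf \<Rightarrow> ('p set \<Rightarrow> 'm \<Rightarrow> 'k) \<Rightarrow>
   ('p, 's, 'm) mod_sheaf" where
  "mod_sheaf_kernel F G \<phi> =
     F\<lparr>msect := \<lambda>U. (msect F U)
         \<lparr>carrier := {x \<in> carrier (msect F U). \<phi> U x = \<zero>\<^bsub>msect G U\<^esub>}\<rparr>\<rparr>"

definition free_sheaf ::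
  "('p, 's) top_ringed_space \<Rightarrow> nat \<Rightarrow> ('p, 's, nat \<Rightarrow> 's) mod_sheaf" where
  "free_sheaf \<X> n =
     \<lparr>msect = \<lambda>U.
        \<lparr>carrier = {..<n} \<rightarrow>\<^sub>E carrier (sect \<X> U),
         monoid.mult = (\<lambda>x y. \<lambda>i\<in>{..<n}. x i \<otimes>\<^bsub>sect \<X> U\<^esub> y i),
         one = (\<lambda>i\<in>{..<n}. \<one>\<^bsub>sect \<X> U\<^esub>),
         zero = (\<lambda>i\<in>{..<n}. \<zero>\<^bsub>sect \<X> U\<^esub>),
         add = (\<lambda>x y. \<lambda>i\<in>{..<n}. x i \<oplus>\<^bsub>sect \<X> U\<^esub> y i),
         smult = (\<lambda>a x. \<lambda>i\<in>{..<n}. a \<otimes>\<^bsub>sect \<X> U\<^esub> x i)\<rparr>,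
      mres = \<lambda>U V x. \<lambda>i\<in>{..<n}. res \<X> U V (x i)\<rparr>"

text \<open>
  A sheaf of modules on \<open>\<X>\<close>, used over \<open>open_subspace \<X> U\<close>, stands for its restriction to
  \<open>U\<close>.
\<close>

definition finite_type ::
  "('p, 's) top_ringed_space \<Rightarrow> ('p, 's, 'm) mod_sheaf \<Rightarrow> bool" where
  "finite_type \<X> F \<longleftrightarrow>
     (\<forall>x\<in>topspace (base \<X>). \<exists>U. openin (base \<X>) U \<and> x \<in> U \<and>
        (\<exists>n \<phi>. mod_sheaf_hom (open_subspace \<X> U) (free_sheaf \<X> n) F \<phi> \<and>
               mod_sheaf_surj (open_subspace \<X> U) (free_sheaf \<X> n) F \<phi>))"

definition coherent_sheaf ::
  "('p, 's) top_ringed_space \<Rightarrow> ('p, 's, 'm) mod_sheaf \<Rightarrow> bool" where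
  "coherent_sheaf \<X> F \<longleftrightarrow>
     sheaf_of_modules \<X> F \<and> finite_type \<X> F \<and>
     (\<forall>U n \<phi>. openin (base \<X>) U \<and>
        mod_sheaf_hom (open_subspace \<X> U) (free_sheaf \<X> n) F \<phi> \<longrightarrow>
        finite_type (open_subspace \<X> U) (mod_sheaf_kernel (free_sheaf \<X> n) F \<phi>))"

definition sheaf_of_ideals ::
  "('p, 's) top_ringed_space \<Rightarrow> ('p set \<Rightarrow> 's set) \<Rightarrow> bool" where
  "sheaf_of_ideals \<X> J \<longleftrightarrow>
     (\<forall>U. openin (base \<X>) U \<longrightarrow> ideal (J U) (sect \<X> U)) \<and>
     sheaf_of_sets (base \<X>) J (res \<X>)"

text \<open>A sheaf of ideals, viewed as a sheaf of modules.\<close>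

definition ideal_module ::
  "('p, 's) top_ringed_space \<Rightarrow> ('p set \<Rightarrow> 's set) \<Rightarrow> ('p, 's, 's) mod_sheaf" where
  "ideal_module \<X> J =
     \<lparr>msect = \<lambda>U.
        \<lparr>carrier = J U, monoid.mult = monoid.mult (sect \<X> U), one = \<one>\<^bsub>sect \<X> U\<^esub>,
         zero = \<zero>\<^bsub>sect \<X> U\<^esub>, add = add (sect \<X> U), smult = monoid.mult (sect \<X> U)\<rparr>,
      mres = res \<X>\<rparr>"

definition nilradical :: "'a ring \<Rightarrow> 'a set" where
  "nilradical R = {a \<in> carrier R. \<exists>n::nat. a [^]\<^bsub>R\<^esub> n = \<zero>\<^bsub>R\<^esub>}"

end

theory Submission
  imports
    Defs
    "HOL-Computational_Algebra.Polynomial_FPS"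
    "HOL-Library.Z2"
    "HOL-Library.Countable_Set"
    "HOL-Library.Nat_Bijection"
begin

text \<open>
  The sheaf of nilradicals of an affine formal scheme can jump: inverting an element and then
  completing may create nilpotents out of nothing.  The example is a domain \<open>A\<close>, complete for the
  ideal generated by one element \<open>t\<close>, for which exactly two primes \<open>p \<subset> m\<close> contain \<open>t\<close>.  The open
  sets of its formal spectrum \<open>X\<close> are \<open>{}\<close>, \<open>{p}\<close> and \<open>X = {p, m}\<close>.  Sections over \<open>X\<close> are elements
  of \<open>A\<close> (lemma \<open>global_section\<close>), so the nilradical vanishes there (\<open>global_reduced\<close>).  Since \<open>X\<close>
  is the only neighbourhood of \<open>m\<close>, a nilradical of finite type would be generated by its sections
  over \<open>X\<close> and would vanish over \<open>{p}\<close> as well (\<open>not_finite_type\<close>).  But over \<open>{p}\<close> there is a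
  nonzero section \<open>\<xi>\<close> of square zero (\<open>xi_nilpotent\<close>, \<open>xi_nonzero\<close>).  Because every family of open
  sets contains its union or is empty, all sheaf conditions are automatic
  (\<open>sheaf_of_sets_chain\<close>).

  The ring is a subring of \<open>F\<^sub>2[[s, t]]\<close>.  Choose \<open>f\<close>
  in \<open>F\<^sub>2[[s]]\<close> transcendental over \<open>F\<^sub>2(s)\<close> and let \<open>R\<close> consist of the power series that are
  fractions of polynomials in \<open>s\<close> and \<open>f\<^sup>2\<close>.  This is a discrete valuation ring with parameter \<open>s\<close>,
  and \<open>f\<close> is not a fraction of elements of \<open>R\<close> although \<open>f\<^sup>2\<close> lies in \<open>R\<close>
  (\<open>exists_nonsplit_dvr\<close>).  Let \<open>f\<^sub>n\<close> be the tail \<open>(f - truncation of f) / s\<^sup>n\<close>.  Its square lies in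
  \<open>R\<close>, but in \<open>C = R[f]\<close> it has the exact denominator \<open>s\<^sup>n\<close>: the normalization of \<open>C\<close> is not finite
  over \<open>C\<close>.  Collect these elements in \<open>\<beta> = \<Sum> f\<^sub>k t\<^sup>n\<close> with \<open>k = n\<^sup>2\<close>, so that \<open>\<beta>\<^sup>2\<close> lies in
  \<open>R[[t]]\<close>, and put \<open>A = R[[t]][f, \<beta>]\<close>.  After \<open>s\<close> is inverted the coefficients \<open>f\<^sub>k\<close> belong to
  \<open>C[1/s]\<close>, so in the completion the equation \<open>Y\<^sup>2 = \<beta>\<^sup>2\<close> has, besides the class of \<open>\<beta>\<close>, the root
  \<open>\<Sum> f\<^sub>k t\<^sup>n\<close> with coefficients in \<open>C[1/s]\<close>.  Their difference is \<open>\<xi>\<close>; the numerators of its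
  approximations are the elements \<open>approx n\<close>.  It is nonzero because \<open>\<beta>\<close> is not a
  fraction of elements of \<open>C[[t]]\<close> (\<open>beta_not_fraction\<close>), which is where the quadratic growth of
  the denominators enters.

  All squares of elements of \<open>A\<close> lie in \<open>R[[t]]\<close> (\<open>A_square\<close>); this reduces the units of \<open>A\<close> and the
  primes that contain \<open>t\<close> to those of \<open>R[[t]]\<close> (\<open>A_inverse\<close>, \<open>primes_over_X\<close>).  As a module over
  \<open>R[[t]]\<close> the ring \<open>A\<close> is generated by \<open>1\<close>, \<open>f\<close>, \<open>\<beta>\<close>, \<open>f\<beta>\<close>, which yields completeness
  (\<open>A_series\<close>) and noetherianity (\<open>A_noetherian\<close>).
\<close>

section \<open>Localizations\<close>

locale mult_subset = cring R for R :: "'a ring" (structure) +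
  fixes S :: "'a set"
  assumes S_sub: "S \<subseteq> carrier R" and S_one: "\<one> \<in> S"
    and S_mult: "\<lbrakk>x \<in> S; y \<in> S\<rbrakk> \<Longrightarrow> x \<otimes> y \<in> S"
begin

lemma S_carr [simp]: "x \<in> S \<Longrightarrow> x \<in> carrier R"
  using S_sub by blast

lemma mem_fraction_iff:
  "(b, t) \<in> fraction R S a s \<longleftrightarrow>
     b \<in> carrier R \<and> t \<in> S \<and> (\<exists>u\<in>S. u \<otimes> (a \<otimes> t) = u \<otimes> (b \<otimes> s))"
  by (simp add: fraction_def)

lemma mem_fraction_self: "\<lbrakk>a \<in> carrier R; s \<in> S\<rbrakk> \<Longrightarrow> (a, s) \<in> fraction R S a s"
  using S_one by (auto simp: mem_fraction_iff)

lemma fraction_rel_trans: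
  assumes c: "a \<in> carrier R" "b \<in> carrier R" "c \<in> carrier R" "s \<in> S" "t \<in> S" "r \<in> S"
    and 1: "u \<in> S" "u \<otimes> (a \<otimes> t) = u \<otimes> (b \<otimes> s)"
    and 2: "v \<in> S" "v \<otimes> (b \<otimes> r) = v \<otimes> (c \<otimes> t)"
  shows "\<exists>w\<in>S. w \<otimes> (a \<otimes> r) = w \<otimes> (c \<otimes> s)"
proof (intro bexI)
  note cc = c 1(1) 2(1)
  have "(u \<otimes> v \<otimes> t) \<otimes> (a \<otimes> r) = (v \<otimes> r) \<otimes> (u \<otimes> (a \<otimes> t))"
    using cc by (simp add: m_ac)
  also have "\<dots> = (u \<otimes> s) \<otimes> (v \<otimes> (b \<otimes> r))"
    unfolding 1(2) using cc by (simp add: m_ac)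
  also have "\<dots> = (u \<otimes> v \<otimes> t) \<otimes> (c \<otimes> s)"
    unfolding 2(2) using cc by (simp add: m_ac)
  finally show "(u \<otimes> v \<otimes> t) \<otimes> (a \<otimes> r) = (u \<otimes> v \<otimes> t) \<otimes> (c \<otimes> s)" .
  show "u \<otimes> v \<otimes> t \<in> S"
    using cc S_mult by blast
qed

lemma fraction_eq_iff:
  assumes "a \<in> carrier R" "b \<in> carrier R" "s \<in> S" "t \<in> S"
  shows "fraction R S a s = fraction R S b t \<longleftrightarrow>
    (\<exists>u\<in>S. u \<otimes> (a \<otimes> t) = u \<otimes> (b \<otimes> s))"
proof
  assume "fraction R S a s = fraction R S b t"
  then show "\<exists>u\<in>S. u \<otimes> (a \<otimes> t) = u \<otimes> (b \<otimes> s)"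
    using mem_fraction_self[OF assms(2,4)] mem_fraction_iff[of b t a s] by simp
next
  assume "\<exists>u\<in>S. u \<otimes> (a \<otimes> t) = u \<otimes> (b \<otimes> s)"
  then obtain u where u: "u \<in> S" "u \<otimes> (a \<otimes> t) = u \<otimes> (b \<otimes> s)" by blast
  have "(c, r) \<in> fraction R S a s \<longleftrightarrow> (c, r) \<in> fraction R S b t" for c r
    unfolding mem_fraction_iff
    using fraction_rel_trans[OF assms(2,1) _ assms(4,3) _ u(1) u(2)[symmetric]]
      fraction_rel_trans[OF assms(1,2) _ assms(3,4) _ u(1) u(2)]
    by blast
  then show "fraction R S a s = fraction R S b t" by auto
qed

lemma fraction_eqI:
  assumes "a \<in> carrier R" "b \<in> carrier R" "s \<in> S" "t \<in> S" "a \<otimes> t = b \<otimes> s"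
  shows "fraction R S a s = fraction R S b t"
  using assms S_one by (auto simp: fraction_eq_iff)

lemma rep_fraction:
  assumes "a \<in> carrier R" "s \<in> S"
  obtains b t where "rep (fraction R S a s) = (b, t)" "b \<in> carrier R" "t \<in> S"
    "fraction R S b t = fraction R S a s"
proof -
  have "rep (fraction R S a s) \<in> fraction R S a s"
    unfolding rep_def by (rule someI, rule mem_fraction_self[OF assms])
  moreover obtain b t where bt: "rep (fraction R S a s) = (b, t)"
    by (cases "rep (fraction R S a s)")
  ultimately have *: "b \<in> carrier R" "t \<in> S" "\<exists>u\<in>S. u \<otimes> (a \<otimes> t) = u \<otimes> (b \<otimes> s)"
    by (auto simp: mem_fraction_iff)
  then have "fraction R S a s = fraction R S b t"
    using fraction_eq_iff[OF assms(1) *(1) assms(2) *(2)] by blast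
  then show ?thesis using that[OF bt *(1,2)] by simp
qed

abbreviation "L \<equiv> localization R S"

lemma localization_carrier: "carrier L = {fraction R S a s | a s. a \<in> carrier R \<and> s \<in> S}"
  and localization_one: "\<one>\<^bsub>L\<^esub> = fraction R S \<one> \<one>"
  and localization_zero: "\<zero>\<^bsub>L\<^esub> = fraction R S \<zero> \<one>"
  by (simp_all add: localization_def)

lemma fraction_closed [simp]: "\<lbrakk>a \<in> carrier R; s \<in> S\<rbrakk> \<Longrightarrow> fraction R S a s \<in> carrier L"
  by (auto simp: localization_carrier)

lemma localization_cases:
  assumes "x \<in> carrier L"
  obtains a s where "a \<in> carrier R" "s \<in> S" "x = fraction R S a s"
  using assms by (auto simp: localization_carrier)

lemma localization_mult:
  assumes "a \<in> carrier R" "b \<in> carrier R" "s \<in> S" "t \<in> S"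
  shows "fraction R S a s \<otimes>\<^bsub>L\<^esub> fraction R S b t = fraction R S (a \<otimes> b) (s \<otimes> t)"
proof -
  obtain a' s' where 1: "rep (fraction R S a s) = (a', s')" "a' \<in> carrier R" "s' \<in> S"
    "fraction R S a' s' = fraction R S a s" using rep_fraction[OF assms(1,3)] .
  obtain b' t' where 2: "rep (fraction R S b t) = (b', t')" "b' \<in> carrier R" "t' \<in> S"
    "fraction R S b' t' = fraction R S b t" using rep_fraction[OF assms(2,4)] .
  obtain u where u: "u \<in> S" "u \<otimes> (a' \<otimes> s) = u \<otimes> (a \<otimes> s')"
    using 1(4) fraction_eq_iff[OF 1(2) assms(1) 1(3) assms(3)] by blast
  obtain v where v: "v \<in> S" "v \<otimes> (b' \<otimes> t) = v \<otimes> (b \<otimes> t')"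
    using 2(4) fraction_eq_iff[OF 2(2) assms(2) 2(3) assms(4)] by blast
  note cc = assms 1(2,3) 2(2,3) u(1) v(1)
  have "(u \<otimes> v) \<otimes> ((a' \<otimes> b') \<otimes> (s \<otimes> t)) = (u \<otimes> (a' \<otimes> s)) \<otimes> (v \<otimes> (b' \<otimes> t))"
    using cc by (simp add: m_ac)
  also have "\<dots> = (u \<otimes> v) \<otimes> ((a \<otimes> b) \<otimes> (s' \<otimes> t'))"
    unfolding u(2) v(2) using cc by (simp add: m_ac)
  finally have "fraction R S (a' \<otimes> b') (s' \<otimes> t') = fraction R S (a \<otimes> b) (s \<otimes> t)"
    using cc by (subst fraction_eq_iff) (auto intro: S_mult)
  then show ?thesis
    using 1(1) 2(1) by (simp add: localization_def Let_def)
qed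

lemma localization_add:
  assumes "a \<in> carrier R" "b \<in> carrier R" "s \<in> S" "t \<in> S"
  shows "fraction R S a s \<oplus>\<^bsub>L\<^esub> fraction R S b t
    = fraction R S (a \<otimes> t \<oplus> b \<otimes> s) (s \<otimes> t)"
proof -
  obtain a' s' where 1: "rep (fraction R S a s) = (a', s')" "a' \<in> carrier R" "s' \<in> S"
    "fraction R S a' s' = fraction R S a s" using rep_fraction[OF assms(1,3)] .
  obtain b' t' where 2: "rep (fraction R S b t) = (b', t')" "b' \<in> carrier R" "t' \<in> S"
    "fraction R S b' t' = fraction R S b t" using rep_fraction[OF assms(2,4)] .
  obtain u where u: "u \<in> S" "u \<otimes> (a' \<otimes> s) = u \<otimes> (a \<otimes> s')"
    using 1(4) fraction_eq_iff[OF 1(2) assms(1) 1(3) assms(3)] by blast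
  obtain v where v: "v \<in> S" "v \<otimes> (b' \<otimes> t) = v \<otimes> (b \<otimes> t')"
    using 2(4) fraction_eq_iff[OF 2(2) assms(2) 2(3) assms(4)] by blast
  note cc = assms 1(2,3) 2(2,3) u(1) v(1)
  have "(u \<otimes> v) \<otimes> ((a' \<otimes> t' \<oplus> b' \<otimes> s') \<otimes> (s \<otimes> t))
      = (v \<otimes> t \<otimes> t') \<otimes> (u \<otimes> (a' \<otimes> s)) \<oplus> (u \<otimes> s \<otimes> s') \<otimes> (v \<otimes> (b' \<otimes> t))"
    using cc by (simp add: m_ac r_distr l_distr)
  also have "\<dots> = (u \<otimes> v) \<otimes> ((a \<otimes> t \<oplus> b \<otimes> s) \<otimes> (s' \<otimes> t'))"
    unfolding u(2) v(2) using cc by (simp add: m_ac r_distr l_distr)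
  finally have "fraction R S (a' \<otimes> t' \<oplus> b' \<otimes> s') (s' \<otimes> t')
      = fraction R S (a \<otimes> t \<oplus> b \<otimes> s) (s \<otimes> t)"
    using cc by (subst fraction_eq_iff) (auto intro: S_mult)
  then show ?thesis
    using 1(1) 2(1) by (simp add: localization_def Let_def)
qed

lemma localization_add_same:
  assumes "a \<in> carrier R" "b \<in> carrier R" "s \<in> S"
  shows "fraction R S a s \<oplus>\<^bsub>L\<^esub> fraction R S b s = fraction R S (a \<oplus> b) s"
  using assms by (simp add: localization_add)
    (rule fraction_eqI; auto intro: S_mult simp: l_distr r_distr m_ac)

lemma localization_neg:
  assumes "a \<in> carrier R" "s \<in> S"
  shows "fraction R S (\<ominus> a) s \<oplus>\<^bsub>L\<^esub> fraction R S a s = \<zero>\<^bsub>L\<^esub>"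
  using assms S_one by (simp add: localization_add_same localization_zero)
    (rule fraction_eqI; auto simp: l_neg)

lemma localization_cring: "cring L"
proof (rule cringI)
  note S = S_one S_mult
  show "abelian_group L"
  proof (rule abelian_groupI)
    fix x y assume x: "x \<in> carrier L" and y: "y \<in> carrier L"
    obtain a s b t where 1: "a \<in> carrier R" "s \<in> S" "x = fraction R S a s"
      "b \<in> carrier R" "t \<in> S" "y = fraction R S b t"
      using localization_cases[OF x] localization_cases[OF y] by metis
    show "x \<oplus>\<^bsub>L\<^esub> y \<in> carrier L" using 1 S by (simp add: localization_add)
    show "x \<oplus>\<^bsub>L\<^esub> y = y \<oplus>\<^bsub>L\<^esub> x" using 1 S
      by (simp add: localization_add a_ac m_ac)
    fix z assume "z \<in> carrier L"
    then obtain c r where 2: "c \<in> carrier R" "r \<in> S" "z = fraction R S c r"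
      using localization_cases by metis
    show "x \<oplus>\<^bsub>L\<^esub> y \<oplus>\<^bsub>L\<^esub> z = x \<oplus>\<^bsub>L\<^esub> (y \<oplus>\<^bsub>L\<^esub> z)"
      using 1 2 S by (simp add: localization_add l_distr r_distr a_ac m_ac)
  next
    show "\<zero>\<^bsub>L\<^esub> \<in> carrier L" using S by (simp add: localization_zero)
    fix x assume x: "x \<in> carrier L"
    then obtain a s where 1: "a \<in> carrier R" "s \<in> S" "x = fraction R S a s"
      using localization_cases by metis
    show "\<zero>\<^bsub>L\<^esub> \<oplus>\<^bsub>L\<^esub> x = x"
      using 1 S by (simp add: localization_add localization_zero)
    show "\<exists>y\<in>carrier L. y \<oplus>\<^bsub>L\<^esub> x = \<zero>\<^bsub>L\<^esub>"
      using 1 localization_neg[OF 1(1,2)] by (intro bexI[of _ "fraction R S (\<ominus> a) s"]) auto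
  qed
  show "comm_monoid L"
  proof (rule comm_monoidI)
    show "\<one>\<^bsub>L\<^esub> \<in> carrier L" using S by (simp add: localization_one)
    fix x y assume x: "x \<in> carrier L" and y: "y \<in> carrier L"
    obtain a s b t where 1: "a \<in> carrier R" "s \<in> S" "x = fraction R S a s"
      "b \<in> carrier R" "t \<in> S" "y = fraction R S b t"
      using localization_cases[OF x] localization_cases[OF y] by metis
    show "x \<otimes>\<^bsub>L\<^esub> y \<in> carrier L" using 1 S by (simp add: localization_mult)
    show "x \<otimes>\<^bsub>L\<^esub> y = y \<otimes>\<^bsub>L\<^esub> x" using 1 S
      by (simp add: localization_mult m_ac)
    show "\<one>\<^bsub>L\<^esub> \<otimes>\<^bsub>L\<^esub> x = x"
      using 1 S by (simp add: localization_mult localization_one)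
    fix z assume "z \<in> carrier L"
    then obtain c r where 2: "c \<in> carrier R" "r \<in> S" "z = fraction R S c r"
      using localization_cases by metis
    show "x \<otimes>\<^bsub>L\<^esub> y \<otimes>\<^bsub>L\<^esub> z = x \<otimes>\<^bsub>L\<^esub> (y \<otimes>\<^bsub>L\<^esub> z)"
      using 1 2 S by (simp add: localization_mult m_ac)
  qed
  fix x y z assume x: "x \<in> carrier L" and y: "y \<in> carrier L" and z: "z \<in> carrier L"
  obtain a s b t c r where 1: "a \<in> carrier R" "s \<in> S" "x = fraction R S a s"
      "b \<in> carrier R" "t \<in> S" "y = fraction R S b t"
      "c \<in> carrier R" "r \<in> S" "z = fraction R S c r"
    using localization_cases[OF x] localization_cases[OF y] localization_cases[OF z] by metis
  have "fraction R S ((a \<otimes> t \<oplus> b \<otimes> s) \<otimes> c) (s \<otimes> t \<otimes> r)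
      = fraction R S ((a \<otimes> c) \<otimes> (t \<otimes> r) \<oplus> (b \<otimes> c) \<otimes> (s \<otimes> r)) ((s \<otimes> r) \<otimes> (t \<otimes> r))"
    using 1 S by (intro fraction_eqI) (auto simp: l_distr r_distr a_ac m_ac)
  then show "(x \<oplus>\<^bsub>L\<^esub> y) \<otimes>\<^bsub>L\<^esub> z = x \<otimes>\<^bsub>L\<^esub> z \<oplus>\<^bsub>L\<^esub> y \<otimes>\<^bsub>L\<^esub> z"
    using 1 S by (simp add: localization_add localization_mult)
qed

end

lemma mult_subset_prime:
  assumes "cring R" "primeideal P R"
  shows "mult_subset R (carrier R - P)"
proof -
  interpret cring R by fact
  interpret primeideal P R by fact
  show ?thesis
    by unfold_locales (use I_notcarr I_prime one_imp_carrier in auto)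
qed

definition localization_map ::
  "'b ring \<Rightarrow> 'b set \<Rightarrow> ('a \<Rightarrow> 'b) \<Rightarrow> ('a \<times> 'a) set \<Rightarrow> ('b \<times> 'b) set" where
  "localization_map R' S' \<phi> x = (let (a, s) = rep x in fraction R' S' (\<phi> a) (\<phi> s))"

text \<open>The choice of the representative does not matter: the element that witnesses the equality of two
  fractions is mapped to a witness for their images.\<close>

lemma localization_map_fraction:
  assumes "mult_subset R S" "mult_subset R' S'" "\<phi> \<in> ring_hom R R'" "\<phi> ` S \<subseteq> S'"
    and a: "a \<in> carrier R" "s \<in> S"
  shows "localization_map R' S' \<phi> (fraction R S a s) = fraction R' S' (\<phi> a) (\<phi> s)"
proof -
  interpret A: mult_subset R S by fact
  interpret B: mult_subset R' S' by fact
  interpret h: ring_hom_cring R R' \<phi>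
    using assms(3) by unfold_locales
  obtain b t where 1: "rep (fraction R S a s) = (b, t)" "b \<in> carrier R" "t \<in> S"
    "fraction R S b t = fraction R S a s" using A.rep_fraction[OF a] .
  obtain u where u: "u \<in> S" "u \<otimes>\<^bsub>R\<^esub> (b \<otimes>\<^bsub>R\<^esub> s) = u \<otimes>\<^bsub>R\<^esub> (a \<otimes>\<^bsub>R\<^esub> t)"
    using 1(4) A.fraction_eq_iff[OF 1(2) a(1) 1(3) a(2)] by blast
  have "\<phi> (u \<otimes>\<^bsub>R\<^esub> (b \<otimes>\<^bsub>R\<^esub> s)) = \<phi> (u \<otimes>\<^bsub>R\<^esub> (a \<otimes>\<^bsub>R\<^esub> t))" using u(2) by simp
  then have "\<phi> u \<otimes>\<^bsub>R'\<^esub> (\<phi> b \<otimes>\<^bsub>R'\<^esub> \<phi> s) = \<phi> u \<otimes>\<^bsub>R'\<^esub> (\<phi> a \<otimes>\<^bsub>R'\<^esub> \<phi> t)"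
    using u(1) 1(2,3) a by simp
  then have "fraction R' S' (\<phi> b) (\<phi> t) = fraction R' S' (\<phi> a) (\<phi> s)"
    using u(1) 1 a assms(4) by (subst B.fraction_eq_iff) auto
  then show ?thesis using 1(1) by (simp add: localization_map_def)
qed

lemma localization_map_hom:
  assumes hyps: "mult_subset R S" "mult_subset R' S'" "\<phi> \<in> ring_hom R R'" "\<phi> ` S \<subseteq> S'"
  shows "localization_map R' S' \<phi> \<in> ring_hom (localization R S) (localization R' S')"
proof -
  interpret A: mult_subset R S by fact
  interpret B: mult_subset R' S' by fact
  interpret h: ring_hom_cring R R' \<phi>
    using hyps(3) by unfold_locales
  note frac = localization_map_fraction[OF hyps]
  have S': "\<phi> s \<in> S'" if "s \<in> S" for s using that hyps(4) by blast
  show ?thesis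
  proof (rule ring_hom_memI)
    show "localization_map R' S' \<phi> x \<in> carrier B.L" if "x \<in> carrier A.L" for x
      using A.localization_cases[OF that] frac S' by (metis B.fraction_closed h.hom_closed)
    show "localization_map R' S' \<phi> \<one>\<^bsub>A.L\<^esub> = \<one>\<^bsub>B.L\<^esub>"
      using A.S_one by (simp add: A.localization_one B.localization_one frac)
    fix x y assume x: "x \<in> carrier A.L" and y: "y \<in> carrier A.L"
    obtain a s where a: "a \<in> carrier R" "s \<in> S" "x = fraction R S a s"
      using A.localization_cases[OF x] .
    obtain b t where b: "b \<in> carrier R" "t \<in> S" "y = fraction R S b t"
      using A.localization_cases[OF y] .
    show "localization_map R' S' \<phi> (x \<otimes>\<^bsub>A.L\<^esub> y)
        = localization_map R' S' \<phi> x \<otimes>\<^bsub>B.L\<^esub> localization_map R' S' \<phi> y"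
      using a b S' A.S_mult by (simp add: A.localization_mult B.localization_mult frac)
    show "localization_map R' S' \<phi> (x \<oplus>\<^bsub>A.L\<^esub> y)
        = localization_map R' S' \<phi> x \<oplus>\<^bsub>B.L\<^esub> localization_map R' S' \<phi> y"
      using a b S' A.S_mult by (simp add: A.localization_add B.localization_add frac)
  qed
qed

section \<open>Rings of families with componentwise operations\<close>

text \<open>Sections over an open set of a spectrum and sections over an open set of a formal spectrum are
  both families with componentwise operations, indexed by points and by thickenings.  The ring
  axioms are therefore checked once, for subsets of products closed under the operations.\<close>

definition pointwise_ring :: "'i set \<Rightarrow> ('i \<Rightarrow> 'a ring) \<Rightarrow> ('i \<Rightarrow> 'a) set \<Rightarrow> ('i \<Rightarrow> 'a) ring" where
  "pointwise_ring I K C =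
     \<lparr>carrier = C,
      monoid.mult = (\<lambda>s t. \<lambda>i\<in>I. s i \<otimes>\<^bsub>K i\<^esub> t i),
      one = (\<lambda>i\<in>I. \<one>\<^bsub>K i\<^esub>),
      zero = (\<lambda>i\<in>I. \<zero>\<^bsub>K i\<^esub>),
      add = (\<lambda>s t. \<lambda>i\<in>I. s i \<oplus>\<^bsub>K i\<^esub> t i)\<rparr>"

locale pointwise_subring =
  fixes I :: "'i set" and K :: "'i \<Rightarrow> 'a ring" and C :: "('i \<Rightarrow> 'a) set"
  assumes K_cring: "i \<in> I \<Longrightarrow> cring (K i)"
    and C_sub: "C \<subseteq> (\<Pi>\<^sub>E i\<in>I. carrier (K i))"
    and C_one: "(\<lambda>i\<in>I. \<one>\<^bsub>K i\<^esub>) \<in> C"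
    and C_add: "\<lbrakk>s \<in> C; t \<in> C\<rbrakk> \<Longrightarrow> (\<lambda>i\<in>I. s i \<oplus>\<^bsub>K i\<^esub> t i) \<in> C"
    and C_mult: "\<lbrakk>s \<in> C; t \<in> C\<rbrakk> \<Longrightarrow> (\<lambda>i\<in>I. s i \<otimes>\<^bsub>K i\<^esub> t i) \<in> C"
    and C_neg: "s \<in> C \<Longrightarrow> (\<lambda>i\<in>I. \<ominus>\<^bsub>K i\<^esub> s i) \<in> C"
begin

lemma C_val: "\<lbrakk>s \<in> C; i \<in> I\<rbrakk> \<Longrightarrow> s i \<in> carrier (K i)"
  using C_sub by (auto simp: PiE_iff subset_iff)

lemma C_restrict: "s \<in> C \<Longrightarrow> restrict s I = s"
  using C_sub by (auto simp: PiE_iff extensional_restrict subset_iff)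

lemma C_zero: "(\<lambda>i\<in>I. \<zero>\<^bsub>K i\<^esub>) \<in> C"
proof -
  have "(\<lambda>i\<in>I. (\<lambda>i\<in>I. \<one>\<^bsub>K i\<^esub>) i \<oplus>\<^bsub>K i\<^esub> (\<lambda>i\<in>I. \<ominus>\<^bsub>K i\<^esub> (\<lambda>i\<in>I. \<one>\<^bsub>K i\<^esub>) i) i) \<in> C"
    by (intro C_add C_neg C_one)
  moreover have "(\<lambda>i\<in>I. (\<lambda>i\<in>I. \<one>\<^bsub>K i\<^esub>) i \<oplus>\<^bsub>K i\<^esub> (\<lambda>i\<in>I. \<ominus>\<^bsub>K i\<^esub> (\<lambda>i\<in>I. \<one>\<^bsub>K i\<^esub>) i) i)
      = (\<lambda>i\<in>I. \<zero>\<^bsub>K i\<^esub>)"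
    using K_cring by (intro restrict_ext) (simp add: cring.cring_simprules(6,17))
  ultimately show ?thesis by simp
qed

abbreviation "P \<equiv> pointwise_ring I K C"

lemma pointwise_cring: "cring P"
proof (rule cringI)
  note R = pointwise_ring_def
  have r: "restrict g I = s" if "s \<in> C" "\<And>i. i \<in> I \<Longrightarrow> g i = s i" for g s
    using restrict_ext[of I g s] that C_restrict by simp
  show "abelian_group P"
  proof (rule abelian_groupI)
    fix s t u assume *: "s \<in> carrier P"
      "t \<in> carrier P" "u \<in> carrier P"
    then show "s \<oplus>\<^bsub>P\<^esub> t \<oplus>\<^bsub>P\<^esub> u
        = s \<oplus>\<^bsub>P\<^esub> (t \<oplus>\<^bsub>P\<^esub> u)"
      by (simp add: R) (rule restrict_ext, simp add: C_val K_cring cring.cring_simprules(7))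
  next
    fix s t assume *: "s \<in> carrier P" "t \<in> carrier P"
    then show "s \<oplus>\<^bsub>P\<^esub> t = t \<oplus>\<^bsub>P\<^esub> s"
      by (simp add: R) (rule restrict_ext, simp add: C_val K_cring cring.cring_simprules(10))
    show "s \<oplus>\<^bsub>P\<^esub> t \<in> carrier P"
      using * C_add by (simp add: R)
  next
    show "\<zero>\<^bsub>P\<^esub> \<in> carrier P"
      by (simp add: R C_zero)
    fix s assume *: "s \<in> carrier P"
    show "\<zero>\<^bsub>P\<^esub> \<oplus>\<^bsub>P\<^esub> s = s"
      using * by (simp add: R) (rule r, auto simp: C_val K_cring cring.cring_simprules(8,12))
    show "\<exists>y\<in>carrier P.
        y \<oplus>\<^bsub>P\<^esub> s = \<zero>\<^bsub>P\<^esub>"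
      using * C_neg[of s]
      by (intro bexI[of _ "\<lambda>i\<in>I. \<ominus>\<^bsub>K i\<^esub> s i"])
        (simp add: R, rule restrict_ext, simp_all add: R C_val K_cring cring.cring_simprules(9))
  qed
  show "Group.comm_monoid P"
  proof (rule comm_monoidI)
    show "\<one>\<^bsub>P\<^esub> \<in> carrier P"
      by (simp add: R C_one)
    fix s t assume *: "s \<in> carrier P" "t \<in> carrier P"
    show "s \<otimes>\<^bsub>P\<^esub> t = t \<otimes>\<^bsub>P\<^esub> s"
      using * by (simp add: R) (rule restrict_ext, simp add: C_val K_cring cring.cring_simprules(14))
    show "s \<otimes>\<^bsub>P\<^esub> t \<in> carrier P"
      using * C_mult by (simp add: R)
    show "\<one>\<^bsub>P\<^esub> \<otimes>\<^bsub>P\<^esub> s = s"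
      using * by (simp add: R) (rule r, auto simp: C_val K_cring cring.cring_simprules(8,12))
    fix u assume "u \<in> carrier P"
    then show "s \<otimes>\<^bsub>P\<^esub> t \<otimes>\<^bsub>P\<^esub> u
        = s \<otimes>\<^bsub>P\<^esub> (t \<otimes>\<^bsub>P\<^esub> u)"
      using * by (simp add: R) (rule restrict_ext, simp add: C_val K_cring cring.cring_simprules(5,11))
  qed
  fix s t u assume *: "s \<in> carrier P"
    "t \<in> carrier P" "u \<in> carrier P"
  then show "(s \<oplus>\<^bsub>P\<^esub> t) \<otimes>\<^bsub>P\<^esub> u
     = s \<otimes>\<^bsub>P\<^esub> u \<oplus>\<^bsub>P\<^esub> t \<otimes>\<^bsub>P\<^esub> u"
    by (simp add: R) (rule restrict_ext, simp add: C_val K_cring cring.cring_simprules(1,5,13))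
qed

lemma pointwise_neg:
  assumes "s \<in> C"
  shows "\<ominus>\<^bsub>P\<^esub> s = (\<lambda>i\<in>I. \<ominus>\<^bsub>K i\<^esub> s i)"
proof -
  interpret P: cring P by (rule pointwise_cring)
  have "(\<lambda>i\<in>I. \<ominus>\<^bsub>K i\<^esub> s i) \<oplus>\<^bsub>P\<^esub> s = \<zero>\<^bsub>P\<^esub>"
    using assms C_neg[OF assms]
    by (simp add: pointwise_ring_def, intro restrict_ext) (simp add: C_val K_cring cring.cring_simprules(9))
  then show ?thesis
    by (rule P.minus_equality) (auto simp: pointwise_ring_def assms C_neg)
qed

end


section \<open>Spectra and their structure sheaves\<close>

lemma spec_proper: "P \<in> spec R \<Longrightarrow> \<one>\<^bsub>R\<^esub> \<notin> P"
  unfolding spec_def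
  by (metis mem_Collect_eq primeideal.I_notcarr primeideal_def ideal.one_imp_carrier)

lemma spec_mult_subset: "\<lbrakk>cring R; P \<in> spec R\<rbrakk> \<Longrightarrow> mult_subset R (carrier R - P)"
  by (simp add: mult_subset_prime spec_def)

lemma spec_mult_notin:
  "\<lbrakk>P \<in> spec R; f \<in> carrier R; g \<in> carrier R; f \<notin> P; g \<notin> P\<rbrakk> \<Longrightarrow> f \<otimes>\<^bsub>R\<^esub> g \<notin> P"
  using primeideal.I_prime[of P R f g] by (auto simp: spec_def)

lemma topspace_zariski: "cring R \<Longrightarrow> topspace (zariski R) = spec R"
  using spec_proper[of _ R] cring.cring_simprules(6)[of R]
  by (auto simp: zariski_def)

lemma zariski_subset: "\<lbrakk>cring R; openin (zariski R) U; P \<in> U\<rbrakk> \<Longrightarrow> P \<in> spec R"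
  using openin_subset topspace_zariski by blast

text \<open>This is why an open set that contains the closed point of a local spectrum is the whole spectrum.\<close>

lemma zariski_generization:
  assumes "openin (zariski R) U" "P \<in> U" "Q \<in> spec R" "Q \<subseteq> P"
  shows "Q \<in> U"
proof -
  have "generate_topology_on {{P \<in> spec R. f \<notin> P} | f. f \<in> carrier R} U"
    using assms(1) unfolding zariski_def openin_topology_generated_by_iff .
  then show ?thesis using assms(2)
    by induction (use assms in auto)
qed

lemma spec_contract:
  assumes "cring R" "cring S" "\<phi> \<in> ring_hom R S" "Q \<in> spec S"
  shows "contract R \<phi> Q \<in> spec R"
proof -
  interpret R: cring R by fact
  interpret S: cring S by fact
  interpret ring_hom_cring R S \<phi>
    using assms(3) by unfold_locales
  interpret Q: primeideal Q S using assms(4) by (simp add: spec_def)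
  have "primeideal (contract R \<phi> Q) R"
  proof (rule primeidealI)
    show "ideal (contract R \<phi> Q) R"
    proof (rule idealI[OF R.ring_axioms])
      show "subgroup (contract R \<phi> Q) (add_monoid R)"
        by (rule R.add.subgroupI)
          (auto simp: contract_def intro!: exI[of _ "\<zero>\<^bsub>R\<^esub>"] Q.a_closed)
    qed (auto simp: contract_def Q.I_l_closed Q.I_r_closed)
    show "cring R" by fact
    show "carrier R \<noteq> contract R \<phi> Q"
      using Q.I_notcarr Q.one_imp_carrier by (force simp: contract_def)
    show "a \<in> contract R \<phi> Q \<or> b \<in> contract R \<phi> Q"
      if "a \<in> carrier R" "b \<in> carrier R" "a \<otimes>\<^bsub>R\<^esub> b \<in> contract R \<phi> Q" for a b
      using that Q.I_prime by (auto simp: contract_def)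
  qed
  then show ?thesis by (simp add: spec_def)
qed

lemma spec_preimage_open:
  assumes "cring R" "cring S" "\<phi> \<in> ring_hom R S" "openin (zariski R) U"
  shows "openin (zariski S) (spec_preimage R S \<phi> U)"
proof -
  have c: "contract R \<phi> Q \<in> spec R" if "Q \<in> spec S" for Q
    using spec_contract[OF assms(1-3) that] .
  have "generate_topology_on {{P \<in> spec R. f \<notin> P} | f. f \<in> carrier R} U"
    using assms(4) unfolding zariski_def openin_topology_generated_by_iff .
  then show ?thesis
  proof induction
    case Empty
    then show ?case by (simp add: spec_preimage_def)
  next
    case (Int a b)
    moreover have "spec_preimage R S \<phi> (a \<inter> b) = spec_preimage R S \<phi> a \<inter> spec_preimage R S \<phi> b"
      by (auto simp: spec_preimage_def)
    ultimately show ?case by (simp add: openin_Int)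
  next
    case (UN K)
    moreover have "spec_preimage R S \<phi> (\<Union>K) = \<Union>(spec_preimage R S \<phi> ` K)"
      by (auto simp: spec_preimage_def)
    ultimately show ?case by (auto intro!: openin_Union)
  next
    case (Basis s)
    then obtain f where f: "f \<in> carrier R" "s = {P \<in> spec R. f \<notin> P}" by blast
    have "spec_preimage R S \<phi> s = {Q \<in> spec S. \<phi> f \<notin> Q}"
      using c f by (auto simp: spec_preimage_def contract_def)
    moreover have "\<phi> f \<in> carrier S" using f assms(3) by (simp add: ring_hom_closed)
    ultimately show ?case unfolding zariski_def
      by (auto intro!: topology_generated_by_Basis)
  qed
qed

lemma spec_sect_alt:
  "spec_sect R U = pointwise_ring U (local_ring_at R) (carrier (spec_sect R U))"
  by (simp add: spec_sect_def pointwise_ring_def)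

abbreviation locally_fraction ::
  "'a ring \<Rightarrow> 'a set set \<Rightarrow> ('a set \<Rightarrow> ('a \<times> 'a) set) \<Rightarrow> 'a set \<Rightarrow> bool" where
  "locally_fraction R U s P \<equiv> \<exists>V a f. openin (zariski R) V \<and> P \<in> V \<and> V \<subseteq> U \<and>
     a \<in> carrier R \<and> f \<in> carrier R \<and> (\<forall>Q\<in>V. f \<notin> Q \<and> s Q = frac_at R Q a f)"

lemma spec_sect_carrierI:
  assumes "\<And>P. P \<notin> U \<Longrightarrow> s P = undefined" "U \<subseteq> spec R" "cring R"
    "\<And>P. P \<in> U \<Longrightarrow> locally_fraction R U s P"
  shows "s \<in> carrier (spec_sect R U)"
proof -
  have "s P \<in> carrier (local_ring_at R P)" if P: "P \<in> U" for P
  proof -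
    obtain a f where "a \<in> carrier R" "f \<in> carrier R - P" "s P = frac_at R P a f"
      using assms(4)[OF P] by blast
    then show ?thesis
      using mult_subset.fraction_closed[OF spec_mult_subset[OF assms(3)], of P a f] P assms(2)
      by auto
  qed
  then show ?thesis
    using assms(1,4) by (simp add: spec_sect_def PiE_iff extensional_def)
qed

lemma spec_sectD:
  assumes "s \<in> carrier (spec_sect R U)"
  shows spec_sect_extensional: "P \<notin> U \<Longrightarrow> s P = undefined"
    and spec_sect_local: "P \<in> U \<Longrightarrow> locally_fraction R U s P"
  using assms by (auto simp: spec_sect_def PiE_iff extensional_def)

lemma spec_sect_eqI:
  assumes "s \<in> carrier (spec_sect R U)" "t \<in> carrier (spec_sect R U)"
    and "\<And>P. P \<in> U \<Longrightarrow> s P = t P"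
  shows "s = t"
proof
  fix P
  show "s P = t P"
    using assms spec_sect_extensional[of s R U P] spec_sect_extensional[of t R U P] by (cases "P \<in> U") auto
qed

lemma spec_sect_at:
  assumes "s \<in> carrier (spec_sect R U)" "P \<in> U"
  obtains a f where "a \<in> carrier R" "f \<in> carrier R" "f \<notin> P" "s P = frac_at R P a f"
  using spec_sect_local[OF assms] by blast

lemma spec_sect_pointwise_subring:
  fixes R :: "'a ring" (structure)
  assumes R: "cring R" and U: "openin (zariski R) U"
  shows "pointwise_subring U (local_ring_at R) (carrier (spec_sect R U))"
proof -
  interpret cring R by fact
  have Us: "U \<subseteq> spec R" using zariski_subset[OF R U] by blast
  have ms: "mult_subset R (carrier R - P)" if "P \<in> U" for P
    using spec_mult_subset[OF R] Us that by blast
  show ?thesis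
  proof (rule pointwise_subring.intro)
    show "cring (local_ring_at R P)" if "P \<in> U" for P
      using ms[OF that] by (rule mult_subset.localization_cring)
    show "carrier (spec_sect R U) \<subseteq> (\<Pi>\<^sub>E P\<in>U. carrier (local_ring_at R P))"
      by (auto simp: spec_sect_def)
    show "(\<lambda>P\<in>U. \<one>\<^bsub>local_ring_at R P\<^esub>) \<in> carrier (spec_sect R U)"
    proof (rule spec_sect_carrierI[OF _ Us R])
      fix P assume "P \<in> U"
      then show "locally_fraction R U (\<lambda>P\<in>U. \<one>\<^bsub>local_ring_at R P\<^esub>) P"
        using U Us spec_proper
        by (intro exI[of _ U] exI[of _ "\<one>"]) (auto simp: localization_def)
    qed auto
    fix s t
    assume s: "s \<in> carrier (spec_sect R U)"
    show "(\<lambda>P\<in>U. \<ominus>\<^bsub>local_ring_at R P\<^esub> s P) \<in> carrier (spec_sect R U)"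
    proof (rule spec_sect_carrierI[OF _ Us R])
      fix P assume "P \<in> U"
      then obtain V a f where V: "openin (zariski R) V" "P \<in> V" "V \<subseteq> U" "a \<in> carrier R"
          "f \<in> carrier R" "\<And>Q. Q \<in> V \<Longrightarrow> f \<notin> Q" "\<And>Q. Q \<in> V \<Longrightarrow> s Q = frac_at R Q a f"
        using spec_sect_local[OF s] by metis
      have "(\<lambda>P\<in>U. \<ominus>\<^bsub>local_ring_at R P\<^esub> s P) Q = frac_at R Q (\<ominus> a) f" if Q: "Q \<in> V" for Q
      proof -
        interpret M: mult_subset R "carrier R - Q" using ms Q V(3) by blast
        interpret L: cring "local_ring_at R Q" by (rule M.localization_cring)
        have "\<ominus>\<^bsub>local_ring_at R Q\<^esub> s Q = frac_at R Q (\<ominus> a) f"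
          using V Q M.localization_neg[of a f] by (intro L.minus_equality) auto
        then show ?thesis using Q V(3) by auto
      qed
      then show "locally_fraction R U (\<lambda>P\<in>U. \<ominus>\<^bsub>local_ring_at R P\<^esub> s P) P"
        using V by (intro exI[of _ V] exI[of _ "\<ominus> a"] exI[of _ f]) auto
    qed auto
    assume t: "t \<in> carrier (spec_sect R U)"
    have ex: "\<exists>V a b f g. openin (zariski R) V \<and> P \<in> V \<and> V \<subseteq> U \<and> a \<in> carrier R \<and> b \<in> carrier R \<and>
        f \<in> carrier R \<and> g \<in> carrier R \<and> (\<forall>Q\<in>V. f \<notin> Q \<and> g \<notin> Q \<and> f \<otimes> g \<notin> Q \<and>
         s Q = frac_at R Q a f \<and> t Q = frac_at R Q b g)"
      if "P \<in> U" for P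
    proof -
      obtain V a f where 1: "openin (zariski R) V" "P \<in> V" "V \<subseteq> U" "a \<in> carrier R"
          "f \<in> carrier R" "\<And>Q. Q \<in> V \<Longrightarrow> f \<notin> Q" "\<And>Q. Q \<in> V \<Longrightarrow> s Q = frac_at R Q a f"
        using spec_sect_local[OF s \<open>P \<in> U\<close>] by metis
      obtain W b g where 2: "openin (zariski R) W" "P \<in> W" "W \<subseteq> U" "b \<in> carrier R"
          "g \<in> carrier R" "\<And>Q. Q \<in> W \<Longrightarrow> g \<notin> Q" "\<And>Q. Q \<in> W \<Longrightarrow> t Q = frac_at R Q b g"
        using spec_sect_local[OF t \<open>P \<in> U\<close>] by metis
      have 3: "f \<otimes> g \<notin> Q" if "Q \<in> V \<inter> W" for Q
        using 1 2 Us that by (intro spec_mult_notin) auto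
      have 4: "openin (zariski R) (V \<inter> W)" using 1(1) 2(1) by (rule openin_Int)
      show ?thesis
        by (intro exI[of _ "V \<inter> W"] exI[of _ a] exI[of _ b] exI[of _ f] exI[of _ g])
          (use 1 2 3 4 in \<open>simp add: subset_iff\<close>)
    qed
    show "(\<lambda>P\<in>U. s P \<oplus>\<^bsub>local_ring_at R P\<^esub> t P) \<in> carrier (spec_sect R U)"
    proof (rule spec_sect_carrierI[OF _ Us R])
      fix P assume "P \<in> U"
      from ex[OF this] obtain V a b f g where V: "openin (zariski R) V" "P \<in> V" "V \<subseteq> U"
        "a \<in> carrier R" "b \<in> carrier R" "f \<in> carrier R" "g \<in> carrier R"
        "\<And>Q. Q \<in> V \<Longrightarrow> f \<notin> Q \<and> g \<notin> Q \<and> f \<otimes> g \<notin> Q \<and> s Q = frac_at R Q a f \<and> t Q = frac_at R Q b g"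
        by metis
      have "(\<lambda>P\<in>U. s P \<oplus>\<^bsub>local_ring_at R P\<^esub> t P) Q = frac_at R Q (a \<otimes> g \<oplus> b \<otimes> f) (f \<otimes> g)"
        if Q: "Q \<in> V" for Q
        using V Q mult_subset.localization_add[OF ms, of Q a b f g] by auto
      then show "locally_fraction R U (\<lambda>P\<in>U. s P \<oplus>\<^bsub>local_ring_at R P\<^esub> t P) P"
        using V by (intro exI[of _ V] exI[of _ "a \<otimes> g \<oplus> b \<otimes> f"] exI[of _ "f \<otimes> g"]) auto
    qed auto
    show "(\<lambda>P\<in>U. s P \<otimes>\<^bsub>local_ring_at R P\<^esub> t P) \<in> carrier (spec_sect R U)"
    proof (rule spec_sect_carrierI[OF _ Us R])
      fix P assume "P \<in> U"
      from ex[OF this] obtain V a b f g where V: "openin (zariski R) V" "P \<in> V" "V \<subseteq> U"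
        "a \<in> carrier R" "b \<in> carrier R" "f \<in> carrier R" "g \<in> carrier R"
        "\<And>Q. Q \<in> V \<Longrightarrow> f \<notin> Q \<and> g \<notin> Q \<and> f \<otimes> g \<notin> Q \<and> s Q = frac_at R Q a f \<and> t Q = frac_at R Q b g"
        by metis
      have "(\<lambda>P\<in>U. s P \<otimes>\<^bsub>local_ring_at R P\<^esub> t P) Q = frac_at R Q (a \<otimes> b) (f \<otimes> g)"
        if Q: "Q \<in> V" for Q
        using V Q mult_subset.localization_mult[OF ms, of Q a b f g] by auto
      then show "locally_fraction R U (\<lambda>P\<in>U. s P \<otimes>\<^bsub>local_ring_at R P\<^esub> t P) P"
        using V by (intro exI[of _ V] exI[of _ "a \<otimes> b"] exI[of _ "f \<otimes> g"]) auto
    qed auto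
  qed
qed

lemma spec_sect_cring: "\<lbrakk>cring R; openin (zariski R) U\<rbrakk> \<Longrightarrow> cring (spec_sect R U)"
  by (subst spec_sect_alt) (rule pointwise_subring.pointwise_cring[OF spec_sect_pointwise_subring])

lemma spec_sect_restrict:
  assumes "cring R" "openin (zariski R) V" "V \<subseteq> U" "s \<in> carrier (spec_sect R U)"
  shows "restrict s V \<in> carrier (spec_sect R V)"
proof (rule spec_sect_carrierI[OF _ _ assms(1)])
  show "V \<subseteq> spec R" using zariski_subset[OF assms(1,2)] by blast
  fix P assume "P \<in> V"
  then have "P \<in> U" using assms(3) by blast
  then obtain W a f where W: "openin (zariski R) W" "P \<in> W" "W \<subseteq> U" "a \<in> carrier R"
      "f \<in> carrier R" "\<And>Q. Q \<in> W \<Longrightarrow> f \<notin> Q" "\<And>Q. Q \<in> W \<Longrightarrow> s Q = frac_at R Q a f"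
    using spec_sect_local[OF assms(4)] by metis
  then show "locally_fraction R V (restrict s V) P"
    using assms(2) \<open>P \<in> V\<close> by (intro exI[of _ "W \<inter> V"] exI[of _ a] exI[of _ f]) auto
qed auto

lemma spec_pullback_alt:
  "spec_pullback R S \<phi> U s =
     (\<lambda>Q\<in>spec_preimage R S \<phi> U. localization_map S (carrier S - Q) \<phi> (s (contract R \<phi> Q)))"
  by (simp add: spec_pullback_def localization_map_def)

lemma contract_local_hyps:
  assumes "cring R" "cring S" "\<phi> \<in> ring_hom R S" "Q \<in> spec_preimage R S \<phi> U"
  shows "mult_subset R (carrier R - contract R \<phi> Q)" "mult_subset S (carrier S - Q)"
    "\<phi> \<in> ring_hom R S" "\<phi> ` (carrier R - contract R \<phi> Q) \<subseteq> carrier S - Q"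
proof -
  have Q: "Q \<in> spec S" using assms(4) by (simp add: spec_preimage_def)
  show "mult_subset R (carrier R - contract R \<phi> Q)" "mult_subset S (carrier S - Q)"
    by (intro spec_mult_subset spec_contract[OF assms(1-3)] assms Q)+
  show "\<phi> ` (carrier R - contract R \<phi> Q) \<subseteq> carrier S - Q"
    using assms(3) by (auto simp: contract_def ring_hom_closed)
qed (rule assms(3))

lemma spec_pullback_at:
  assumes "cring R" "cring S" "\<phi> \<in> ring_hom R S" "Q \<in> spec_preimage R S \<phi> U"
    "a \<in> carrier R" "f \<in> carrier R" "f \<notin> contract R \<phi> Q"
    "s (contract R \<phi> Q) = frac_at R (contract R \<phi> Q) a f"
  shows "spec_pullback R S \<phi> U s Q = frac_at S Q (\<phi> a) (\<phi> f)"
  using localization_map_fraction[OF contract_local_hyps[OF assms(1-4)], of a f] assms(4-8)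
  by (simp add: spec_pullback_alt)

lemma spec_pullback_carrier:
  assumes "cring R" "cring S" "\<phi> \<in> ring_hom R S" "s \<in> carrier (spec_sect R U)"
  shows "spec_pullback R S \<phi> U s \<in> carrier (spec_sect S (spec_preimage R S \<phi> U))"
proof (rule spec_sect_carrierI[OF _ _ assms(2)])
  show "spec_preimage R S \<phi> U \<subseteq> spec S" by (auto simp: spec_preimage_def)
  show "spec_pullback R S \<phi> U s Q = undefined" if "Q \<notin> spec_preimage R S \<phi> U" for Q
    using that by (simp add: spec_pullback_def)
  fix Q assume Q: "Q \<in> spec_preimage R S \<phi> U"
  then have "contract R \<phi> Q \<in> U" by (simp add: spec_preimage_def)
  then obtain V a f where V: "openin (zariski R) V" "contract R \<phi> Q \<in> V" "V \<subseteq> U"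
    "a \<in> carrier R" "f \<in> carrier R" "\<And>P. P \<in> V \<Longrightarrow> f \<notin> P" "\<And>P. P \<in> V \<Longrightarrow> s P = frac_at R P a f"
    using spec_sect_local[OF assms(4)] by metis
  show "locally_fraction S (spec_preimage R S \<phi> U) (spec_pullback R S \<phi> U s) Q"
  proof (intro exI conjI ballI)
    show "openin (zariski S) (spec_preimage R S \<phi> V)"
      by (rule spec_preimage_open[OF assms(1-3) V(1)])
    show "Q \<in> spec_preimage R S \<phi> V" using Q V(2) by (simp add: spec_preimage_def)
    show sub: "spec_preimage R S \<phi> V \<subseteq> spec_preimage R S \<phi> U"
      using V(3) by (auto simp: spec_preimage_def)
    show "\<phi> a \<in> carrier S" "\<phi> f \<in> carrier S" using V assms(3) by (auto simp: ring_hom_closed)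
    fix P assume P: "P \<in> spec_preimage R S \<phi> V"
    then have c: "contract R \<phi> P \<in> V" by (simp add: spec_preimage_def)
    show "\<phi> f \<notin> P" using V(6)[OF c] V(5) by (simp add: contract_def)
    show "spec_pullback R S \<phi> U s P = frac_at S P (\<phi> a) (\<phi> f)"
      using V sub P c by (intro spec_pullback_at[OF assms(1-3)]) auto
  qed
qed

lemma spec_pullback_hom:
  assumes R: "cring R" and S: "cring S" and \<phi>: "\<phi> \<in> ring_hom R S"
  shows "spec_pullback R S \<phi> U \<in> ring_hom (spec_sect R U) (spec_sect S (spec_preimage R S \<phi> U))"
proof -
  let ?W = "spec_preimage R S \<phi> U" and ?c = "contract R \<phi>"
  let ?S = "spec_sect R U" and ?T = "spec_sect S ?W"
  have hom: "localization_map S (carrier S - Q) \<phi> \<in> ring_hom (local_ring_at R (?c Q)) (local_ring_at S Q)"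
    if "Q \<in> ?W" for Q
    by (rule localization_map_hom[OF contract_local_hyps[OF R S \<phi> that]])
  have U: "?c Q \<in> U" if "Q \<in> ?W" for Q using that by (simp add: spec_preimage_def)
  have val: "s (?c Q) \<in> carrier (local_ring_at R (?c Q))" if "s \<in> carrier ?S" "Q \<in> ?W" for s Q
    using that(1) U[OF that(2)] by (auto simp: spec_sect_def)
  show ?thesis
  proof (rule ring_hom_memI)
    show "spec_pullback R S \<phi> U s \<in> carrier ?T" if "s \<in> carrier ?S" for s
      by (rule spec_pullback_carrier[OF R S \<phi> that])
    show "spec_pullback R S \<phi> U \<one>\<^bsub>?S\<^esub> = \<one>\<^bsub>?T\<^esub>"
      by (simp add: spec_pullback_alt spec_sect_def, rule restrict_ext) (simp add: U ring_hom_one[OF hom])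
    fix s t assume s: "s \<in> carrier ?S" and t: "t \<in> carrier ?S"
    show "spec_pullback R S \<phi> U (s \<otimes>\<^bsub>?S\<^esub> t)
        = spec_pullback R S \<phi> U s \<otimes>\<^bsub>?T\<^esub> spec_pullback R S \<phi> U t"
      by (simp add: spec_pullback_alt spec_sect_def, rule restrict_ext)
        (simp add: U ring_hom_mult[OF hom val[OF s] val[OF t]])
    show "spec_pullback R S \<phi> U (s \<oplus>\<^bsub>?S\<^esub> t)
        = spec_pullback R S \<phi> U s \<oplus>\<^bsub>?T\<^esub> spec_pullback R S \<phi> U t"
      by (simp add: spec_pullback_alt spec_sect_def, rule restrict_ext)
        (simp add: U ring_hom_add[OF hom val[OF s] val[OF t]])
  qed
qed

section \<open>Affine formal schemes\<close>

locale adic_pair = cring A + I: ideal I A for A :: "'a ring" (structure) and I :: "'a set"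
begin

abbreviation "ipow \<equiv> ideal_power A I"
abbreviation "B \<equiv> thick A I"
abbreviation "\<pi> \<equiv> to_thick A I"
abbreviation "\<tau> \<equiv> thick_step A I"
abbreviation "X \<equiv> spf_base A I"
abbreviation "\<O> \<equiv> spf_sect A I"
abbreviation "W \<equiv> thick_open A I"
abbreviation "\<rho> \<equiv> spf_res A I"
abbreviation "\<T> \<equiv> spf_sect_top A I"
abbreviation "level n U \<equiv> spec_sect (B n) (W n U)"
abbreviation "pull n U \<equiv> spec_pullback (B (Suc n)) (B n) (\<tau> n) (W (Suc n) U)"

lemma ipow_ideal: "ideal (ipow n) A"
  by (induction n) (auto simp: oneideal intro: ideal_prod_is_ideal I.is_ideal)

lemma ipow_carrier: "ipow n \<subseteq> carrier A"
  by (rule additive_subgroup.a_subset[OF ideal.axioms(1)[OF ipow_ideal]])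

lemma ipow_Suc_subset: "ipow (Suc n) \<subseteq> ipow n"
  using ideal_prod_inter[OF ipow_ideal I.is_ideal, of n] by simp

lemma thick_cring: "cring (B n)"
  unfolding thick_def by (rule ideal.quotient_is_cring[OF ipow_ideal is_cring])

lemma thick_carrier: "carrier (B n) = \<pi> n ` carrier A"
  by (auto simp: thick_def to_thick_def FactRing_def A_RCOSETS_def')

lemma to_thick_hom: "\<pi> n \<in> ring_hom A (B n)"
  using ideal.rcos_ring_hom[OF ipow_ideal[of "Suc n"]]
  by (simp add: thick_def to_thick_def[abs_def] del: ideal_power.simps)

lemma to_thick_eq_iff:
  assumes "a \<in> carrier A" "b \<in> carrier A"
  shows "\<pi> n a = \<pi> n b \<longleftrightarrow> a \<ominus> b \<in> ipow (Suc n)"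
  unfolding to_thick_def using quotient_eq_iff_same_a_r_cos[OF ipow_ideal assms] by blast

lemma to_thick_zero_iff:
  assumes "a \<in> carrier A"
  shows "\<pi> n a = \<zero>\<^bsub>B n\<^esub> \<longleftrightarrow> a \<in> ipow (Suc n)"
proof -
  interpret h: ring_hom_cring A "B n" "\<pi> n"
    using thick_cring to_thick_hom is_cring by (intro ring_hom_cring.intro ring_hom_cring_axioms.intro)
  show ?thesis using to_thick_eq_iff[OF assms zero_closed, of n] assms by (simp add: minus_eq)
qed

lemma thick_step_to_thick:
  assumes "a \<in> carrier A"
  shows "\<tau> n (\<pi> (Suc n) a) = \<pi> n a"
proof -
  interpret J: ideal "ipow (Suc n)" A by (rule ipow_ideal)
  interpret K: ideal "ipow (Suc (Suc n))" A by (rule ipow_ideal)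
  have 1: "(i \<oplus> (j \<oplus> a)) = (i \<oplus> j) \<oplus> a \<and> i \<oplus> j \<in> ipow (Suc n)"
    if "i \<in> ipow (Suc n)" "j \<in> ipow (Suc (Suc n))" for i j
  proof -
    have j: "j \<in> ipow (Suc n)" using that(2) ipow_Suc_subset[of "Suc n"] by blast
    show ?thesis
      using J.a_closed[OF that(1) j] a_assoc[OF J.a_Hcarr[OF that(1)] J.a_Hcarr[OF j] assms] by simp
  qed
  have 2: "i \<oplus> a = i \<oplus> (\<zero> \<oplus> a)" for i using assms by simp
  show ?thesis
    unfolding thick_step_def to_thick_def set_add_def' a_r_coset_def'
  proof (rule subset_antisym; rule subsetI)
    fix x
    assume "x \<in> (\<Union>i\<in>ipow (Suc n). \<Union>c\<in>\<Union>j\<in>ipow (Suc (Suc n)). {j \<oplus> a}. {i \<oplus> c})"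
    then obtain i j where ij: "i \<in> ipow (Suc n)" "j \<in> ipow (Suc (Suc n))" "x = i \<oplus> (j \<oplus> a)" by blast
    then show "x \<in> (\<Union>i\<in>ipow (Suc n). {i \<oplus> a})" using 1[OF ij(1,2)] by blast
  next
    fix x
    assume "x \<in> (\<Union>i\<in>ipow (Suc n). {i \<oplus> a})"
    then obtain i where "i \<in> ipow (Suc n)" "x = i \<oplus> (\<zero> \<oplus> a)" using 2 by blast
    then show "x \<in> (\<Union>i\<in>ipow (Suc n). \<Union>c\<in>\<Union>j\<in>ipow (Suc (Suc n)). {j \<oplus> a}. {i \<oplus> c})"
      using K.zero_closed by blast
  qed
qed

lemma thick_step_hom: "\<tau> n \<in> ring_hom (B (Suc n)) (B n)"
proof -
  have h: "\<pi> m \<in> ring_hom A (B m)" for m by (rule to_thick_hom)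
  show ?thesis
  proof (rule ring_hom_memI)
    show "\<tau> n x \<in> carrier (B n)" if "x \<in> carrier (B (Suc n))" for x
      using that by (auto simp: thick_carrier thick_step_to_thick)
    show "\<tau> n \<one>\<^bsub>B (Suc n)\<^esub> = \<one>\<^bsub>B n\<^esub>"
      using thick_step_to_thick[OF one_closed, of n] by (simp add: ring_hom_one[OF h])
    fix x y assume "x \<in> carrier (B (Suc n))" "y \<in> carrier (B (Suc n))"
    then obtain a b where ab: "a \<in> carrier A" "b \<in> carrier A" "x = \<pi> (Suc n) a" "y = \<pi> (Suc n) b"
      by (auto simp: thick_carrier)
    show "\<tau> n (x \<otimes>\<^bsub>B (Suc n)\<^esub> y) = \<tau> n x \<otimes>\<^bsub>B n\<^esub> \<tau> n y"
      using ab by (simp add: thick_step_to_thick flip: ring_hom_mult[OF h])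
    show "\<tau> n (x \<oplus>\<^bsub>B (Suc n)\<^esub> y) = \<tau> n x \<oplus>\<^bsub>B n\<^esub> \<tau> n y"
      using ab by (simp add: thick_step_to_thick flip: ring_hom_add[OF h])
  qed
qed

text \<open>Because of this all thickenings have the open primes of \<open>A\<close> as their points, and the preimages of
  open sets of the formal spectrum are open in the thickenings.\<close>

lemma prime_contains_I:
  assumes "P \<in> spec A" "ipow n \<subseteq> P"
  shows "I \<subseteq> P"
proof (rule ccontr)
  assume "\<not> I \<subseteq> P"
  then obtain x where x: "x \<in> I" "x \<notin> P" by blast
  interpret P: primeideal P A using assms(1) by (simp add: spec_def)
  have "ipow n \<subseteq> P \<Longrightarrow> False"
  proof (induction n)
    case 0
    then show ?case using P.I_notcarr P.a_subset by auto
  next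
    case (Suc n)
    have "ipow n \<subseteq> P"
    proof
      fix y assume y: "y \<in> ipow n"
      then have "y \<otimes> x \<in> P" using Suc.prems x by (auto intro: ideal_prod.prod)
      then show "y \<in> P" using x y ipow_carrier P.I_prime[of y x] I.a_Hcarr by blast
    qed
    then show ?case by (rule Suc.IH)
  qed
  then show False using assms(2) by blast
qed

lemma contract_spec: "Q \<in> spec (B n) \<Longrightarrow> contract A (\<pi> n) Q \<in> spec A"
  by (rule spec_contract[OF is_cring thick_cring to_thick_hom])

lemma contract_contains_I:
  assumes Q: "Q \<in> spec (B n)"
  shows "I \<subseteq> contract A (\<pi> n) Q"
proof (rule prime_contains_I[OF contract_spec[OF Q]])
  interpret Q: primeideal Q "B n" using Q by (simp add: spec_def)
  show "ipow (Suc n) \<subseteq> contract A (\<pi> n) Q"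
  proof
    fix x assume x: "x \<in> ipow (Suc n)"
    then have "x \<in> carrier A" using ipow_carrier by blast
    moreover from this x have "\<pi> n x = \<zero>\<^bsub>B n\<^esub>" by (simp only: to_thick_zero_iff)
    ultimately show "x \<in> contract A (\<pi> n) Q"
      using additive_subgroup.zero_closed[OF Q.is_additive_subgroup] by (simp add: contract_def)
  qed
qed

lemma thick_open_open:
  assumes "openin X U"
  shows "openin (zariski (B n)) (W n U)"
proof -
  obtain V where V: "openin (zariski A) V" "U = V \<inter> {P. I \<subseteq> P}"
    using assms by (auto simp: spf_base_def openin_subtopology)
  have "W n U = spec_preimage A (B n) (\<pi> n) V"
    using contract_contains_I V(2) by (auto simp: thick_open_def spec_preimage_def)
  then show ?thesis
    using spec_preimage_open[OF is_cring thick_cring to_thick_hom V(1)] by simp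
qed

lemma thick_open_mono: "U \<subseteq> V \<Longrightarrow> W n U \<subseteq> W n V"
  by (auto simp: thick_open_def spec_preimage_def)

lemma contract_step:
  "contract A (\<pi> (Suc n)) (contract (B (Suc n)) (\<tau> n) Q) = contract A (\<pi> n) Q"
  by (auto simp: contract_def thick_step_to_thick thick_carrier)

lemma step_preimage: "spec_preimage (B (Suc n)) (B n) (\<tau> n) (W (Suc n) U) = W n U"
  using spec_contract[OF thick_cring thick_cring thick_step_hom]
  by (auto simp: thick_open_def spec_preimage_def contract_step)

lemma spf_carrier:
  "s \<in> carrier (\<O> U) \<longleftrightarrow> (\<forall>n. s n \<in> carrier (level n U)) \<and>
     (\<forall>n. pull n U (s (Suc n)) = s n)"
  by (simp add: spf_sect_def)

lemma spf_level: "s \<in> carrier (\<O> U) \<Longrightarrow> s n \<in> carrier (level n U)"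
  by (simp add: spf_carrier)

lemma level_cring: "openin X U \<Longrightarrow> cring (level n U)"
  by (intro spec_sect_cring thick_cring thick_open_open)

lemma pullback_hom: "pull n U \<in> ring_hom (level (Suc n) U) (level n U)"
  using spec_pullback_hom[OF thick_cring thick_cring thick_step_hom, of n "W (Suc n) U"]
  by (simp add: step_preimage)

lemma spf_sect_alt: "\<O> U = pointwise_ring UNIV (\<lambda>n. level n U) (carrier (\<O> U))"
  by (simp add: spf_sect_def pointwise_ring_def Let_def restrict_UNIV)

lemma spf_pointwise_subring:
  assumes U: "openin X U"
  shows "pointwise_subring UNIV (\<lambda>n. level n U) (carrier (\<O> U))"
proof -
  note h = pullback_hom[of _ U]
  have rh: "ring_hom_cring (level (Suc n) U) (level n U) (pull n U)" for n
    by (intro ring_hom_cring.intro ring_hom_cring_axioms.intro level_cring h U)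
  have neg: "pull n U (\<ominus>\<^bsub>level (Suc n) U\<^esub> x) = \<ominus>\<^bsub>level n U\<^esub> (pull n U x)"
    if "x \<in> carrier (level (Suc n) U)" for n x
    using ring_hom_cring.hom_a_inv[OF rh that] .
  note c = level_cring[OF U]
  show ?thesis
  proof (rule pointwise_subring.intro)
    show "cring (level n U)" for n by (rule c)
    show "carrier (\<O> U) \<subseteq> (\<Pi>\<^sub>E n\<in>UNIV. carrier (level n U))"
      by (auto simp: spf_level)
    show "(\<lambda>n\<in>UNIV. \<one>\<^bsub>level n U\<^esub>) \<in> carrier (\<O> U)"
      by (simp add: spf_carrier restrict_UNIV ring_hom_one[OF h] cring.cring_simprules(6)[OF c])
    fix s t assume s: "s \<in> carrier (\<O> U)"
    show "(\<lambda>n\<in>UNIV. \<ominus>\<^bsub>level n U\<^esub> s n) \<in> carrier (\<O> U)"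
      using s by (simp add: spf_carrier restrict_UNIV neg cring.cring_simprules(3)[OF c])
    assume t: "t \<in> carrier (\<O> U)"
    show "(\<lambda>n\<in>UNIV. s n \<oplus>\<^bsub>level n U\<^esub> t n) \<in> carrier (\<O> U)"
      using s t by (simp add: spf_carrier restrict_UNIV ring_hom_add[OF h] cring.cring_simprules(1)[OF c])
    show "(\<lambda>n\<in>UNIV. s n \<otimes>\<^bsub>level n U\<^esub> t n) \<in> carrier (\<O> U)"
      using s t by (simp add: spf_carrier restrict_UNIV ring_hom_mult[OF h] cring.cring_simprules(5)[OF c])
  qed
qed

lemma spf_sect_cring: "openin X U \<Longrightarrow> cring (\<O> U)"
  by (subst spf_sect_alt) (rule pointwise_subring.pointwise_cring[OF spf_pointwise_subring])

lemma spf_add: "(s \<oplus>\<^bsub>\<O> U\<^esub> t) n = s n \<oplus>\<^bsub>level n U\<^esub> t n"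
  and spf_mult: "(s \<otimes>\<^bsub>\<O> U\<^esub> t) n = s n \<otimes>\<^bsub>level n U\<^esub> t n"
  and spf_one: "\<one>\<^bsub>\<O> U\<^esub> n = \<one>\<^bsub>level n U\<^esub>"
  and spf_zero: "\<zero>\<^bsub>\<O> U\<^esub> n = \<zero>\<^bsub>level n U\<^esub>"
  by (simp_all add: spf_sect_def)

lemma level_restrict_hom:
  assumes "openin X V" "V \<subseteq> U"
  shows "(\<lambda>s. restrict s (W n V)) \<in> ring_hom (level n U) (level n V)"
proof (rule ring_hom_memI)
  show "restrict s (W n V) \<in> carrier (level n V)" if "s \<in> carrier (level n U)" for s
    by (rule spec_sect_restrict[OF thick_cring thick_open_open[OF assms(1)] thick_open_mono[OF assms(2)] that])
qed (use thick_open_mono[OF assms(2), of n] in \<open>auto simp: spec_sect_def restrict_def fun_eq_iff\<close>)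

lemma spf_res_hom:
  assumes "openin X U" "openin X V" "V \<subseteq> U"
  shows "\<rho> U V \<in> ring_hom (\<O> U) (\<O> V)"
proof (rule ring_hom_memI)
  note h = level_restrict_hom[OF assms(2,3)]
  fix s assume s: "s \<in> carrier (\<O> U)"
  have "pull n V (restrict (s (Suc n)) (W (Suc n) V)) = restrict (s n) (W n V)" for n
  proof -
    have "s n = pull n U (s (Suc n))"
      using s by (simp add: spf_carrier)
    moreover have "contract (B (Suc n)) (\<tau> n) Q \<in> W (Suc n) V" "Q \<in> W n U" if "Q \<in> W n V" for Q
      using that step_preimage[of n V] thick_open_mono[OF assms(3), of n] by (auto simp: spec_preimage_def)
    ultimately show ?thesis
      by (auto simp: spec_pullback_def step_preimage fun_eq_iff restrict_def)
  qed
  then show "\<rho> U V s \<in> carrier (\<O> V)"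
    using s ring_hom_closed[OF h] by (simp add: spf_carrier spf_res_def)
next
  note h = level_restrict_hom[OF assms(2,3)]
  fix s t assume st: "s \<in> carrier (\<O> U)" "t \<in> carrier (\<O> U)"
  show "\<rho> U V (s \<otimes>\<^bsub>\<O> U\<^esub> t) = \<rho> U V s \<otimes>\<^bsub>\<O> V\<^esub> \<rho> U V t"
    using ring_hom_mult[OF h spf_level[OF st(1)] spf_level[OF st(2)]]
    by (auto simp: spf_res_def spf_mult)
  show "\<rho> U V (s \<oplus>\<^bsub>\<O> U\<^esub> t) = \<rho> U V s \<oplus>\<^bsub>\<O> V\<^esub> \<rho> U V t"
    using ring_hom_add[OF h spf_level[OF st(1)] spf_level[OF st(2)]]
    by (auto simp: spf_res_def spf_add)
next
  note h = level_restrict_hom[OF assms(2,3)]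
  show "\<rho> U V \<one>\<^bsub>\<O> U\<^esub> = \<one>\<^bsub>\<O> V\<^esub>"
    using ring_hom_one[OF h] by (auto simp: spf_res_def spf_one)
qed

lemma spf_res_id: "s \<in> carrier (\<O> U) \<Longrightarrow> \<rho> U U s = s"
  using spf_level spec_sect_extensional
  by (fastforce simp: spf_res_def restrict_def fun_eq_iff)

lemma spf_res_comp: "Z \<subseteq> V \<Longrightarrow> \<rho> V Z (\<rho> U V s) = \<rho> U Z s"
  by (simp add: spf_res_def restrict_restrict Int_absorb1 thick_open_mono)

lemma spf_sect_empty: "carrier (\<O> {}) = {\<lambda>n Q. undefined}"
proof -
  have W: "W n {} = {}" for n by (simp add: thick_open_def spec_preimage_def)
  have "carrier (level n {}) = {\<lambda>Q. undefined}" for n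
    unfolding W by (auto simp: spec_sect_def)
  then have "s n = (\<lambda>Q. undefined)" if "s \<in> carrier (\<O> {})" for s n
    using spf_level[OF that, of n] by simp
  then have "carrier (\<O> {}) \<subseteq> {\<lambda>n Q. undefined}" by blast
  moreover have "carrier (\<O> {}) \<noteq> {}"
    using cring.cring_simprules(2)[OF spf_sect_cring[OF openin_empty]] by blast
  ultimately show ?thesis by blast
qed


subsection \<open>The topology on sections\<close>

definition sub_nbhd :: "'a set set \<Rightarrow> 'a set set \<Rightarrow> nat \<Rightarrow> ('a set set \<Rightarrow> ('a set \<times> 'a set) set) \<Rightarrow> 'a spf_section set" where
  "sub_nbhd U V n t = {s \<in> carrier (\<O> U). \<rho> U V s n = t}"

lemma spf_sect_top_alt:
  "\<T> U = topology_generated_by {sub_nbhd U V n t | V n t.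
     openin X V \<and> compactin X V \<and> V \<subseteq> U \<and> t \<in> carrier (level n V)}"
  by (simp add: spf_sect_top_def sub_nbhd_def)

lemma sub_nbhd_open:
  assumes "openin X V" "compactin X V" "V \<subseteq> U" "t \<in> carrier (level n V)"
  shows "openin (\<T> U) (sub_nbhd U V n t)"
  unfolding spf_sect_top_alt using assms by (intro topology_generated_by_Basis) blast

lemma res_level:
  assumes "openin X U" "openin X V" "V \<subseteq> U" "s \<in> carrier (\<O> U)"
  shows "\<rho> U V s n \<in> carrier (level n V)"
  using ring_hom_closed[OF spf_res_hom[OF assms(1-3)] assms(4)] by (rule spf_level)

text \<open>The empty set is quasi-compact, so every section lies in a subbasic neighbourhood.\<close>

lemma topspace_spf_sect_top:
  assumes "openin X U"
  shows "topspace (\<T> U) = carrier (\<O> U)"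
proof
  show "topspace (\<T> U) \<subseteq> carrier (\<O> U)"
    unfolding spf_sect_top_alt topology_generated_by_topspace by (auto simp: sub_nbhd_def)
  show "carrier (\<O> U) \<subseteq> topspace (\<T> U)"
  proof
    fix s assume s: "s \<in> carrier (\<O> U)"
    have "openin (\<T> U) (sub_nbhd U {} 0 (\<rho> U {} s 0))"
      using res_level[OF assms _ _ s, of "{}"] by (intro sub_nbhd_open) auto
    moreover have "s \<in> sub_nbhd U {} 0 (\<rho> U {} s 0)"
      using s by (simp add: sub_nbhd_def)
    ultimately show "s \<in> topspace (\<T> U)" using openin_subset by blast
  qed
qed

text \<open>The values at a fixed level over a quasi-compact open set are discrete, so a map into the sections
  is continuous as soon as each of these values is locally constant.\<close>

lemma continuous_map_spf_sect_topI:
  assumes U: "openin X U" and f: "f \<in> topspace T \<rightarrow> carrier (\<O> U)"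
    and nb: "\<And>x V n. \<lbrakk>x \<in> topspace T; openin X V; compactin X V; V \<subseteq> U\<rbrakk> \<Longrightarrow>
      \<exists>N. openin T N \<and> x \<in> N \<and> (\<forall>y\<in>N. \<rho> U V (f y) n = \<rho> U V (f x) n)"
  shows "continuous_map T (\<T> U) f"
  unfolding spf_sect_top_alt
proof (rule continuous_on_generated_topo)
  fix N assume "N \<in> {sub_nbhd U V n t | V n t.
     openin X V \<and> compactin X V \<and> V \<subseteq> U \<and> t \<in> carrier (level n V)}"
  then obtain V n t where N: "N = sub_nbhd U V n t" "openin X V" "compactin X V" "V \<subseteq> U" by blast
  show "openin T (f -` N \<inter> topspace T)"
  proof (subst openin_subopen, intro ballI)
    fix x assume x: "x \<in> f -` N \<inter> topspace T"
    then obtain M where M: "openin T M" "x \<in> M"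
      "\<And>y. y \<in> M \<Longrightarrow> \<rho> U V (f y) n = \<rho> U V (f x) n"
      using nb[OF _ N(2-4), of x n] by blast
    have "M \<subseteq> topspace T" using M(1) by (rule openin_subset)
    have "M \<subseteq> f -` N \<inter> topspace T"
    proof
      fix y assume y: "y \<in> M"
      have "y \<in> topspace T" using y \<open>M \<subseteq> topspace T\<close> by blast
      moreover have "\<rho> U V (f x) n = t" using x by (simp add: N(1) sub_nbhd_def)
      ultimately show "y \<in> f -` N \<inter> topspace T"
        using M(3)[OF y] f by (auto simp: N(1) sub_nbhd_def)
    qed
    then show "\<exists>T'. openin T T' \<and> x \<in> T' \<and> T' \<subseteq> f -` N \<inter> topspace T" using M by blast
  qed
next
  show "f ` topspace T \<subseteq> \<Union> {sub_nbhd U V n t | V n t.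
     openin X V \<and> compactin X V \<and> V \<subseteq> U \<and> t \<in> carrier (level n V)}"
    using f topspace_spf_sect_top[OF U] unfolding spf_sect_top_alt topology_generated_by_topspace
    by blast
qed

lemma spf_res_continuous:
  assumes U: "openin X U" and V: "openin X V" and "V \<subseteq> U"
  shows "continuous_map (\<T> U) (\<T> V) (\<rho> U V)"
proof (rule continuous_map_spf_sect_topI[OF V])
  show "\<rho> U V \<in> topspace (\<T> U) \<rightarrow> carrier (\<O> V)"
    using spf_res_hom[OF assms] ring_hom_closed by (fastforce simp: topspace_spf_sect_top[OF U])
  fix s Z n assume s: "s \<in> topspace (\<T> U)" and Z: "openin X Z" "compactin X Z" "Z \<subseteq> V"
  then have sc: "s \<in> carrier (\<O> U)" by (simp add: topspace_spf_sect_top[OF U])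
  show "\<exists>N. openin (\<T> U) N \<and> s \<in> N \<and> (\<forall>y\<in>N.
      \<rho> V Z (\<rho> U V y) n = \<rho> V Z (\<rho> U V s) n)"
    using Z assms(3) sc res_level[OF U Z(1) _ sc, of n]
    by (intro exI[of _ "sub_nbhd U Z n (\<rho> U Z s n)"] conjI sub_nbhd_open)
      (auto simp: spf_res_comp sub_nbhd_def)
qed

lemma spf_topological_ring:
  assumes U: "openin X U"
  shows "topological_ring (\<O> U) (\<T> U)"
proof -
  let ?T = "\<T> U"
  note ts = topspace_spf_sect_top[OF U]
  interpret R: cring "\<O> U" by (rule spf_sect_cring[OF U])
  \<comment> \<open>Both operations are handled at once: on values at a given level they are given by some
    function \<open>k\<close> of the values of the arguments.\<close>
  have bin: "continuous_map (prod_topology ?T ?T) ?T (\<lambda>(x, y). g x y)"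
    if g: "\<And>x y. \<lbrakk>x \<in> carrier (\<O> U); y \<in> carrier (\<O> U)\<rbrakk> \<Longrightarrow> g x y \<in> carrier (\<O> U)"
      and l: "\<And>V n. \<lbrakk>openin X V; V \<subseteq> U\<rbrakk> \<Longrightarrow> \<exists>k. \<forall>x\<in>carrier (\<O> U). \<forall>y\<in>carrier (\<O> U).
         \<rho> U V (g x y) n = k (\<rho> U V x n) (\<rho> U V y n)" for g
  proof (rule continuous_map_spf_sect_topI[OF U])
    show "(\<lambda>(x, y). g x y) \<in> topspace (prod_topology ?T ?T) \<rightarrow> carrier (\<O> U)"
      using g by (auto simp: ts)
    fix p V n assume p: "p \<in> topspace (prod_topology ?T ?T)" and V: "openin X V" "compactin X V" "V \<subseteq> U"
    obtain x y where xy: "p = (x, y)" "x \<in> carrier (\<O> U)" "y \<in> carrier (\<O> U)"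
      using p by (auto simp: ts)
    obtain k where k: "\<And>x y. \<lbrakk>x \<in> carrier (\<O> U); y \<in> carrier (\<O> U)\<rbrakk> \<Longrightarrow>
       \<rho> U V (g x y) n = k (\<rho> U V x n) (\<rho> U V y n)"
      using l[OF V(1,3)] by metis
    let ?N = "\<lambda>x. sub_nbhd U V n (\<rho> U V x n)"
    have o: "openin ?T (?N x)" if "x \<in> carrier (\<O> U)" for x
      using V res_level[OF U V(1,3) that] by (intro sub_nbhd_open)
    have "openin (prod_topology ?T ?T) (?N x \<times> ?N y)"
      using o xy by (simp add: openin_prod_Times_iff)
    then show "\<exists>N. openin (prod_topology ?T ?T) N \<and> p \<in> N \<and> (\<forall>q\<in>N.
        \<rho> U V (case q of (x, y) \<Rightarrow> g x y) n = \<rho> U V (case p of (x, y) \<Rightarrow> g x y) n)"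
      using xy k by (intro exI[of _ "?N x \<times> ?N y"]) (auto simp: sub_nbhd_def)
  qed
  have "continuous_map (prod_topology ?T ?T) ?T (\<lambda>(x, y). x \<oplus>\<^bsub>\<O> U\<^esub> y)"
  proof (rule bin)
    fix V n assume V: "openin X V" "V \<subseteq> U"
    show "\<exists>k. \<forall>x\<in>carrier (\<O> U). \<forall>y\<in>carrier (\<O> U).
         \<rho> U V (x \<oplus>\<^bsub>\<O> U\<^esub> y) n = k (\<rho> U V x n) (\<rho> U V y n)"
      by (intro exI[of _ "add (level n V)"]) (simp add: ring_hom_add[OF spf_res_hom[OF U V]] spf_add)
  qed auto
  moreover have "continuous_map (prod_topology ?T ?T) ?T (\<lambda>(x, y). x \<otimes>\<^bsub>\<O> U\<^esub> y)"
  proof (rule bin)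
    fix V n assume V: "openin X V" "V \<subseteq> U"
    show "\<exists>k. \<forall>x\<in>carrier (\<O> U). \<forall>y\<in>carrier (\<O> U).
         \<rho> U V (x \<otimes>\<^bsub>\<O> U\<^esub> y) n = k (\<rho> U V x n) (\<rho> U V y n)"
      by (intro exI[of _ "monoid.mult (level n V)"]) (simp add: ring_hom_mult[OF spf_res_hom[OF U V]] spf_mult)
  qed auto
  moreover have "continuous_map ?T ?T (a_inv (\<O> U))"
  proof (rule continuous_map_spf_sect_topI[OF U])
    show "a_inv (\<O> U) \<in> topspace ?T \<rightarrow> carrier (\<O> U)" by (auto simp: ts)
    fix x V n assume x: "x \<in> topspace ?T" and V: "openin X V" "compactin X V" "V \<subseteq> U"
    have x: "x \<in> carrier (\<O> U)" using x by (simp add: ts)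
    interpret h: ring_hom_cring "\<O> U" "\<O> V" "\<rho> U V"
      by (intro ring_hom_cring.intro ring_hom_cring_axioms.intro spf_sect_cring spf_res_hom U V)
    have neg: "\<rho> U V (\<ominus>\<^bsub>\<O> U\<^esub> y) n = \<ominus>\<^bsub>level n V\<^esub> (\<rho> U V y n)"
      if "y \<in> carrier (\<O> U)" for y
      using pointwise_subring.pointwise_neg[OF spf_pointwise_subring[OF V(1)] h.hom_closed[OF that]] that
      by (simp add: restrict_UNIV flip: spf_sect_alt)
    show "\<exists>N. openin ?T N \<and> x \<in> N \<and> (\<forall>y\<in>N.
      \<rho> U V (\<ominus>\<^bsub>\<O> U\<^esub> y) n = \<rho> U V (\<ominus>\<^bsub>\<O> U\<^esub> x) n)"
      using x neg V res_level[OF U V(1,3) x, of n]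
      by (intro exI[of _ "sub_nbhd U V n (\<rho> U V x n)"] conjI sub_nbhd_open)
        (auto simp: sub_nbhd_def)
  qed
  ultimately show ?thesis
    by (simp add: topological_ring_def ts R.ring_axioms)
qed

end

section \<open>Spaces whose open sets are linearly ordered\<close>

text \<open>If every nonempty family of open sets contains its own union, a section over the union is
  determined by the member of the family over that union, and only the empty covering remains.\<close>

lemma sheaf_of_sets_chain:
  assumes chain: "\<And>\<U>. \<lbrakk>\<And>U. U \<in> \<U> \<Longrightarrow> openin T U; \<U> \<noteq> {}\<rbrakk> \<Longrightarrow> \<Union>\<U> \<in> \<U>"
    and closed: "\<And>U V s. \<lbrakk>openin T U; openin T V; V \<subseteq> U; s \<in> F U\<rbrakk> \<Longrightarrow> \<rho> U V s \<in> F V"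
    and ident: "\<And>U s. \<lbrakk>openin T U; s \<in> F U\<rbrakk> \<Longrightarrow> \<rho> U U s = s"
    and comp: "\<And>U V Z s. \<lbrakk>openin T U; openin T V; openin T Z; Z \<subseteq> V; V \<subseteq> U; s \<in> F U\<rbrakk> \<Longrightarrow>
        \<rho> V Z (\<rho> U V s) = \<rho> U Z s"
    and empty: "F {} = {e}"
  shows "sheaf_of_sets T F \<rho>"
  unfolding sheaf_of_sets_def
proof (intro conjI allI impI)
  fix \<U> s
  assume *: "(\<forall>U\<in>\<U>. openin T U \<and> s U \<in> F U) \<and>
            (\<forall>U\<in>\<U>. \<forall>V\<in>\<U>. \<rho> U (U \<inter> V) (s U) = \<rho> V (U \<inter> V) (s V))"
  show "\<exists>!t. t \<in> F (\<Union>\<U>) \<and> (\<forall>U\<in>\<U>. \<rho> (\<Union>\<U>) U t = s U)"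
  proof (cases "\<U> = {}")
    case True
    then show ?thesis using empty by simp
  next
    case False
    let ?W = "\<Union>\<U>"
    have W: "?W \<in> \<U>" using chain[of \<U>] False * by blast
    show ?thesis
    proof (rule ex1I[of _ "s ?W"])
      have "\<rho> ?W U (s ?W) = s U" if U: "U \<in> \<U>" for U
      proof -
        have "U \<inter> ?W = U" using U by blast
        then have "\<rho> U U (s U) = \<rho> ?W U (s ?W)" using * U W by metis
        then show ?thesis using * U ident by simp
      qed
      then show "s ?W \<in> F ?W \<and> (\<forall>U\<in>\<U>. \<rho> ?W U (s ?W) = s U)" using * W by blast
      fix t assume t: "t \<in> F ?W \<and> (\<forall>U\<in>\<U>. \<rho> ?W U t = s U)"
      then have "\<rho> ?W ?W t = s ?W" using W by blast
      then show "t = s ?W" using ident[of ?W t] t W * by simp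
    qed
  qed
qed (use closed ident comp in \<open>auto simp del: Union_iff\<close>)

context adic_pair
begin

text \<open>The component at the union itself is a continuous left inverse of the map into the product.\<close>

lemma spf_embedding:
  assumes chain: "\<And>\<U>. \<lbrakk>\<And>U. U \<in> \<U> \<Longrightarrow> openin X U; \<U> \<noteq> {}\<rbrakk> \<Longrightarrow> \<Union>\<U> \<in> \<U>"
    and op: "\<And>U. U \<in> \<U> \<Longrightarrow> openin X U"
  shows "embedding_map (\<T> (\<Union>\<U>)) (product_topology (\<T>) \<U>)
          (\<lambda>s. \<lambda>U\<in>\<U>. \<rho> (\<Union>\<U>) U s)"
proof (rule section_imp_embedding_map, unfold section_map_def retraction_maps_def)
  let ?W = "\<Union>\<U>"
  have W: "openin X ?W" using op by blast
  have cont: "continuous_map (\<T> ?W) (product_topology (\<T>) \<U>)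
      (\<lambda>s. \<lambda>U\<in>\<U>. \<rho> ?W U s)"
    unfolding continuous_map_componentwise
  proof (intro conjI ballI)
    fix U assume U: "U \<in> \<U>"
    have "continuous_map (\<T> ?W) (\<T> U) (\<rho> ?W U)"
      using U by (intro spf_res_continuous W op) auto
    then show "continuous_map (\<T> ?W) (\<T> U)
        (\<lambda>x. (\<lambda>U\<in>\<U>. \<rho> ?W U x) U)"
      using U by (simp add: eta_contract_eq)
  qed auto
  show "\<exists>g. continuous_map (product_topology (\<T>) \<U>) (\<T> ?W) g \<and>
     continuous_map (\<T> ?W) (product_topology (\<T>) \<U>)
      (\<lambda>s. \<lambda>U\<in>\<U>. \<rho> ?W U s) \<and>
     (\<forall>x\<in>topspace (\<T> ?W). g (\<lambda>U\<in>\<U>. \<rho> ?W U x) = x)"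
  proof (cases "\<U> = {}")
    case True
    have "topspace (\<T> ?W) = {\<lambda>n Q. undefined}"
      using topspace_spf_sect_top[OF W] True by (simp add: spf_sect_empty)
    then show ?thesis using cont
      by (intro exI[of _ "\<lambda>_. \<lambda>n Q. undefined"]) simp
  next
    case False
    then have "?W \<in> \<U>" by (intro chain op)
    then show ?thesis using cont
      by (intro exI[of _ "\<lambda>f. f ?W"])
        (simp add: continuous_map_product_projection topspace_spf_sect_top[OF W] spf_res_id)
  qed
qed

lemma Spf_simps [simp]: "base (Spf A I) = X" "sect (Spf A I) = \<O>" "res (Spf A I) = \<rho>"
    "sect_top (Spf A I) = \<T>"
  by (simp_all add: Spf_def)

lemma Spf_topologically_ringed_space:
  assumes chain: "\<And>\<U>. \<lbrakk>\<And>U. U \<in> \<U> \<Longrightarrow> openin X U; \<U> \<noteq> {}\<rbrakk> \<Longrightarrow> \<Union>\<U> \<in> \<U>"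
  shows "topologically_ringed_space (Spf A I)"
proof -
  have "sheaf_of_sets X (\<lambda>U. carrier (\<O> U)) (\<rho>)"
  proof (rule sheaf_of_sets_chain[OF chain])
    fix U V s assume "openin X U" "openin X V" "V \<subseteq> U" "s \<in> carrier (\<O> U)"
    then show "\<rho> U V s \<in> carrier (\<O> V)" using ring_hom_closed[OF spf_res_hom] by metis
  qed (auto simp: spf_res_id spf_res_comp spf_sect_empty)
  then show ?thesis
    unfolding topologically_ringed_space_def
    using spf_embedding[OF chain] spf_sect_cring spf_topological_ring spf_res_hom by simp
qed

lemma Spf_formal_scheme:
  assumes chain: "\<And>\<U>. \<lbrakk>\<And>U. U \<in> \<U> \<Longrightarrow> openin X U; \<U> \<noteq> {}\<rbrakk> \<Longrightarrow> \<Union>\<U> \<in> \<U>"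
    and "noetherian_adic_ring A I"
  shows "adic_noetherian_formal_scheme TYPE('a) (Spf A I)"
proof -
  have pre: "{x \<in> topspace X. x \<in> V} = V" if "openin X V" for V
    using openin_subset[OF that] by blast
  have "open_subspace (Spf A I) (topspace X) = Spf A I"
    by (simp add: open_subspace_def Spf_def subtopology_topspace)
  moreover have "iso_top_ringed_space (Spf A I) (Spf A I)"
    unfolding iso_top_ringed_space_def Let_def
    by (intro exI[of _ "\<lambda>x. x"] exI[of _ "\<lambda>_ s. s"])
      (auto simp: pre ring_iso_def ring_hom_def bij_betw_def homeomorphic_map_id[unfolded id_def])
  ultimately show ?thesis
    unfolding adic_noetherian_formal_scheme_def
    using Spf_topologically_ringed_space[OF chain] assms(2)
    by (intro conjI exI[of _ "{topspace X}"]) (auto)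
qed

end


section \<open>Nilradicals\<close>

text \<open>The proof replaces the binomial theorem by an induction that splits off one factor \<open>a \<oplus> b\<close> at a
  time and raises the exponent of either \<open>a\<close> or \<open>b\<close>.\<close>

lemma (in cring) nil_sum:
  assumes a: "a \<in> carrier R" "a [^] (n::nat) = \<zero>" and b: "b \<in> carrier R" "b [^] (m::nat) = \<zero>"
  shows "(a \<oplus> b) [^] (n + m) = \<zero>"
proof -
  have pow: "x [^] (i::nat) = \<zero>" if "x \<in> carrier R" "x [^] k = \<zero>" "k \<le> i" for x i k
    using nat_pow_mult[OF that(1), of k "i - k"] that by simp
  have "a [^] i \<otimes> b [^] j \<otimes> (a \<oplus> b) [^] l = \<zero>" if "n + m \<le> i + j + l" for i j l :: nat
    using that
  proof (induction l arbitrary: i j)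
    case 0
    then have "n \<le> i \<or> m \<le> j" by linarith
    then show ?case using pow[OF a] pow[OF b] a(1) b(1) by auto
  next
    case (Suc l)
    have "a [^] i \<otimes> b [^] j \<otimes> (a \<oplus> b) [^] Suc l
       = a [^] Suc i \<otimes> b [^] j \<otimes> (a \<oplus> b) [^] l \<oplus> a [^] i \<otimes> b [^] Suc j \<otimes> (a \<oplus> b) [^] l"
      using a b by (simp add: m_ac r_distr l_distr)
    also have "\<dots> = \<zero>" using Suc.IH[of "Suc i" j] Suc.IH[of i "Suc j"] Suc.prems by simp
    finally show ?case .
  qed
  from this[of 0 0 "n + m"] show ?thesis using a b by simp
qed

lemma nilradical_ideal:
  fixes R :: "'a ring" (structure)
  assumes "cring R"
  shows "ideal (nilradical R) R"
proof -
  interpret cring R by fact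
  show ?thesis
proof (rule idealI[OF ring_axioms])
  show "subgroup (nilradical R) (add_monoid R)"
  proof (rule add.subgroupI)
    show "nilradical R \<subseteq> carrier R" by (auto simp: nilradical_def)
    show "nilradical R \<noteq> {}"
      by (auto simp: nilradical_def intro!: exI[of _ "\<zero>"] exI[of _ "1::nat"])
    fix a assume a: "a \<in> nilradical R"
    then obtain n :: nat where n: "a \<in> carrier R" "a [^] n = \<zero>" by (auto simp: nilradical_def)
    have "(\<ominus> a) [^] n = (\<ominus> \<one>) [^] n \<otimes> a [^] n"
      using n(1) nat_pow_distrib[of "\<ominus> \<one>" a n] by (simp add: l_minus)
    then show "\<ominus> a \<in> nilradical R" using n by (auto simp: nilradical_def)
    fix b assume "b \<in> nilradical R"
    then show "a \<oplus> b \<in> nilradical R"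
      using a nil_sum by (fastforce simp: nilradical_def)
  qed
  fix a x assume "a \<in> nilradical R" and x: "x \<in> carrier R"
  then obtain n :: nat where n: "a \<in> carrier R" "a [^] n = \<zero>" by (auto simp: nilradical_def)
  then show "x \<otimes> a \<in> nilradical R" "a \<otimes> x \<in> nilradical R"
    using x by (auto simp: nilradical_def nat_pow_distrib intro!: exI[of _ n])
qed
qed

lemma ring_hom_nilradical:
  assumes "cring R" "cring S" "h \<in> ring_hom R S" "a \<in> nilradical R"
  shows "h a \<in> nilradical S"
proof -
  interpret ring_hom_cring R S h
    using assms by (intro ring_hom_cring.intro ring_hom_cring_axioms.intro)
  obtain n :: nat where n: "a \<in> carrier R" "a [^]\<^bsub>R\<^esub> n = \<zero>\<^bsub>R\<^esub>" using assms(4) by (auto simp: nilradical_def)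
  have "h a [^]\<^bsub>S\<^esub> n = \<zero>\<^bsub>S\<^esub>" using n by (metis hom_pow hom_zero)
  then show ?thesis using n by (auto simp: nilradical_def)
qed

lemma (in adic_pair) nilradical_sheaf_of_ideals:
  assumes chain: "\<And>\<U>. \<lbrakk>\<And>U. U \<in> \<U> \<Longrightarrow> openin X U; \<U> \<noteq> {}\<rbrakk> \<Longrightarrow> \<Union>\<U> \<in> \<U>"
  shows "sheaf_of_ideals (Spf A I) (\<lambda>U. nilradical (sect (Spf A I) U))"
proof -
  have sub: "nilradical (\<O> U) \<subseteq> carrier (\<O> U)" for U by (auto simp: nilradical_def)
  have zero: "\<zero>\<^bsub>\<O> {}\<^esub> \<in> nilradical (\<O> {})"
    by (rule additive_subgroup.zero_closed[OF
        ideal.axioms(1)[OF nilradical_ideal[OF spf_sect_cring[OF openin_empty]]]])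
  have "sheaf_of_sets X (\<lambda>U. nilradical (\<O> U)) (\<rho>)"
  proof (rule sheaf_of_sets_chain[OF chain])
    fix U V s assume "openin X U" "openin X V" "V \<subseteq> U" "s \<in> nilradical (\<O> U)"
    then show "\<rho> U V s \<in> nilradical (\<O> V)"
      by (intro ring_hom_nilradical[OF _ _ spf_res_hom] spf_sect_cring)
  next
    show "nilradical (\<O> {}) = {\<lambda>n Q. undefined}"
      using subset_singletonD[OF sub[of "{}", unfolded spf_sect_empty]] zero by (metis empty_iff)
  next
    fix U s assume "s \<in> nilradical (\<O> U)"
    then show "\<rho> U U s = s" using sub spf_res_id by blast
  qed (auto simp: spf_res_comp)
  then show ?thesis
    unfolding sheaf_of_ideals_def
    by (simp add: nilradical_ideal spf_sect_cring)
qed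

section \<open>Formal spectra with two points\<close>

text \<open>The fractions \<open>a n / \<sigma> n\<close> form, modulo the powers of \<open>I\<close>, a compatible system of elements of the
  local ring at the smaller prime \<open>p\<close>.  The limit is an element of square zero which is nonzero
  already modulo \<open>I\<close>.\<close>

locale two_point_pair = adic_pair A I for A :: "'a ring" (structure) and I :: "'a set" +
  fixes p m :: "'a set" and a \<sigma> :: "nat \<Rightarrow> 'a"
  assumes complete: "adically_complete A I"
    and reduced: "\<lbrakk>x \<in> carrier A; x [^] (k::nat) = \<zero>\<rbrakk> \<Longrightarrow> x = \<zero>"
    and points: "{P \<in> spec A. I \<subseteq> P} = {p, m}"
    and p_less_m: "p \<subset> m"
    and unit_off_m: "\<lbrakk>x \<in> carrier A; x \<notin> m\<rbrakk> \<Longrightarrow> \<exists>y\<in>carrier A. x \<otimes> y = \<one>"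
    and a_carrier: "a n \<in> carrier A"
    and sigma_carrier: "\<sigma> n \<in> carrier A"
    and sigma_notin: "\<sigma> n \<notin> p"
    and a_square: "a n \<otimes> a n \<in> ideal_power A I (Suc n)"
    and a_compat: "a (Suc n) \<otimes> \<sigma> n \<ominus> a n \<otimes> \<sigma> (Suc n) \<in> ideal_power A I (Suc n)"
    and a_nonzero: "\<lbrakk>u \<in> carrier A; u \<notin> p\<rbrakk> \<Longrightarrow> u \<otimes> a 0 \<notin> ideal_power A I (Suc 0)"
begin

abbreviation "\<O>\<^sub>X \<equiv> \<O> {p, m}"
abbreviation "\<O>\<^sub>p \<equiv> \<O> {p}"

lemma p_spec: "p \<in> spec A" and m_spec: "m \<in> spec A" and I_p: "I \<subseteq> p" and I_m: "I \<subseteq> m"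
  using points by blast+

lemma topspace_X: "topspace X = {p, m}"
  using points by (auto simp: spf_base_def topspace_zariski[OF is_cring])

lemma open_m:
  assumes "openin X U" "m \<in> U"
  shows "U = {p, m}"
proof -
  obtain V where V: "openin (zariski A) V" "U = V \<inter> {P. I \<subseteq> P}"
    using assms(1) by (auto simp: spf_base_def openin_subtopology)
  have "p \<in> V" using zariski_generization[OF V(1) _ p_spec, of m] assms(2) V(2) p_less_m by blast
  then show ?thesis using openin_subset[OF assms(1)] assms(2) V(2) I_p by (auto simp: topspace_X)
qed

lemma open_p: "openin X {p}"
proof -
  obtain f where f: "f \<in> m" "f \<notin> p" using p_less_m by blast
  interpret M: primeideal m A using m_spec by (simp add: spec_def)
  have fA: "f \<in> carrier A" using f(1) M.a_subset by blast
  have "openin (zariski A) {P \<in> spec A. f \<notin> P}"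
    unfolding zariski_def using fA by (intro topology_generated_by_Basis) blast
  moreover have "{P \<in> spec A. f \<notin> P} \<inter> {P. I \<subseteq> P} = {P \<in> {p, m}. f \<notin> P}"
    using points by blast
  moreover have "{P \<in> {p, m}. f \<notin> P} = {p}" using f by blast
  ultimately show ?thesis by (auto simp: spf_base_def openin_subtopology)
qed

lemma open_X: "openin X {p, m}"
  using openin_topspace[of X] by (simp add: topspace_X)

text \<open>The open sets form a chain with three members.\<close>

lemma Union_open_mem:
  assumes "\<And>U. U \<in> \<U> \<Longrightarrow> openin X U" "\<U> \<noteq> {}"
  shows "\<Union>\<U> \<in> \<U>"
proof -
  have sub: "U \<subseteq> {p, m}" if "U \<in> \<U>" for U
    using openin_subset[OF assms(1)[OF that]] by (simp add: topspace_X)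
  consider (m) U where "U \<in> \<U>" "m \<in> U" | (p) U where "m \<notin> \<Union>\<U>" "U \<in> \<U>" "p \<in> U"
    | (e) "p \<notin> \<Union>\<U>" "m \<notin> \<Union>\<U>" by blast
  then show ?thesis
  proof cases
    case m
    then have "U = {p, m}" using open_m assms(1) by blast
    then have "\<Union>\<U> = U" using sub m by blast
    then show ?thesis using m by simp
  next
    case p
    then have "\<Union>\<U> = U" using sub by blast
    then show ?thesis using p by simp
  next
    case e
    then have e: "U = {}" if "U \<in> \<U>" for U using sub[OF that] that by blast
    obtain U where "U \<in> \<U>" using assms(2) by blast
    then have "\<Union>\<U> = U" using e by blast
    then show ?thesis using \<open>U \<in> \<U>\<close> by simp
  qed
qed

subsection \<open>Points of the thickenings\<close>

lemma ring_hom_pi: "ring_hom_cring A (B n) (\<pi> n)"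
  by (intro ring_hom_cring.intro ring_hom_cring_axioms.intro thick_cring to_thick_hom is_cring)

lemma pi_mem_image_iff:
  assumes "P \<in> spec A" "I \<subseteq> P" "x \<in> carrier A"
  shows "\<pi> n x \<in> \<pi> n ` P \<longleftrightarrow> x \<in> P"
proof
  assume "\<pi> n x \<in> \<pi> n ` P"
  interpret P: primeideal P A using assms(1) by (simp add: spec_def)
  obtain y where y: "y \<in> P" "\<pi> n x = \<pi> n y" using \<open>\<pi> n x \<in> \<pi> n ` P\<close> by blast
  have yA: "y \<in> carrier A" using y(1) P.a_subset by blast
  have "x \<ominus> y \<in> ipow (Suc n)" using y(2) to_thick_eq_iff[OF assms(3) yA] by blast
  then have "x \<ominus> y \<in> P" using ideal_prod_inter[OF ipow_ideal I.is_ideal, of n] assms(2) by auto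
  then have "(x \<ominus> y) \<oplus> y \<in> P" using y(1) by (rule P.a_closed)
  moreover have "(x \<ominus> y) \<oplus> y = x" using assms(3) yA by (simp add: minus_eq a_assoc l_neg)
  ultimately show "x \<in> P" by simp
qed auto

lemma image_spec:
  assumes P: "P \<in> spec A" "I \<subseteq> P"
  shows "\<pi> n ` P \<in> spec (B n)"
proof -
  interpret h: ring_hom_cring A "B n" "\<pi> n" by (rule ring_hom_pi)
  interpret P: primeideal P A using P(1) by (simp add: spec_def)
  have c: "\<And>x. x \<in> carrier (B n) \<Longrightarrow> \<exists>y\<in>carrier A. x = \<pi> n y" by (auto simp: thick_carrier)
  note iff = pi_mem_image_iff[OF P]
  have "primeideal (\<pi> n ` P) (B n)"
  proof (rule primeidealI)
    show "ideal (\<pi> n ` P) (B n)"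
      using ring_ideal_imp_quot_ideal[OF ipow_ideal P.is_ideal, of "Suc n"]
      by (simp only: thick_def to_thick_def[abs_def])
    show "cring (B n)" by (rule thick_cring)
    have "\<one> \<notin> P" by (rule spec_proper[OF P(1)])
    then have "\<one>\<^bsub>B n\<^esub> \<notin> \<pi> n ` P" using iff[OF one_closed, of n] h.hom_one by metis
    then show "carrier (B n) \<noteq> \<pi> n ` P" using h.S.one_closed by blast
    fix x y assume x: "x \<in> carrier (B n)" and y: "y \<in> carrier (B n)"
      and xy: "x \<otimes>\<^bsub>B n\<^esub> y \<in> \<pi> n ` P"
    obtain x' y' where x': "x' \<in> carrier A" "x = \<pi> n x'" "y' \<in> carrier A" "y = \<pi> n y'"
      using c[OF x] c[OF y] by blast
    have "\<pi> n (x' \<otimes> y') \<in> \<pi> n ` P" using xy x' by simp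
    then have "x' \<otimes> y' \<in> P" using x' by (simp only: iff m_closed)
    then show "x \<in> \<pi> n ` P \<or> y \<in> \<pi> n ` P" using P.I_prime[OF x'(1,3)] x' by blast
  qed
  then show ?thesis by (simp add: spec_def)
qed

lemma contract_image:
  assumes "P \<in> spec A" "I \<subseteq> P"
  shows "contract A (\<pi> n) (\<pi> n ` P) = P"
proof -
  have "P \<subseteq> carrier A"
    using assms(1) unfolding spec_def
    by (metis mem_Collect_eq primeideal_def ideal.axioms(1) additive_subgroup.a_subset)
  then show ?thesis using pi_mem_image_iff[OF assms] by (auto simp: contract_def)
qed

lemma image_thick_open:
  assumes "P \<in> spec A" "I \<subseteq> P" "P \<in> U"
  shows "\<pi> n ` P \<in> W n U"
  using assms image_spec contract_image by (simp add: thick_open_def spec_preimage_def)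

abbreviation "Qm n \<equiv> \<pi> n ` m"

lemma Qm_mem: "Qm n \<in> W n {p, m}"
  by (intro image_thick_open m_spec I_m) simp

lemma thick_open_below_Qm:
  assumes "Q \<in> W n {p, m}"
  shows "Q \<in> spec (B n)" "Q \<subseteq> Qm n"
proof -
  have c: "contract A (\<pi> n) Q \<subseteq> m" and Q: "Q \<in> spec (B n)"
    using assms p_less_m by (auto simp: thick_open_def spec_preimage_def)
  show "Q \<in> spec (B n)" by (rule Q)
  have "Q \<subseteq> carrier (B n)"
    using Q unfolding spec_def
    by (metis mem_Collect_eq primeideal_def ideal.axioms(1) additive_subgroup.a_subset)
  then show "Q \<subseteq> Qm n" using c by (force simp: thick_carrier contract_def)
qed

lemma Qm_unit:
  assumes "f \<in> carrier (B n)" "f \<notin> Qm n"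
  shows "\<exists>g\<in>carrier (B n). f \<otimes>\<^bsub>B n\<^esub> g = \<one>\<^bsub>B n\<^esub>"
proof -
  interpret h: ring_hom_cring A "B n" "\<pi> n" by (rule ring_hom_pi)
  obtain f' where f': "f' \<in> carrier A" "f = \<pi> n f'" using assms(1) by (auto simp: thick_carrier)
  then obtain g' where g': "g' \<in> carrier A" "f' \<otimes> g' = \<one>" using unit_off_m[of f'] assms(2) by blast
  then have "f \<otimes>\<^bsub>B n\<^esub> \<pi> n g' = \<one>\<^bsub>B n\<^esub>" using f' by (metis h.hom_mult h.hom_one)
  then show ?thesis using g' by auto
qed

lemma frac_Qm_eqD:
  assumes "x \<in> carrier (B n)" "y \<in> carrier (B n)"
    and eq: "frac_at (B n) (Qm n) x \<one>\<^bsub>B n\<^esub> = frac_at (B n) (Qm n) y \<one>\<^bsub>B n\<^esub>"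
  shows "x = y"
proof -
  have Q: "Qm n \<in> spec (B n)" by (intro image_spec m_spec I_m)
  interpret M: mult_subset "B n" "carrier (B n) - Qm n" by (rule spec_mult_subset[OF thick_cring Q])
  obtain u where u: "u \<in> carrier (B n) - Qm n" "u \<otimes>\<^bsub>B n\<^esub> x = u \<otimes>\<^bsub>B n\<^esub> y"
    using eq assms(1,2) M.fraction_eq_iff[of x y "\<one>\<^bsub>B n\<^esub>" "\<one>\<^bsub>B n\<^esub>"] M.S_one by auto
  obtain g where g: "g \<in> carrier (B n)" "u \<otimes>\<^bsub>B n\<^esub> g = \<one>\<^bsub>B n\<^esub>" using Qm_unit[of u n] u by blast
  have k: "g \<otimes>\<^bsub>B n\<^esub> (u \<otimes>\<^bsub>B n\<^esub> z) = z" if "z \<in> carrier (B n)" for z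
  proof -
    have "g \<otimes>\<^bsub>B n\<^esub> (u \<otimes>\<^bsub>B n\<^esub> z) = (u \<otimes>\<^bsub>B n\<^esub> g) \<otimes>\<^bsub>B n\<^esub> z"
      using that g(1) u(1) by (simp add: M.m_ac)
    then show ?thesis using that g(2) by simp
  qed
  show ?thesis using k[OF assms(1)] k[OF assms(2)] unfolding u(2) by (rule trans[OF sym])
qed

subsection \<open>Global sections\<close>

text \<open>Near the closed point a section is a single fraction.  Its neighbourhood is the whole space and its
  denominator is a unit, so the section comes from the ring.\<close>

lemma level_section:
  assumes "s \<in> carrier (level n {p, m})"
  shows "\<exists>x\<in>carrier A. \<forall>Q\<in>W n {p, m}. s Q = frac_at (B n) Q (\<pi> n x) \<one>\<^bsub>B n\<^esub>"
proof -
  obtain V b f where V: "openin (zariski (B n)) V" "Qm n \<in> V" "b \<in> carrier (B n)" "f \<in> carrier (B n)"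
    "\<And>Q. Q \<in> V \<Longrightarrow> f \<notin> Q" "\<And>Q. Q \<in> V \<Longrightarrow> s Q = frac_at (B n) Q b f"
    using spec_sect_local[OF assms Qm_mem] by metis
  obtain g where g: "g \<in> carrier (B n)" "f \<otimes>\<^bsub>B n\<^esub> g = \<one>\<^bsub>B n\<^esub>" using Qm_unit[OF V(4) V(5)[OF V(2)]] by blast
  interpret R: cring "B n" by (rule thick_cring)
  obtain x where x: "x \<in> carrier A" "b \<otimes>\<^bsub>B n\<^esub> g = \<pi> n x"
    using R.m_closed[OF V(3) g(1)] by (auto simp: thick_carrier)
  have "s Q = frac_at (B n) Q (\<pi> n x) \<one>\<^bsub>B n\<^esub>" if Q: "Q \<in> W n {p, m}" for Q
  proof -
    have QV: "Q \<in> V" by (rule zariski_generization[OF V(1,2) thick_open_below_Qm[OF Q]])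
    interpret M: mult_subset "B n" "carrier (B n) - Q"
      by (rule spec_mult_subset[OF thick_cring thick_open_below_Qm(1)[OF Q]])
    have "b \<otimes>\<^bsub>B n\<^esub> \<one>\<^bsub>B n\<^esub> = (b \<otimes>\<^bsub>B n\<^esub> g) \<otimes>\<^bsub>B n\<^esub> f"
      using g V(3,4) by (simp add: R.m_assoc R.m_comm[of g f])
    then have "frac_at (B n) Q b f = frac_at (B n) Q (b \<otimes>\<^bsub>B n\<^esub> g) \<one>\<^bsub>B n\<^esub>"
      using g V(3,4) V(5)[OF QV] M.S_one by (intro M.fraction_eqI) auto
    then show ?thesis using V(6)[OF QV] x(2) by simp
  qed
  then show ?thesis using x(1) by blast
qed

text \<open>The elements representing a section at the various levels are unique, hence compatible, and
  completeness supplies a common lift.\<close>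

lemma global_section:
  assumes s: "s \<in> carrier \<O>\<^sub>X"
  shows "\<exists>x\<in>carrier A. \<forall>n. \<forall>Q\<in>W n {p, m}. s n Q = frac_at (B n) Q (\<pi> n x) \<one>\<^bsub>B n\<^esub>"
proof -
  obtain x where x: "\<And>n. x n \<in> carrier A"
    "\<And>n Q. Q \<in> W n {p, m} \<Longrightarrow> s n Q = frac_at (B n) Q (\<pi> n (x n)) \<one>\<^bsub>B n\<^esub>"
    using level_section[OF spf_level[OF s]] by metis
  have c: "\<tau> n (\<pi> (Suc n) (x (Suc n))) = \<pi> n (x n)" for n
  proof -
    interpret h: ring_hom_cring A "B n" "\<pi> n" by (rule ring_hom_pi)
    interpret h': ring_hom_cring A "B (Suc n)" "\<pi> (Suc n)" by (rule ring_hom_pi)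
    let ?P = "contract (B (Suc n)) (\<tau> n) (Qm n)"
    have Q: "Qm n \<in> spec_preimage (B (Suc n)) (B n) (\<tau> n) (W (Suc n) {p, m})"
      using Qm_mem by (simp add: step_preimage)
    have Q': "?P \<in> W (Suc n) {p, m}" using Q by (simp add: spec_preimage_def)
    have "s n (Qm n) = pull n {p, m} (s (Suc n)) (Qm n)"
      using s by (simp add: spf_carrier)
    also have "\<dots> = frac_at (B n) (Qm n) (\<tau> n (\<pi> (Suc n) (x (Suc n)))) (\<tau> n \<one>\<^bsub>B (Suc n)\<^esub>)"
      using x(1) spec_proper[OF thick_open_below_Qm(1)[OF Q']] x(2)[OF Q']
      by (intro spec_pullback_at[OF thick_cring thick_cring thick_step_hom Q]) auto
    finally have "frac_at (B n) (Qm n) (\<pi> n (x n)) \<one>\<^bsub>B n\<^esub>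
        = frac_at (B n) (Qm n) (\<tau> n (\<pi> (Suc n) (x (Suc n)))) \<one>\<^bsub>B n\<^esub>"
      using x(2)[OF Qm_mem] by (simp add: ring_hom_one[OF thick_step_hom])
    then have "\<pi> n (x n) = \<tau> n (\<pi> (Suc n) (x (Suc n)))"
      using x(1) by (intro frac_Qm_eqD) (auto simp: thick_step_to_thick)
    then show ?thesis by simp
  qed
  have "\<exists>!y. y \<in> carrier A \<and> (\<forall>n. \<pi> n y = \<pi> n (x n))"
    using complete c x(1) unfolding adically_complete_def by (auto simp: thick_carrier)
  then obtain y where y: "y \<in> carrier A" "\<And>n. \<pi> n y = \<pi> n (x n)" by blast
  then show ?thesis using x(2) by (intro bexI[of _ y]) simp_all
qed

text \<open>Separatedness is the uniqueness part of completeness, applied to the zero system.\<close>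

lemma ipow_Inter:
  assumes "x \<in> carrier A" "\<And>n. x \<in> ipow (Suc n)"
  shows "x = \<zero>"
proof -
  have z: "\<pi> n x = \<pi> n \<zero>" for n
    using to_thick_zero_iff[OF assms(1), of n] to_thick_zero_iff[OF zero_closed, of n] assms(2)
      additive_subgroup.zero_closed[OF ideal.axioms(1)[OF ipow_ideal]] by metis
  have "\<exists>!y. y \<in> carrier A \<and> (\<forall>n. \<pi> n y = \<pi> n \<zero>)"
    using complete unfolding adically_complete_def by (auto simp: thick_carrier thick_step_to_thick)
  then show ?thesis using z assms(1) zero_closed by metis
qed

lemma global_reduced: "nilradical \<O>\<^sub>X = {\<zero>\<^bsub>\<O>\<^sub>X\<^esub>}"
proof
  interpret R: cring "\<O>\<^sub>X" by (rule spf_sect_cring[OF open_X])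
  have "\<zero>\<^bsub>\<O>\<^sub>X\<^esub> [^]\<^bsub>\<O>\<^sub>X\<^esub> (1::nat) = \<zero>\<^bsub>\<O>\<^sub>X\<^esub>" by simp
  then show "{\<zero>\<^bsub>\<O>\<^sub>X\<^esub>} \<subseteq> nilradical \<O>\<^sub>X" unfolding nilradical_def by blast
  show "nilradical \<O>\<^sub>X \<subseteq> {\<zero>\<^bsub>\<O>\<^sub>X\<^esub>}"
  proof
    fix s assume "s \<in> nilradical \<O>\<^sub>X"
    then obtain k :: nat where s: "s \<in> carrier \<O>\<^sub>X"
      and k: "s [^]\<^bsub>\<O>\<^sub>X\<^esub> k = \<zero>\<^bsub>\<O>\<^sub>X\<^esub>"
      by (auto simp: nilradical_def)
    obtain x where x: "x \<in> carrier A"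
      "\<And>n Q. Q \<in> W n {p, m} \<Longrightarrow> s n Q = frac_at (B n) Q (\<pi> n x) \<one>\<^bsub>B n\<^esub>"
      using global_section[OF s] by blast
    have pow: "(s [^]\<^bsub>\<O>\<^sub>X\<^esub> i) n Q = frac_at (B n) Q (\<pi> n (x [^] i)) \<one>\<^bsub>B n\<^esub>"
      if Q: "Q \<in> W n {p, m}" for n Q and i :: nat
    proof -
      interpret h: ring_hom_cring A "B n" "\<pi> n" by (rule ring_hom_pi)
      interpret M: mult_subset "B n" "carrier (B n) - Q"
        by (rule spec_mult_subset[OF thick_cring thick_open_below_Qm(1)[OF Q]])
      show ?thesis
      proof (induction i)
        case 0
        then show ?case using Q by (simp add: spf_one spec_sect_def localization_def)
      next
        case (Suc i)
        have "(s [^]\<^bsub>\<O>\<^sub>X\<^esub> Suc i) n Q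
            = (s [^]\<^bsub>\<O>\<^sub>X\<^esub> i) n Q \<otimes>\<^bsub>local_ring_at (B n) Q\<^esub> s n Q"
          using Q by (simp add: spf_mult spec_sect_def)
        also have "\<dots> = frac_at (B n) Q (\<pi> n (x [^] i) \<otimes>\<^bsub>B n\<^esub> \<pi> n x) (\<one>\<^bsub>B n\<^esub> \<otimes>\<^bsub>B n\<^esub> \<one>\<^bsub>B n\<^esub>)"
          unfolding Suc.IH x(2)[OF Q] using x(1) M.S_one by (intro M.localization_mult) auto
        finally show ?case using x(1) by (simp del: h.hom_pow)
      qed
    qed
    have "x [^] k \<in> ipow (Suc n)" for n
    proof -
      interpret h: ring_hom_cring A "B n" "\<pi> n" by (rule ring_hom_pi)
      have "frac_at (B n) (Qm n) (\<pi> n (x [^] k)) \<one>\<^bsub>B n\<^esub> = frac_at (B n) (Qm n) \<zero>\<^bsub>B n\<^esub> \<one>\<^bsub>B n\<^esub>"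
        using pow[OF Qm_mem, of k n] Qm_mem[of n] unfolding k
        by (simp add: spf_zero spec_sect_def localization_def)
      then have "\<pi> n (x [^] k) = \<zero>\<^bsub>B n\<^esub>"
        using x(1) by (intro frac_Qm_eqD) (auto simp del: h.hom_pow)
      then show ?thesis using to_thick_zero_iff[of "x [^] k" n] x(1) by blast
    qed
    then have "x [^] k = \<zero>" using x(1) by (intro ipow_Inter) auto
    then have x0: "x = \<zero>" using reduced x(1) by blast
    have "s n = \<zero>\<^bsub>\<O>\<^sub>X\<^esub> n" for n
    proof (rule spec_sect_eqI[OF spf_level[OF s] spf_level[OF R.zero_closed]])
      interpret h: ring_hom_cring A "B n" "\<pi> n" by (rule ring_hom_pi)
      fix Q assume "Q \<in> W n {p, m}"
      then show "s n Q = \<zero>\<^bsub>\<O>\<^sub>X\<^esub> n Q"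
        using x(2) x0 by (simp add: spf_zero spec_sect_def localization_def)
    qed
    then show "s \<in> {\<zero>\<^bsub>\<O>\<^sub>X\<^esub>}" by auto
  qed
qed

subsection \<open>The nilpotent section over the open point\<close>

definition \<xi> :: "'a spf_section" where
  "\<xi> n = (\<lambda>Q\<in>W n {p}. frac_at (B n) Q (\<pi> n (a n)) (\<pi> n (\<sigma> n)))"

lemma thick_open_p:
  assumes "Q \<in> W n {p}"
  shows "Q \<in> spec (B n)" "contract A (\<pi> n) Q = p" "x \<in> carrier A \<Longrightarrow> \<pi> n x \<in> Q \<longleftrightarrow> x \<in> p"
  using assms by (auto simp: thick_open_def spec_preimage_def contract_def)

lemma xi_level: "\<xi> n \<in> carrier (level n {p})"
proof (rule spec_sect_carrierI[OF _ _ thick_cring])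
  interpret h: ring_hom_cring A "B n" "\<pi> n" by (rule ring_hom_pi)
  show "\<xi> n Q = undefined" if "Q \<notin> W n {p}" for Q using that by (simp add: \<xi>_def)
  show "W n {p} \<subseteq> spec (B n)" using thick_open_p(1) by blast
  fix Q assume "Q \<in> W n {p}"
  then show "locally_fraction (B n) (W n {p}) (\<xi> n) Q"
    using thick_open_open[OF open_p] a_carrier sigma_carrier sigma_notin thick_open_p(3)
    by (intro exI[of _ "W n {p}"] exI[of _ "\<pi> n (a n)"] exI[of _ "\<pi> n (\<sigma> n)"]) (simp add: \<xi>_def)
qed

lemma xi_carrier: "\<xi> \<in> carrier \<O>\<^sub>p"
  unfolding spf_carrier
proof (intro conjI allI)
  fix n
  show "\<xi> n \<in> carrier (level n {p})" by (rule xi_level)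
  let ?pb = "pull n {p} (\<xi> (Suc n))"
  have cl: "?pb \<in> carrier (level n {p})"
    using spec_pullback_carrier[OF thick_cring thick_cring thick_step_hom xi_level[of "Suc n"]]
    by (simp add: step_preimage)
  show "?pb = \<xi> n"
  proof (rule spec_sect_eqI[OF cl xi_level])
    interpret h: ring_hom_cring A "B n" "\<pi> n" by (rule ring_hom_pi)
    interpret h': ring_hom_cring A "B (Suc n)" "\<pi> (Suc n)" by (rule ring_hom_pi)
    fix Q assume Q: "Q \<in> W n {p}"
    interpret M: mult_subset "B n" "carrier (B n) - Q"
      by (rule spec_mult_subset[OF thick_cring thick_open_p(1)[OF Q]])
    let ?P = "contract (B (Suc n)) (\<tau> n) Q"
    have Q1: "Q \<in> spec_preimage (B (Suc n)) (B n) (\<tau> n) (W (Suc n) {p})"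
      using Q by (simp add: step_preimage)
    then have P: "?P \<in> W (Suc n) {p}" by (simp add: spec_preimage_def)
    note c = a_carrier sigma_carrier
    have "?pb Q = frac_at (B n) Q (\<tau> n (\<pi> (Suc n) (a (Suc n)))) (\<tau> n (\<pi> (Suc n) (\<sigma> (Suc n))))"
      using c thick_open_p(3)[OF P] sigma_notin P
      by (intro spec_pullback_at[OF thick_cring thick_cring thick_step_hom Q1]) (simp_all add: \<xi>_def)
    also have "\<dots> = frac_at (B n) Q (\<pi> n (a (Suc n))) (\<pi> n (\<sigma> (Suc n)))"
      using c by (simp add: thick_step_to_thick)
    also have "\<dots> = frac_at (B n) Q (\<pi> n (a n)) (\<pi> n (\<sigma> n))"
    proof (rule M.fraction_eqI)
      have "\<pi> n (a (Suc n) \<otimes> \<sigma> n) = \<pi> n (a n \<otimes> \<sigma> (Suc n))"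
        using a_compat[of n] c by (subst to_thick_eq_iff) auto
      then show "\<pi> n (a (Suc n)) \<otimes>\<^bsub>B n\<^esub> \<pi> n (\<sigma> n) = \<pi> n (a n) \<otimes>\<^bsub>B n\<^esub> \<pi> n (\<sigma> (Suc n))"
        using c by simp
    qed (use c sigma_notin thick_open_p(3)[OF Q] in auto)
    finally show "?pb Q = \<xi> n Q" using Q by (simp add: \<xi>_def)
  qed
qed

lemma xi_nilpotent: "\<xi> \<in> nilradical \<O>\<^sub>p"
proof -
  interpret R: cring "\<O>\<^sub>p" by (rule spf_sect_cring[OF open_p])
  have cl: "\<xi> \<otimes>\<^bsub>\<O>\<^sub>p\<^esub> \<xi> \<in> carrier \<O>\<^sub>p" using xi_carrier by blast
  have "(\<xi> \<otimes>\<^bsub>\<O>\<^sub>p\<^esub> \<xi>) n = \<zero>\<^bsub>\<O>\<^sub>p\<^esub> n" for n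
  proof (rule spec_sect_eqI[OF spf_level[OF cl] spf_level[OF R.zero_closed]])
    interpret h: ring_hom_cring A "B n" "\<pi> n" by (rule ring_hom_pi)
    fix Q assume Q: "Q \<in> W n {p}"
    interpret M: mult_subset "B n" "carrier (B n) - Q"
      by (rule spec_mult_subset[OF thick_cring thick_open_p(1)[OF Q]])
    note c = a_carrier sigma_carrier
    have s: "\<pi> n (\<sigma> n) \<in> carrier (B n) - Q" using c sigma_notin thick_open_p(3)[OF Q] by auto
    have "(\<xi> \<otimes>\<^bsub>\<O>\<^sub>p\<^esub> \<xi>) n Q
       = frac_at (B n) Q (\<pi> n (a n)) (\<pi> n (\<sigma> n)) \<otimes>\<^bsub>local_ring_at (B n) Q\<^esub> frac_at (B n) Q (\<pi> n (a n)) (\<pi> n (\<sigma> n))"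
      using Q by (simp add: spf_mult spec_sect_def \<xi>_def)
    also have "\<dots> = frac_at (B n) Q (\<pi> n (a n) \<otimes>\<^bsub>B n\<^esub> \<pi> n (a n)) (\<pi> n (\<sigma> n) \<otimes>\<^bsub>B n\<^esub> \<pi> n (\<sigma> n))"
      using c s by (intro M.localization_mult) auto
    also have "\<pi> n (a n) \<otimes>\<^bsub>B n\<^esub> \<pi> n (a n) = \<zero>\<^bsub>B n\<^esub>"
      using to_thick_zero_iff[of "a n \<otimes> a n" n] a_square[of n] c by simp
    also have "frac_at (B n) Q \<zero>\<^bsub>B n\<^esub> (\<pi> n (\<sigma> n) \<otimes>\<^bsub>B n\<^esub> \<pi> n (\<sigma> n)) = frac_at (B n) Q \<zero>\<^bsub>B n\<^esub> \<one>\<^bsub>B n\<^esub>"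
      using s M.S_one M.S_mult[OF s s] by (intro M.fraction_eqI) auto
    finally show "(\<xi> \<otimes>\<^bsub>\<O>\<^sub>p\<^esub> \<xi>) n Q = \<zero>\<^bsub>\<O>\<^sub>p\<^esub> n Q"
      using Q by (simp add: spf_zero spec_sect_def localization_def)
  qed
  then have "\<xi> \<otimes>\<^bsub>\<O>\<^sub>p\<^esub> \<xi> = \<zero>\<^bsub>\<O>\<^sub>p\<^esub>" by blast
  then have "\<xi> [^]\<^bsub>\<O>\<^sub>p\<^esub> (2::nat) = \<zero>\<^bsub>\<O>\<^sub>p\<^esub>"
    using xi_carrier by (simp add: numeral_2_eq_2)
  then show ?thesis using xi_carrier by (auto simp: nilradical_def)
qed

lemma xi_nonzero: "\<xi> \<noteq> \<zero>\<^bsub>\<O>\<^sub>p\<^esub>"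
proof
  assume eq: "\<xi> = \<zero>\<^bsub>\<O>\<^sub>p\<^esub>"
  interpret h: ring_hom_cring A "B 0" "\<pi> 0" by (rule ring_hom_pi)
  have Q: "\<pi> 0 ` p \<in> W 0 {p}" by (intro image_thick_open p_spec I_p) simp
  interpret M: mult_subset "B 0" "carrier (B 0) - \<pi> 0 ` p"
    by (rule spec_mult_subset[OF thick_cring thick_open_p(1)[OF Q]])
  note c = a_carrier sigma_carrier
  have s: "\<pi> 0 (\<sigma> 0) \<in> carrier (B 0) - \<pi> 0 ` p" using c sigma_notin thick_open_p(3)[OF Q] by auto
  have "frac_at (B 0) (\<pi> 0 ` p) (\<pi> 0 (a 0)) (\<pi> 0 (\<sigma> 0)) = \<xi> 0 (\<pi> 0 ` p)"
    using Q by (simp add: \<xi>_def)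
  also have "\<dots> = frac_at (B 0) (\<pi> 0 ` p) \<zero>\<^bsub>B 0\<^esub> \<one>\<^bsub>B 0\<^esub>"
    unfolding eq using Q by (simp add: spf_zero spec_sect_def localization_def)
  finally obtain u where u: "u \<in> carrier (B 0) - \<pi> 0 ` p"
     "u \<otimes>\<^bsub>B 0\<^esub> (\<pi> 0 (a 0) \<otimes>\<^bsub>B 0\<^esub> \<one>\<^bsub>B 0\<^esub>) = u \<otimes>\<^bsub>B 0\<^esub> (\<zero>\<^bsub>B 0\<^esub> \<otimes>\<^bsub>B 0\<^esub> \<pi> 0 (\<sigma> 0))"
    using c s M.S_one M.fraction_eq_iff[of "\<pi> 0 (a 0)" "\<zero>\<^bsub>B 0\<^esub>" "\<pi> 0 (\<sigma> 0)" "\<one>\<^bsub>B 0\<^esub>"] by auto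
  obtain u' where u': "u' \<in> carrier A" "u = \<pi> 0 u'" using u(1) by (auto simp: thick_carrier)
  have "u' \<notin> p" using u(1) u' by blast
  moreover have "\<pi> 0 (u' \<otimes> a 0) = \<zero>\<^bsub>B 0\<^esub>" using u u' c s by simp
  ultimately show False
    using a_nonzero[OF u'(1)] to_thick_zero_iff[of "u' \<otimes> a 0" 0] u'(1) c by simp
qed

subsection \<open>Failure of coherence\<close>

text \<open>Generators defined near the closed point are defined everywhere, so they vanish, and with them all
  their combinations over the open point; but \<open>\<xi>\<close> would have to be one.\<close>

lemma not_finite_type:
  "\<not> finite_type (Spf A I) (ideal_module (Spf A I) (\<lambda>U. nilradical (sect (Spf A I) U)))"
proof
  let ?N = "ideal_module (Spf A I) (\<lambda>U. nilradical (sect (Spf A I) U))"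
  assume "finite_type (Spf A I) ?N"
  then obtain U n \<phi> where U: "openin X U" "m \<in> U"
    and hom: "mod_sheaf_hom (open_subspace (Spf A I) U) (free_sheaf (Spf A I) n) ?N \<phi>"
    and sur: "mod_sheaf_surj (open_subspace (Spf A I) U) (free_sheaf (Spf A I) n) ?N \<phi>"
    unfolding finite_type_def by (auto simp: topspace_X)
  have UX: "U = {p, m}" by (rule open_m[OF U])
  have oX: "openin (subtopology X {p, m}) {p, m}" and op: "openin (subtopology X {p, m}) {p}"
    using open_X open_p by (auto simp: openin_open_subtopology)
  let ?F = "free_sheaf (Spf A I) n" and ?O = "\<O>\<^sub>p"
  interpret R: cring ?O by (rule spf_sect_cring[OF open_p])
  interpret RX: cring "\<O>\<^sub>X" by (rule spf_sect_cring[OF open_X])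
  have Fc: "carrier (msect ?F V) = {..<n} \<rightarrow>\<^sub>E carrier (\<O> V)"
    and Fadd: "x \<oplus>\<^bsub>msect ?F V\<^esub> y = (\<lambda>i\<in>{..<n}. x i \<oplus>\<^bsub>\<O> V\<^esub> y i)"
    and Fs: "c \<odot>\<^bsub>msect ?F V\<^esub> x = (\<lambda>i\<in>{..<n}. c \<otimes>\<^bsub>\<O> V\<^esub> x i)"
    and Fr: "mres ?F V V' x = (\<lambda>i\<in>{..<n}. \<rho> V V' (x i))" for V V' x y c
    by (simp_all add: free_sheaf_def)
  have Nc: "carrier (msect ?N V) = nilradical (\<O> V)"
    and Nadd: "x \<oplus>\<^bsub>msect ?N V\<^esub> y = x \<oplus>\<^bsub>\<O> V\<^esub> y"
    and Ns: "c \<odot>\<^bsub>msect ?N V\<^esub> x = c \<otimes>\<^bsub>\<O> V\<^esub> x"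
    and Nr: "mres ?N = \<rho>" for V x y c
    by (simp_all add: ideal_module_def)
  have os: "base (open_subspace (Spf A I) U) = subtopology X {p, m}"
    "sect (open_subspace (Spf A I) U) = \<O>" by (simp_all add: open_subspace_def UX)
  have nil: "nilradical (\<O> V) \<subseteq> carrier (\<O> V)" for V by (auto simp: nilradical_def)
  have cl: "\<phi> V x \<in> nilradical (\<O> V)"
    and add: "y \<in> {..<n} \<rightarrow>\<^sub>E carrier (\<O> V) \<Longrightarrow>
      \<phi> V (\<lambda>i\<in>{..<n}. x i \<oplus>\<^bsub>\<O> V\<^esub> y i) = \<phi> V x \<oplus>\<^bsub>\<O> V\<^esub> \<phi> V y"
    and smul: "c \<in> carrier (\<O> V) \<Longrightarrow> \<phi> V (\<lambda>i\<in>{..<n}. c \<otimes>\<^bsub>\<O> V\<^esub> x i) = c \<otimes>\<^bsub>\<O> V\<^esub> \<phi> V x"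
    if "openin (subtopology X {p, m}) V" "x \<in> {..<n} \<rightarrow>\<^sub>E carrier (\<O> V)" for V x y c
    using hom that unfolding mod_sheaf_hom_def os Fc Fadd Fs Nc Nadd Ns by blast+
  have rs: "\<phi> {p} (\<lambda>i\<in>{..<n}. \<rho> {p, m} {p} (x i)) = \<rho> {p, m} {p} (\<phi> {p, m} x)"
    if "x \<in> {..<n} \<rightarrow>\<^sub>E carrier \<O>\<^sub>X" for x
  proof -
    have "\<forall>U V. openin (subtopology X {p, m}) U \<and> openin (subtopology X {p, m}) V \<and> V \<subseteq> U \<longrightarrow>
        (\<forall>x\<in>carrier (msect ?F U). \<phi> V (mres ?F U V x) = mres ?N U V (\<phi> U x))"
      using hom unfolding mod_sheaf_hom_def os by (rule conjunct2)
    from this[rule_format, of "{p, m}" "{p}" x] show ?thesis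
      using that oX op unfolding Fc Fr Nr by simp
  qed
  have r_hom: "\<rho> {p, m} {p} \<in> ring_hom \<O>\<^sub>X ?O"
    by (rule spf_res_hom[OF open_X open_p]) auto
  interpret r: ring_hom_cring "\<O>\<^sub>X" ?O "\<rho> {p, m} {p}"
    by (intro ring_hom_cring.intro ring_hom_cring_axioms.intro R.is_cring RX.is_cring r_hom)
  \<comment> \<open>The images of the standard basis over \<open>{p}\<close> are restrictions of global nilpotents.\<close>
  define e where "e V k = (\<lambda>i\<in>{..<n}. if i = k then \<one>\<^bsub>\<O> V\<^esub> else \<zero>\<^bsub>\<O> V\<^esub>)" for V k
  have eX: "e {p, m} k \<in> {..<n} \<rightarrow>\<^sub>E carrier \<O>\<^sub>X" for k by (auto simp: e_def)
  have ep: "e {p} k \<in> {..<n} \<rightarrow>\<^sub>E carrier ?O" for k by (auto simp: e_def)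
  have "\<phi> {p} (e {p} k) = \<zero>\<^bsub>?O\<^esub>" for k
  proof -
    have "e {p} k = (\<lambda>i\<in>{..<n}. \<rho> {p, m} {p} (e {p, m} k i))"
      by (rule ext) (simp add: e_def)
    then have "\<phi> {p} (e {p} k) = \<rho> {p, m} {p} (\<phi> {p, m} (e {p, m} k))"
      using rs[OF eX] by simp
    also have "\<phi> {p, m} (e {p, m} k) = \<zero>\<^bsub>\<O>\<^sub>X\<^esub>"
      using cl[OF oX eX, of k] unfolding global_reduced by simp
    finally show ?thesis by simp
  qed
  note e0 = this
  have z: "(\<lambda>i\<in>{..<n}. \<zero>\<^bsub>?O\<^esub>) \<in> {..<n} \<rightarrow>\<^sub>E carrier ?O" by auto
  have phi0: "\<phi> {p} (\<lambda>i\<in>{..<n}. \<zero>\<^bsub>?O\<^esub>) = \<zero>\<^bsub>?O\<^esub>"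
  proof -
    have eq: "(\<lambda>i\<in>{..<n}. \<zero>\<^bsub>?O\<^esub> \<otimes>\<^bsub>?O\<^esub> (\<lambda>i\<in>{..<n}. \<zero>\<^bsub>?O\<^esub>) i) = (\<lambda>i\<in>{..<n}. \<zero>\<^bsub>?O\<^esub>)"
      by (rule restrict_ext) simp
    have "\<phi> {p} (\<lambda>i\<in>{..<n}. \<zero>\<^bsub>?O\<^esub>) = \<zero>\<^bsub>?O\<^esub> \<otimes>\<^bsub>?O\<^esub> \<phi> {p} (\<lambda>i\<in>{..<n}. \<zero>\<^bsub>?O\<^esub>)"
      using smul[OF op z R.zero_closed] unfolding eq .
    also have "\<dots> = \<zero>\<^bsub>?O\<^esub>" by (rule R.l_null[OF subsetD[OF nil cl[OF op z]]])
    finally show ?thesis .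
  qed
  have all0: "\<phi> {p} s = \<zero>\<^bsub>?O\<^esub>" if s: "s \<in> {..<n} \<rightarrow>\<^sub>E carrier ?O" for s
  proof -
    have sc: "s i \<in> carrier ?O" if "i < n" for i using s that by (auto simp: PiE_iff)
    \<comment> \<open>Truncating \<open>s\<close> builds it up from the basis one coordinate at a time.\<close>
    define tr where "tr k = (\<lambda>i\<in>{..<n}. if i < k then s i else \<zero>\<^bsub>?O\<^esub>)" for k
    have trc: "tr k \<in> {..<n} \<rightarrow>\<^sub>E carrier ?O" for k using sc by (auto simp: tr_def)
    have "k \<le> n \<Longrightarrow> \<phi> {p} (tr k) = \<zero>\<^bsub>?O\<^esub>" for k
    proof (induction k)
      case 0
      have "tr 0 = (\<lambda>i\<in>{..<n}. \<zero>\<^bsub>?O\<^esub>)" unfolding tr_def by (rule restrict_ext) simp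
      then show ?case using phi0 by (simp only:)
    next
      case (Suc k)
      let ?y = "\<lambda>i\<in>{..<n}. s k \<otimes>\<^bsub>?O\<^esub> e {p} k i"
      have sk: "s k \<in> carrier ?O" using Suc.prems sc by simp
      have y: "?y \<in> {..<n} \<rightarrow>\<^sub>E carrier ?O" using sk by (auto simp: e_def)
      have "tr (Suc k) = (\<lambda>i\<in>{..<n}. tr k i \<oplus>\<^bsub>?O\<^esub> ?y i)"
        unfolding tr_def using sk sc
        by (intro restrict_ext) (auto simp: e_def less_Suc_eq)
      then have "\<phi> {p} (tr (Suc k)) = \<phi> {p} (tr k) \<oplus>\<^bsub>?O\<^esub> \<phi> {p} ?y"
        using add[OF op trc y] by (simp only:)
      also have "\<phi> {p} ?y = s k \<otimes>\<^bsub>?O\<^esub> \<phi> {p} (e {p} k)" by (rule smul[OF op ep sk])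
      finally show ?case using Suc e0 sk by simp
    qed
    then have "\<phi> {p} (tr n) = \<zero>\<^bsub>?O\<^esub>" by simp
    moreover have "tr n = s" using s by (auto simp: tr_def PiE_iff extensional_def)
    ultimately show ?thesis by simp
  qed
  obtain V s where V: "openin (subtopology X {p, m}) V" "p \<in> V" "V \<subseteq> {p}"
    "s \<in> {..<n} \<rightarrow>\<^sub>E carrier (\<O> V)" "\<phi> V s = \<rho> {p} V \<xi>"
  proof -
    have "\<forall>U. openin (subtopology X {p, m}) U \<longrightarrow> (\<forall>t\<in>nilradical (\<O> U). \<forall>x\<in>U.
        \<exists>V. openin (subtopology X {p, m}) V \<and> x \<in> V \<and> V \<subseteq> U \<and>
          (\<exists>s\<in>{..<n} \<rightarrow>\<^sub>E carrier (\<O> V). \<phi> V s = \<rho> U V t))"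
      using sur unfolding mod_sheaf_surj_def os Fc Nc Nr .
    from this[rule_format, OF op xi_nilpotent singletonI] show ?thesis
      using that by (elim exE conjE bexE)
  qed
  have "V = {p}" using V(2,3) by blast
  then have "\<xi> = \<zero>\<^bsub>?O\<^esub>" using V(4,5) all0 spf_res_id[OF xi_carrier] by simp
  then show False using xi_nonzero by simp
qed

lemma nilradical_not_coherent:
  "\<not> coherent_sheaf (Spf A I) (ideal_module (Spf A I) (\<lambda>U. nilradical (sect (Spf A I) U)))"
  using not_finite_type by (simp add: coherent_sheaf_def)

end

unbundle fps_syntax

section \<open>A discrete valuation ring with an inseparable quadratic extension in its completion\<close>

lemma bit_fps_uminus: "- u = (u :: bit fps)"
  by (simp add: fps_eq_iff)

lemma bit_fps_add_self: "u + u = (0 :: bit fps)"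
proof (rule fps_ext)
  fix n
  have "u $ n + u $ n = 0" by (cases "u $ n") simp_all
  then show "(u + u) $ n = 0 $ n" by (simp only: fps_add_nth fps_zero_nth)
qed

lemma bit_fps_diff: "u - v = u + (v :: bit fps)"
  by (simp add: fps_eq_iff)

lemma bit_fps_square_add: "(u + v) ^ 2 = u ^ 2 + (v :: bit fps) ^ 2"
proof -
  have "(u + v) ^ 2 = u ^ 2 + v ^ 2 + (u * v + u * v)"
    by (simp add: power2_eq_square algebra_simps)
  then show ?thesis by (simp add: bit_fps_add_self)
qed

text \<open>Polynomials in one variable over the polynomials in the parameter of \<open>F\<^sub>2[[s]]\<close>; their values at
  \<open>f\<close> are the elements of \<open>F\<^sub>2[s, f]\<close>.\<close>

definition poly_like :: "bit fps poly set" where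
  "poly_like = {P. \<forall>i. coeff P i \<in> range fps_of_poly}"

lemma uncountable_bit_fps: "uncountable (UNIV :: bit fps set)"
proof
  assume "countable (UNIV :: bit fps set)"
  then have c: "countable (range (\<lambda>u :: bit fps. {n. u $ n = 1}))" by (rule countable_image)
  have "range (\<lambda>u :: bit fps. {n. u $ n = 1}) = UNIV"
  proof (intro equalityI subset_UNIV subsetI)
    fix N :: "nat set"
    have "N = {n. Abs_fps (\<lambda>n. if n \<in> N then 1 else 0 :: bit) $ n = 1}" by auto
    then show "N \<in> range (\<lambda>u :: bit fps. {n. u $ n = 1})" by blast
  qed
  then have "countable (UNIV :: nat set set)" using c by simp
  then have "range (from_nat_into (UNIV :: nat set set)) = UNIV"
    by (intro range_from_nat_into) auto
  then show False using Cantors_theorem[of "UNIV :: nat set"] by (metis Pow_UNIV)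
qed

lemma countable_poly_over:
  assumes "countable (D :: 'a::zero set)"
  shows "countable {P :: 'a poly. \<forall>i. coeff P i \<in> D}"
proof (rule countable_image_inj_on)
  show "inj_on coeffs {P :: 'a poly. \<forall>i. coeff P i \<in> D}"
    by (auto simp: inj_on_def coeffs_eq_iff)
  have "coeffs ` {P :: 'a poly. \<forall>i. coeff P i \<in> D} \<subseteq> lists D"
    by (auto simp: coeffs_def)
  then show "countable (coeffs ` {P :: 'a poly. \<forall>i. coeff P i \<in> D})"
    using countable_lists[OF assms] countable_subset by blast
qed

text \<open>The series algebraic over the polynomials form a countable set.\<close>

lemma exists_transcendental: "\<exists>f :: bit fps. \<forall>P\<in>poly_like. P \<noteq> 0 \<longrightarrow> poly P f \<noteq> 0"
proof -
  have "(UNIV :: bit set) = {0, 1}" by (auto intro: bit.exhaust)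
  then have "countable (UNIV :: bit set)" by (metis countable_finite finite.emptyI finite_insert)
  then have "countable (UNIV :: bit poly set)" using countable_poly_over[of "UNIV :: bit set"] by simp
  then have "countable poly_like"
    unfolding poly_like_def by (intro countable_poly_over countable_image)
  then have "countable (\<Union>P\<in>poly_like - {0}. {f :: bit fps. poly P f = 0})"
    by (intro countable_UN countable_Diff) (auto intro: countable_finite poly_roots_finite)
  then have "(\<Union>P\<in>poly_like - {0}. {f :: bit fps. poly P f = 0}) \<noteq> UNIV"
    using uncountable_bit_fps by metis
  then show ?thesis by blast
qed

text \<open>The axioms describe a discrete valuation ring \<open>R\<close> with parameter \<open>s\<close> (here \<open>fps_X\<close>) that lies
  densely in \<open>F\<^sub>2[[s]]\<close>, together with a purely inseparable element \<open>f\<close> of degree two over its field of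
  fractions.\<close>

locale nonsplit_dvr =
  fixes R :: "bit fps set" and f :: "bit fps"
  assumes R_0: "0 \<in> R" and R_1: "1 \<in> R"
    and R_add: "\<lbrakk>u \<in> R; v \<in> R\<rbrakk> \<Longrightarrow> u + v \<in> R"
    and R_mult: "\<lbrakk>u \<in> R; v \<in> R\<rbrakk> \<Longrightarrow> u * v \<in> R"
    and R_cutoff: "fps_cutoff n f \<in> R"
    and R_X: "fps_X \<in> R"
    and R_divide_X: "fps_X * u \<in> R \<Longrightarrow> u \<in> R"
    and R_inverse: "\<lbrakk>u \<in> R; u $ 0 \<noteq> 0\<rbrakk> \<Longrightarrow> inverse u \<in> R"
    and f_square: "f ^ 2 \<in> R"
    and f_not_fraction: "\<lbrakk>u \<in> R; v \<in> R; u * f = v\<rbrakk> \<Longrightarrow> u = 0"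

text \<open>\<open>R\<close> consists of the power series that are fractions of elements of \<open>S = F\<^sub>2[s, f\<^sup>2]\<close>.  It is
  closed under exact division simply because divisibility is tested in \<open>F\<^sub>2[[s]]\<close>.  A relation \<open>u f = v\<close>
  with \<open>u\<close> and \<open>v\<close> in \<open>S\<close> is a polynomial relation for \<open>f\<close> whose odd part comes from \<open>u\<close> and whose
  even part comes from \<open>v\<close>, so transcendence of \<open>f\<close> forces \<open>u = 0\<close>.\<close>

lemma exists_nonsplit_dvr: "\<exists>R f. nonsplit_dvr R f"
proof -
  obtain f :: "bit fps" where f: "\<And>P. \<lbrakk>P \<in> poly_like; P \<noteq> 0\<rbrakk> \<Longrightarrow> poly P f \<noteq> 0"
    using exists_transcendental by blast
  define D where "D = range (fps_of_poly :: bit poly \<Rightarrow> bit fps)"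
  have D0: "0 \<in> D" and D1: "1 \<in> D" and DX: "fps_X \<in> D" and Dc: "fps_cutoff n f \<in> D" for n
    unfolding D_def
    by (auto intro: range_eqI[of _ _ 0] range_eqI[of _ _ 1] range_eqI[of _ _ "[:0, 1:]"]
        range_eqI[of _ _ "truncate_fps n f"])
  have Da: "u + v \<in> D" and Dm: "u * v \<in> D" if "u \<in> D" "v \<in> D" for u v
    using that unfolding D_def by (auto simp flip: fps_of_poly_add fps_of_poly_mult)
  have Ds: "sum g K \<in> D" if "\<And>i. i \<in> K \<Longrightarrow> g i \<in> D" for g and K :: "nat set"
    using that by (induction K rule: infinite_finite_induct) (auto simp: D0 Da)
  define E where "E = {P :: bit fps poly. (\<forall>i. coeff P i \<in> D) \<and> (\<forall>i. odd i \<longrightarrow> coeff P i = 0)}"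
  have Ea: "P + Q \<in> E" if "P \<in> E" "Q \<in> E" for P Q using that Da by (auto simp: E_def)
  have Em: "P * Q \<in> E" if "P \<in> E" "Q \<in> E" for P Q
  proof -
    have "coeff P i * coeff Q (n - i) = 0" if "odd n" "i \<le> n" for i n
    proof (cases "odd i")
      case True then show ?thesis using \<open>P \<in> E\<close> by (simp add: E_def)
    next
      case False
      then have "odd (n - i)" using that by simp
      then show ?thesis using \<open>Q \<in> E\<close> by (simp add: E_def)
    qed
    then show ?thesis using that by (auto simp: E_def coeff_mult intro!: Ds Dm sum.neutral)
  qed
  have Ec: "[:u:] \<in> E" if "u \<in> D" for u
    using that D0 by (auto simp: E_def coeff_pCons split: nat.splits)
  have E2: "monom 1 2 \<in> E" using D0 D1 by (auto simp: E_def)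
  define S where "S = (\<lambda>P. poly P f) ` E"
  have SD: "u \<in> S" if "u \<in> D" for u
    using Ec[OF that] unfolding S_def by (rule rev_image_eqI) simp
  have Sa: "u + v \<in> S" and Sm: "u * v \<in> S" if "u \<in> S" "v \<in> S" for u v
    using that Ea Em unfolding S_def by (auto simp flip: poly_add poly_mult)
  have S2: "f ^ 2 \<in> S"
    using E2 unfolding S_def by (rule rev_image_eqI) (simp add: poly_monom)
  have Sf: "u = 0" if "u \<in> S" "v \<in> S" "u * f = v" for u v
  proof -
    obtain P Q where P: "P \<in> E" "u = poly P f" and Q: "Q \<in> E" "v = poly Q f"
      using \<open>u \<in> S\<close> \<open>v \<in> S\<close> unfolding S_def by blast
    have "poly (pCons 0 P + Q) f = u * f + v" using P Q by (simp add: mult.commute)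
    also have "\<dots> = 0" using that(3) by (simp add: bit_fps_add_self)
    finally have z: "poly (pCons 0 P + Q) f = 0" .
    have "pCons 0 P + Q \<in> poly_like"
      using P(1) Q(1) D0 Da unfolding poly_like_def D_def[symmetric]
      by (auto simp: E_def coeff_pCons split: nat.splits)
    then have e: "pCons 0 P + Q = 0" using f z by blast
    have "coeff P i = 0" for i
    proof (cases "odd i")
      case True then show ?thesis using P(1) by (simp add: E_def)
    next
      case False
      have "coeff (pCons 0 P + Q) (Suc i) = 0" using e by simp
      then show ?thesis using Q(1) False by (simp add: E_def)
    qed
    then have "P = 0" by (simp add: poly_eq_iff)
    then show ?thesis using P(2) by simp
  qed
  define R where "R = {u. \<exists>a\<in>S. \<exists>b\<in>S. b \<noteq> 0 \<and> u * b = a}"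
  have SR: "u \<in> R" if "u \<in> S" for u
    unfolding R_def using that SD[OF D1] by (intro CollectI bexI[of _ u] bexI[of _ 1]) auto
  have "nonsplit_dvr R f"
  proof
    show "0 \<in> R" "1 \<in> R" "fps_X \<in> R" "f ^ 2 \<in> R" "\<And>n. fps_cutoff n f \<in> R"
      using SR SD S2 D0 D1 DX Dc by auto
    fix u
    { assume "fps_X * u \<in> R"
      then obtain a b where ab: "a \<in> S" "b \<in> S" "b \<noteq> 0" "fps_X * u * b = a" unfolding R_def by blast
      have "u * (fps_X * b) = a" using ab(4) by (simp add: mult_ac)
      moreover have "fps_X * b \<in> S" "fps_X * b \<noteq> 0" using ab SD[OF DX] Sm by auto
      ultimately show "u \<in> R" using ab(1) unfolding R_def by blast }
    assume "u \<in> R"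
    then obtain a b where ab: "a \<in> S" "b \<in> S" "b \<noteq> 0" "u * b = a" unfolding R_def by blast
    { assume u0: "u $ 0 \<noteq> 0"
      then have "u \<noteq> 0" by auto
      then have "a \<noteq> 0" using ab(3,4) by auto
      moreover have "inverse u * a = (inverse u * u) * b" using ab(4) by (simp add: mult_ac)
      then have "inverse u * a = b" using inverse_mult_eq_1[OF u0] by simp
      ultimately show "inverse u \<in> R" using ab(1,2) unfolding R_def by blast }
    fix v assume "v \<in> R"
    then obtain c d where cd: "c \<in> S" "d \<in> S" "d \<noteq> 0" "v * d = c" unfolding R_def by blast
    have bd: "b * d \<in> S" "b * d \<noteq> 0" using ab(2,3) cd(2,3) Sm by auto
    have "(u + v) * (b * d) = a * d + c * b" using ab(4) cd(4) by (auto simp: algebra_simps)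
    moreover have "a * d + c * b \<in> S" using ab cd Sa Sm by blast
    ultimately show "u + v \<in> R" using bd unfolding R_def by blast
    have "(u * v) * (b * d) = a * c" using ab(4) cd(4) by (auto simp: algebra_simps)
    then show "u * v \<in> R" using bd ab(1) cd(1) Sm unfolding R_def by blast
    assume "u * f = v"
    then have "(a * d) * f = c * b" using ab(4) cd(4) by (auto simp: algebra_simps)
    then have "a * d = 0" using Sf[of "a * d" "c * b"] Sm ab(1,2) cd(1,2) by blast
    then show "u = 0" using cd(3) ab(3,4) by auto
  qed
  then show ?thesis by blast
qed

section \<open>A complete domain of characteristic two\<close>

text \<open>The outer variable is \<open>t\<close>, the variable of the coefficients is \<open>s\<close>; both are written \<open>fps_X\<close>.\<close>

type_synonym biseries = "bit fps fps"

lemma biseries_add_self: "x + x = (0 :: biseries)"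
  by (rule fps_ext) (simp only: fps_add_nth fps_zero_nth bit_fps_add_self)

lemma biseries_uminus: "- x = (x :: biseries)"
  by (rule fps_ext) (simp only: fps_neg_nth bit_fps_uminus)

lemma biseries_diff: "x - y = x + (y :: biseries)"
  by (rule fps_ext) (simp only: fps_add_nth fps_sub_nth bit_fps_diff)

lemma biseries_square_add: "(x + y) ^ 2 = x ^ 2 + (y :: biseries) ^ 2"
proof -
  have "(x + y) ^ 2 = x ^ 2 + y ^ 2 + (x * y + x * y)"
    by (simp add: power2_eq_square algebra_simps)
  then show ?thesis by (simp add: biseries_add_self)
qed

lemma fps_shift_split:
  "fps_shift n (w :: 'a::comm_ring_1 fps) = fps_const (w $ n) + fps_X * fps_shift (Suc n) w"
proof (rule fps_ext)
  show "fps_shift n w $ k = (fps_const (w $ n) + fps_X * fps_shift (Suc n) w) $ k" for k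
    by (cases k) simp_all
qed

context nonsplit_dvr
begin

lemma R_power: "u \<in> R \<Longrightarrow> u ^ n \<in> R"
  by (induction n) (auto simp: R_1 R_mult)

lemma R_Xpow: "fps_X ^ n \<in> R"
  by (rule R_power[OF R_X])

lemma R_sum: "(\<And>i. i \<in> K \<Longrightarrow> g i \<in> R) \<Longrightarrow> sum g K \<in> R"
  by (induction K rule: infinite_finite_induct) (auto simp: R_0 R_add)

lemma R_divide_Xpow: "fps_X ^ n * u \<in> R \<Longrightarrow> u \<in> R"
proof (induction n)
  case (Suc n)
  then have "fps_X * (fps_X ^ n * u) \<in> R" by (simp add: mult_ac)
  then show ?case using R_divide_X Suc.IH by blast
qed simp

abbreviation tail :: "nat \<Rightarrow> bit fps" where "tail n \<equiv> fps_shift n f"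

lemma Xpow_tail: "fps_X ^ n * tail n = fps_cutoff n f + f"
proof -
  have "fps_X ^ n * tail n = (fps_X ^ n * tail n + fps_cutoff n f) + fps_cutoff n f"
    by (simp add: add.assoc bit_fps_add_self)
  then show ?thesis by (simp only: fps_shift_cutoff') (simp add: add.commute)
qed

text \<open>\<open>tail n\<close> has the denominator \<open>s\<^sup>n\<close> over \<open>R[f]\<close>, but its square lies in the valuation ring \<open>R\<close>,
  because \<open>R\<close> is closed under exact division by \<open>s\<close>.\<close>

lemma tail_square: "tail n ^ 2 \<in> R"
proof (rule R_divide_Xpow)
  have "fps_X ^ (2 * n) * tail n ^ 2 = (fps_X ^ n * tail n) ^ 2"
    by (simp add: power_mult_distrib power_mult[symmetric] mult.commute)
  also have "\<dots> = fps_cutoff n f ^ 2 + f ^ 2" by (simp add: Xpow_tail bit_fps_square_add)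
  finally show "fps_X ^ (2 * n) * tail n ^ 2 \<in> R"
    using R_add[OF R_power[OF R_cutoff] f_square] by simp
qed

text \<open>This is \<open>R[[t]]\<close>.\<close>

definition RT :: "biseries set" where "RT = {w. \<forall>n. w $ n \<in> R}"

lemma RT_nth: "w \<in> RT \<Longrightarrow> w $ n \<in> R"
  by (simp add: RT_def)

lemma RT_0: "0 \<in> RT" and RT_1: "1 \<in> RT" and RT_X: "fps_X \<in> RT"
  by (auto simp: RT_def R_0 R_1 fps_X_def)

lemma RT_add: "\<lbrakk>x \<in> RT; y \<in> RT\<rbrakk> \<Longrightarrow> x + y \<in> RT"
  by (simp add: RT_def R_add)

lemma RT_mult: "\<lbrakk>x \<in> RT; y \<in> RT\<rbrakk> \<Longrightarrow> x * y \<in> RT"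
  by (auto simp: RT_def fps_mult_nth intro!: R_sum R_mult)

lemma RT_const: "u \<in> R \<Longrightarrow> fps_const u \<in> RT"
  by (simp add: RT_def R_0)

lemma RT_power: "x \<in> RT \<Longrightarrow> x ^ n \<in> RT"
  by (induction n) (auto simp: RT_1 RT_mult)

text \<open>In characteristic two squaring is additive, so only the squares of the coefficients matter.\<close>

lemma RT_square:
  assumes "\<And>i. (w $ i) ^ 2 \<in> R"
  shows "w ^ 2 \<in> RT"
proof -
  have "\<exists>b\<in>RT. w ^ 2 = b + fps_X ^ (2 * n) * fps_shift n w ^ 2" for n
  proof (induction n)
    case 0
    then show ?case using RT_0 by auto
  next
    case (Suc n)
    then obtain b where b: "b \<in> RT" "w ^ 2 = b + fps_X ^ (2 * n) * fps_shift n w ^ 2" by blast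
    have "fps_shift n w ^ 2 = (fps_const (w $ n) + fps_X * fps_shift (Suc n) w) ^ 2"
      by (subst fps_shift_split) (rule refl)
    also have "\<dots> = fps_const (w $ n) ^ 2 + fps_X ^ 2 * fps_shift (Suc n) w ^ 2"
      by (simp add: biseries_square_add power_mult_distrib)
    finally have "w ^ 2 = (b + fps_X ^ (2 * n) * fps_const ((w $ n) ^ 2))
        + fps_X ^ (2 * Suc n) * fps_shift (Suc n) w ^ 2"
      using b(2) by (simp add: algebra_simps power_add power2_eq_square)
    moreover have "b + fps_X ^ (2 * n) * fps_const ((w $ n) ^ 2) \<in> RT"
      by (intro RT_add RT_mult RT_power RT_X RT_const b assms)
    ultimately show ?case by blast
  qed
  then have "(w ^ 2) $ k \<in> R" for k
  proof -
    obtain b where b: "b \<in> RT" "w ^ 2 = b + fps_X ^ (2 * Suc k) * fps_shift (Suc k) w ^ 2"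
      using \<open>\<And>n. \<exists>b\<in>RT. w ^ 2 = b + fps_X ^ (2 * n) * fps_shift n w ^ 2\<close> by blast
    have "(w ^ 2) $ k = b $ k" unfolding b(2) by (simp add: fps_X_power_mult_nth del: power_Suc)
    then show ?thesis using RT_nth[OF b(1)] by simp
  qed
  then show ?thesis by (simp add: RT_def)
qed

lemma RT_inverse:
  assumes "w \<in> RT" "w $ 0 $ 0 \<noteq> 0"
  shows "\<exists>v\<in>RT. w * v = 1"
proof
  let ?y = "inverse (w $ 0)" and ?c = "fps_right_inverse_constructor w (inverse (w $ 0))"
  have y: "?y \<in> R" using assms by (intro R_inverse RT_nth)
  have "w $ 0 * ?y = 1" using inverse_mult_eq_1[OF assms(2)] by (simp add: mult.commute)
  then show "w * fps_right_inverse w ?y = 1" by (rule fps_right_inverse)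
  have "?c n \<in> R" for n
  proof (induction n rule: less_induct)
    case (less n)
    show ?case
    proof (cases n)
      case 0
      then show ?thesis using y by simp
    next
      case (Suc k)
      have "(\<Sum>i=1..n. w $ i * ?c (n - i)) \<in> R"
        using less assms(1) by (intro R_sum R_mult RT_nth) auto
      then show ?thesis using Suc y by (simp add: bit_fps_uminus R_mult)
    qed
  qed
  then show "fps_right_inverse w ?y \<in> RT" by (simp add: RT_def)
qed

text \<open>The indices must grow faster than linearly: the series with coefficients \<open>tail n\<close> is the difference
  quotient of the power series \<open>s f(s)\<close> at \<open>s\<close> and \<open>t\<close>, hence a fraction of elements of \<open>R[[t]][f]\<close>.\<close>

definition \<beta> :: biseries where "\<beta> = Abs_fps (\<lambda>n. tail (n ^ 2))"

abbreviation F :: biseries where "F \<equiv> fps_const f"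

definition A :: "biseries set" where
  "A = {x0 + x1 * F + x2 * \<beta> + x3 * (F * \<beta>) | x0 x1 x2 x3.
     x0 \<in> RT \<and> x1 \<in> RT \<and> x2 \<in> RT \<and> x3 \<in> RT}"

lemma F_square: "F * F \<in> RT"
  using RT_const[OF f_square] by (simp add: power2_eq_square)

lemma beta_square: "\<beta> * \<beta> \<in> RT"
  using RT_square[of \<beta>] tail_square by (simp add: \<beta>_def power2_eq_square)

lemma A_I:
  "\<lbrakk>x0 \<in> RT; x1 \<in> RT; x2 \<in> RT; x3 \<in> RT\<rbrakk> \<Longrightarrow> x0 + x1 * F + x2 * \<beta> + x3 * (F * \<beta>) \<in> A"
  unfolding A_def by blast

lemma A_E:
  assumes "x \<in> A"
  obtains x0 x1 x2 x3 where "x0 \<in> RT" "x1 \<in> RT" "x2 \<in> RT" "x3 \<in> RT"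
    "x = x0 + x1 * F + x2 * \<beta> + x3 * (F * \<beta>)"
  using assms unfolding A_def by blast

lemma RT_A: "x \<in> RT \<Longrightarrow> x \<in> A"
  using A_I[of x 0 0 0] RT_0 by simp

lemma F_A: "F \<in> A" and beta_A: "\<beta> \<in> A"
  using A_I[of 0 1 0 0] A_I[of 0 0 1 0] RT_0 RT_1 by simp_all

lemma A_add: assumes "x \<in> A" "y \<in> A" shows "x + y \<in> A"
proof -
  obtain x0 x1 x2 x3 where x: "x0 \<in> RT" "x1 \<in> RT" "x2 \<in> RT" "x3 \<in> RT"
    "x = x0 + x1 * F + x2 * \<beta> + x3 * (F * \<beta>)" using A_E[OF assms(1)] .
  obtain y0 y1 y2 y3 where y: "y0 \<in> RT" "y1 \<in> RT" "y2 \<in> RT" "y3 \<in> RT"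
    "y = y0 + y1 * F + y2 * \<beta> + y3 * (F * \<beta>)" using A_E[OF assms(2)] .
  have "x + y = (x0 + y0) + (x1 + y1) * F + (x2 + y2) * \<beta> + (x3 + y3) * (F * \<beta>)"
    unfolding x(5) y(5) by (simp only: algebra_simps)
  then show ?thesis using A_I x y RT_add by metis
qed

lemma A_mult: assumes "x \<in> A" "y \<in> A" shows "x * y \<in> A"
proof -
  obtain x0 x1 x2 x3 where x: "x0 \<in> RT" "x1 \<in> RT" "x2 \<in> RT" "x3 \<in> RT"
    "x = x0 + x1 * F + x2 * \<beta> + x3 * (F * \<beta>)" using A_E[OF assms(1)] .
  obtain y0 y1 y2 y3 where y: "y0 \<in> RT" "y1 \<in> RT" "y2 \<in> RT" "y3 \<in> RT"
    "y = y0 + y1 * F + y2 * \<beta> + y3 * (F * \<beta>)" using A_E[OF assms(2)] .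
  have "(x0 + x1 * h + x2 * b + x3 * (h * b)) * (y0 + y1 * h + y2 * b + y3 * (h * b))
     = (x0 * y0 + (h * h) * x1 * y1 + (b * b) * x2 * y2 + (h * h) * (b * b) * x3 * y3)
       + (x0 * y1 + x1 * y0 + (b * b) * x2 * y3 + (b * b) * x3 * y2) * h
       + (x0 * y2 + x2 * y0 + (h * h) * x1 * y3 + (h * h) * x3 * y1) * b
       + (x0 * y3 + x3 * y0 + x1 * y2 + x2 * y1) * (h * b)" for h b :: biseries
    by (simp only: algebra_simps)
  from this[of F \<beta>] show ?thesis
    unfolding x(5) y(5)
    by (elim ssubst) (intro A_I RT_add RT_mult F_square beta_square x y)
qed

lemma A_0: "0 \<in> A" and A_1: "1 \<in> A" and A_X: "fps_X \<in> A"
  by (intro RT_A RT_0 RT_1 RT_X)+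

lemma A_uminus: "x \<in> A \<Longrightarrow> - x \<in> A"
  by (simp add: biseries_uminus)

text \<open>The squares of the generators \<open>f\<close> and \<open>\<beta>\<close> lie in \<open>R[[t]]\<close> and squaring is additive.  The square
  thus serves as a norm from \<open>A\<close> to \<open>R[[t]]\<close>.\<close>

lemma A_square: assumes "x \<in> A" shows "x * x \<in> RT"
proof -
  obtain x0 x1 x2 x3 where x: "x0 \<in> RT" "x1 \<in> RT" "x2 \<in> RT" "x3 \<in> RT"
    "x = x0 + x1 * F + x2 * \<beta> + x3 * (F * \<beta>)" using A_E[OF assms] .
  have "x ^ 2 = x0 ^ 2 + x1 ^ 2 * (F * F) + x2 ^ 2 * (\<beta> * \<beta>) + x3 ^ 2 * ((F * F) * (\<beta> * \<beta>))"
    unfolding x(5) by (simp only: biseries_square_add power_mult_distrib) (simp only: power2_eq_square)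
  moreover have "x0 ^ 2 + x1 ^ 2 * g + x2 ^ 2 * h + x3 ^ 2 * (g * h) \<in> RT" if "g \<in> RT" "h \<in> RT" for g h
    by (intro RT_add RT_mult RT_power x that)
  ultimately have "x ^ 2 \<in> RT" using F_square beta_square by (simp only:)
  then show ?thesis by (simp only: power2_eq_square)
qed

lemma A_inverse:
  assumes "x \<in> A" "x $ 0 $ 0 \<noteq> 0"
  shows "\<exists>y\<in>A. x * y = 1"
proof -
  have "(x * x) $ 0 $ 0 \<noteq> 0" using assms(2) by simp
  then obtain v where v: "v \<in> RT" "x * x * v = 1" using RT_inverse[OF A_square[OF assms(1)]] by blast
  then show ?thesis using A_mult[OF assms(1) RT_A[OF v(1)]] by (auto simp: mult.assoc)
qed

subsection \<open>Completeness\<close>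

text \<open>The elements \<open>s N\<close> are the remainders of the series, divided by the power of \<open>t\<close> that they
  contain; membership of the remainders is what adic convergence in \<open>A\<close> requires.\<close>

lemma RT_series:
  assumes "\<And>n. b n \<in> RT"
  shows "\<exists>s. (\<forall>N. s N \<in> RT) \<and> (\<forall>N. s 0 = (\<Sum>n<N. fps_X ^ n * b n) + fps_X ^ N * s N)"
proof -
  define s where "s N = Abs_fps (\<lambda>k. \<Sum>i\<le>k. b (N + i) $ (k - i))" for N
  have step: "s N = b N + fps_X * s (Suc N)" for N
  proof (rule fps_ext)
    fix k
    show "s N $ k = (b N + fps_X * s (Suc N)) $ k"
    proof (cases k)
      case 0
      then show ?thesis by (simp add: s_def)
    next
      case (Suc l)
      have "(\<Sum>i\<le>Suc l. b (N + i) $ (Suc l - i)) = b N $ Suc l + (\<Sum>i\<le>l. b (Suc N + i) $ (l - i))"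
        by (subst sum.atMost_Suc_shift) simp
      then show ?thesis using Suc by (simp add: s_def)
    qed
  qed
  have "s 0 = (\<Sum>n<N. fps_X ^ n * b n) + fps_X ^ N * s N" for N
  proof (induction N)
    case (Suc N)
    then show ?case by (subst (asm) (2) step) (simp add: algebra_simps)
  qed simp
  moreover have "s N \<in> RT" for N
    using assms by (auto simp: RT_def s_def intro!: R_sum)
  ultimately show ?thesis by blast
qed

lemma A_series:
  assumes "\<And>n. d n \<in> A"
  shows "\<exists>s. (\<forall>N. s N \<in> A) \<and> (\<forall>N. s 0 = (\<Sum>n<N. fps_X ^ n * d n) + fps_X ^ N * s N)"
proof -
  have "\<forall>n. \<exists>x0 x1 x2 x3. d n = x0 + x1 * F + x2 * \<beta> + x3 * (F * \<beta>) \<and>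
    x0 \<in> RT \<and> x1 \<in> RT \<and> x2 \<in> RT \<and> x3 \<in> RT"
    using assms unfolding A_def by simp
  then obtain x0 x1 x2 x3 where x: "\<And>n. x0 n \<in> RT" "\<And>n. x1 n \<in> RT" "\<And>n. x2 n \<in> RT" "\<And>n. x3 n \<in> RT"
    "\<And>n. d n = x0 n + x1 n * F + x2 n * \<beta> + x3 n * (F * \<beta>)" by metis
  obtain s0 where s0: "\<And>N. s0 N \<in> RT" "\<And>N. s0 0 = (\<Sum>n<N. fps_X ^ n * x0 n) + fps_X ^ N * s0 N"
    using RT_series[of x0] x(1) by metis
  obtain s1 where s1: "\<And>N. s1 N \<in> RT" "\<And>N. s1 0 = (\<Sum>n<N. fps_X ^ n * x1 n) + fps_X ^ N * s1 N"
    using RT_series[of x1] x(2) by metis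
  obtain s2 where s2: "\<And>N. s2 N \<in> RT" "\<And>N. s2 0 = (\<Sum>n<N. fps_X ^ n * x2 n) + fps_X ^ N * s2 N"
    using RT_series[of x2] x(3) by metis
  obtain s3 where s3: "\<And>N. s3 N \<in> RT" "\<And>N. s3 0 = (\<Sum>n<N. fps_X ^ n * x3 n) + fps_X ^ N * s3 N"
    using RT_series[of x3] x(4) by metis
  let ?s = "\<lambda>N. s0 N + s1 N * F + s2 N * \<beta> + s3 N * (F * \<beta>)"
  have "?s 0 = (\<Sum>n<N. fps_X ^ n * d n) + fps_X ^ N * ?s N" for N
  proof -
    have "(\<Sum>n<N. fps_X ^ n * d n) = (\<Sum>n<N. fps_X ^ n * x0 n) + (\<Sum>n<N. fps_X ^ n * x1 n) * F
        + (\<Sum>n<N. fps_X ^ n * x2 n) * \<beta> + (\<Sum>n<N. fps_X ^ n * x3 n) * (F * \<beta>)"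
      by (simp only: x(5) sum_distrib_right sum.distrib distrib_left mult.assoc)
    then show ?thesis
      by (simp only: s0(2)[of N] s1(2)[of N] s2(2)[of N] s3(2)[of N]) (simp only: algebra_simps)
  qed
  moreover have "?s N \<in> A" for N by (intro A_I s0 s1 s2 s3)
  ultimately show ?thesis by (intro exI[of _ ?s]) blast
qed

subsection \<open>The denominators of the square root are unbounded\<close>

text \<open>Multiply the coefficient at \<open>t\<^sup>n\<close> by the power of \<open>s\<close> with exponent \<open>n\<^sup>2\<close> and compare the multiples of
  \<open>f\<close>.  The summand with the largest denominator contributes the constant coefficient of \<open>z\<close>; all the
  others carry at least \<open>n\<^sup>2 - (n - 1)\<^sup>2\<close> factors \<open>s\<close>.  Hence the constant coefficient of \<open>z\<close> is divisible
  by arbitrarily high powers of \<open>s\<close>.\<close>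

lemma beta_not_fraction:
  assumes z: "z \<in> RT" "z $ 0 \<noteq> 0" and c: "c \<in> RT" and d: "d \<in> RT" and eq: "z * \<beta> = c + d * F"
  shows False
proof -
  have "z $ 0 $ k = 0" for k
  proof -
    define n where "n = Suc k"
    have e: "n\<^sup>2 = (n\<^sup>2 - (n - i)\<^sup>2) + (n - i)\<^sup>2" if "i \<le> n" for i
      using power_mono[of "n - i" n 2] by simp
    define h where "h i = z $ i * fps_X ^ (n\<^sup>2 - (n - i)\<^sup>2)" for i
    have hR: "h i \<in> R" for i unfolding h_def by (intro R_mult RT_nth[OF z(1)] R_Xpow)
    have "fps_X ^ n\<^sup>2 * (z * \<beta>) $ n = (\<Sum>i=0..n. h i * (fps_cutoff ((n - i)\<^sup>2) f + f))"
      unfolding fps_mult_nth sum_distrib_left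
    proof (rule sum.cong[OF refl])
      fix i assume "i \<in> {0..n}"
      then have "fps_X ^ n\<^sup>2 = (fps_X ^ (n\<^sup>2 - (n - i)\<^sup>2) * fps_X ^ (n - i)\<^sup>2 :: bit fps)"
        using e[of i] by (metis atLeastAtMost_iff power_add)
      then have "fps_X ^ n\<^sup>2 * (z $ i * \<beta> $ (n - i)) = h i * (fps_X ^ (n - i)\<^sup>2 * tail ((n - i)\<^sup>2))"
        by (simp add: h_def \<beta>_def mult_ac)
      then show "fps_X ^ n\<^sup>2 * (z $ i * \<beta> $ (n - i)) = h i * (fps_cutoff ((n - i)\<^sup>2) f + f)"
        by (simp only: Xpow_tail)
    qed
    also have "\<dots> = (\<Sum>i=0..n. h i * fps_cutoff ((n - i)\<^sup>2) f) + (\<Sum>i=0..n. h i) * f"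
      by (simp add: distrib_left sum.distrib sum_distrib_right)
    finally have 1: "(\<Sum>i=0..n. h i * fps_cutoff ((n - i)\<^sup>2) f) + (\<Sum>i=0..n. h i) * f
       = fps_X ^ n\<^sup>2 * c $ n + fps_X ^ n\<^sup>2 * d $ n * f"
      unfolding eq by (simp add: algebra_simps)
    let ?u = "(\<Sum>i=0..n. h i) + fps_X ^ n\<^sup>2 * d $ n"
    let ?v = "(\<Sum>i=0..n. h i * fps_cutoff ((n - i)\<^sup>2) f) + fps_X ^ n\<^sup>2 * c $ n"
    have "?u * f = ((\<Sum>i=0..n. h i * fps_cutoff ((n - i)\<^sup>2) f) + (\<Sum>i=0..n. h i) * f)
        + (\<Sum>i=0..n. h i * fps_cutoff ((n - i)\<^sup>2) f) + fps_X ^ n\<^sup>2 * d $ n * f"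
      by (simp add: algebra_simps bit_fps_add_self)
    also have "\<dots> = ?v + (fps_X ^ n\<^sup>2 * d $ n * f + fps_X ^ n\<^sup>2 * d $ n * f)"
      unfolding 1 by (simp only: add_ac)
    finally have "?u * f = ?v" by (simp add: bit_fps_add_self)
    moreover have "?u \<in> R" "?v \<in> R"
      by (intro R_add R_sum R_mult hR R_Xpow RT_nth[OF c] RT_nth[OF d] R_cutoff)+
    ultimately have u0: "?u = 0" using f_not_fraction by blast
    have "k < n\<^sup>2 - (n - i)\<^sup>2" if "i \<in> {1..n}" for i
    proof -
      have "(n - i)\<^sup>2 \<le> k\<^sup>2" using that by (intro power_mono) (auto simp: n_def)
      moreover have "n\<^sup>2 = k\<^sup>2 + 2 * k + 1" by (simp add: n_def power2_eq_square)
      ultimately show ?thesis by linarith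
    qed
    then have h1: "h i $ k = 0" if "i \<in> {1..n}" for i
      using that unfolding h_def fps_X_power_mult_right_nth by simp
    have "k < n\<^sup>2" by (simp add: n_def power2_eq_square)
    then have "(fps_X ^ n\<^sup>2 * d $ n) $ k = 0" by (simp add: fps_X_power_mult_nth)
    then have "0 = (\<Sum>i=0..n. h i) $ k" using arg_cong[OF u0, of "\<lambda>u. u $ k"] by simp
    also have "\<dots> = h 0 $ k + (\<Sum>i=1..n. h i $ k)"
      by (simp add: fps_sum_nth sum.atLeast_Suc_atMost)
    also have "\<dots> = z $ 0 $ k" using h1 by (simp add: h_def)
    finally show ?thesis by simp
  qed
  then show False using z(2) by (simp add: fps_eq_iff)
qed

text \<open>Multiplying by \<open>u\<close> makes the factor \<open>u\<close> an element \<open>w\<close> of \<open>R[[t]]\<close>.  Collecting the multiples of \<open>\<beta>\<close>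
  gives a relation \<open>z \<beta> = c + d f\<close> with \<open>z\<close> in \<open>R[[t]][f]\<close>, and multiplying by \<open>z\<close> once more moves the
  factor of \<open>\<beta>\<close> into \<open>R[[t]]\<close>.\<close>

lemma beta_not_divisible:
  assumes u: "u \<in> A" "u $ 0 \<noteq> 0" and y: "y \<in> A"
  shows "u * (\<beta> + F) \<noteq> fps_X * y"
proof
  assume eq: "u * (\<beta> + F) = fps_X * y"
  define w where "w = u * u"
  have w: "w \<in> RT" "w $ 0 \<noteq> 0" using A_square[OF u(1)] u(2) by (auto simp: w_def)
  obtain y0 y1 y2 y3 where y: "y0 \<in> RT" "y1 \<in> RT" "y2 \<in> RT" "y3 \<in> RT"
    "u * y = y0 + y1 * F + y2 * \<beta> + y3 * (F * \<beta>)" using A_E[OF A_mult[OF u(1) y]] .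
  have "w * (\<beta> + F) = fps_X * (u * y)" using eq by (simp add: w_def mult_ac)
  then have 1: "w * \<beta> + w * F = fps_X * y0 + fps_X * y1 * F + fps_X * y2 * \<beta> + fps_X * y3 * (F * \<beta>)"
    unfolding y(5) by (simp only: algebra_simps)
  define z where "z = (w + fps_X * y2) + fps_X * y3 * F"
  have "z * \<beta> = (w * \<beta> + w * F) + w * F + fps_X * y2 * \<beta> + fps_X * y3 * (F * \<beta>)"
    by (simp add: z_def algebra_simps biseries_add_self)
  also have "\<dots> = fps_X * y0 + (fps_X * y1 + w) * F + (fps_X * y2 * \<beta> + fps_X * y2 * \<beta>)
      + (fps_X * y3 * (F * \<beta>) + fps_X * y3 * (F * \<beta>))"
    unfolding 1 by (simp only: algebra_simps)
  finally have zb: "z * \<beta> = fps_X * y0 + (fps_X * y1 + w) * F" by (simp add: biseries_add_self)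
  have "(z * z) * \<beta> = z * (z * \<beta>)" by (simp add: mult_ac)
  also have "\<dots> = ((w + fps_X * y2) * (fps_X * y0) + fps_X * y3 * (fps_X * y1 + w) * (F * F))
    + ((w + fps_X * y2) * (fps_X * y1 + w) + fps_X * y3 * (fps_X * y0)) * F"
    by (simp only: zb) (simp only: z_def algebra_simps)
  finally have zz: "(z * z) * \<beta> = \<dots>" .
  have cRT: "(w + fps_X * y2) * (fps_X * y0) + fps_X * y3 * (fps_X * y1 + w) * g \<in> RT" if "g \<in> RT" for g
    by (intro RT_add RT_mult RT_X w y that)
  have dRT: "(w + fps_X * y2) * (fps_X * y1 + w) + fps_X * y3 * (fps_X * y0) \<in> RT"
    by (intro RT_add RT_mult RT_X w y)
  have "z \<in> A"
    unfolding z_def by (intro A_add A_mult RT_A w y RT_X F_A)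
  then have "z * z \<in> RT" by (rule A_square)
  moreover have "(z * z) $ 0 \<noteq> 0" using w(2) by (simp add: z_def)
  ultimately show False
    using beta_not_fraction[OF _ _ cRT[OF F_square] dRT zz] by blast
qed

end

context nonsplit_dvr
begin

subsection \<open>The approximate square roots\<close>

text \<open>In characteristic two the sum with the truncation is the difference.  The truncation, whose
  coefficients have denominators up to the power of \<open>s\<close> with exponent \<open>n\<^sup>2\<close>, becomes an element of \<open>A\<close>
  after multiplication by that power.\<close>

definition approx :: "nat \<Rightarrow> biseries" where
  "approx n = fps_const (fps_X ^ n\<^sup>2) * (\<beta> + fps_cutoff (Suc n) \<beta>)"

lemma scaled_tail:
  assumes "i \<le> n"
  shows "fps_X ^ n\<^sup>2 * tail (i\<^sup>2) = fps_X ^ (n\<^sup>2 - i\<^sup>2) * fps_cutoff (i\<^sup>2) f + fps_X ^ (n\<^sup>2 - i\<^sup>2) * f"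
proof -
  have "i\<^sup>2 \<le> n\<^sup>2" using assms by (rule power_mono) simp
  then have "fps_X ^ n\<^sup>2 * tail (i\<^sup>2) = fps_X ^ (n\<^sup>2 - i\<^sup>2) * (fps_X ^ i\<^sup>2 * tail (i\<^sup>2))"
    by (simp add: mult.assoc[symmetric] power_add[symmetric])
  then show ?thesis by (simp only: Xpow_tail distrib_left)
qed

lemma approx_0: "approx 0 = \<beta> + F"
proof -
  have "fps_cutoff (Suc 0) \<beta> = F" by (rule fps_ext) (simp add: \<beta>_def)
  then show ?thesis by (simp add: approx_def)
qed

lemma approx_A: "approx n \<in> A"
proof -
  let ?c = "Abs_fps (\<lambda>i. if i \<le> n then fps_X ^ (n\<^sup>2 - i\<^sup>2) * fps_cutoff (i\<^sup>2) f else 0)"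
  let ?d = "Abs_fps (\<lambda>i. if i \<le> n then fps_X ^ (n\<^sup>2 - i\<^sup>2) else 0) :: biseries"
  have eq: "fps_const (fps_X ^ n\<^sup>2) * fps_cutoff (Suc n) \<beta> = ?c + ?d * F"
    by (rule fps_ext) (simp add: \<beta>_def scaled_tail less_Suc_eq_le)
  have c: "?c \<in> RT" and d: "?d \<in> RT"
    using R_mult[OF R_Xpow R_cutoff] R_Xpow R_0 by (simp_all add: RT_def)
  show ?thesis
    unfolding approx_def distrib_left eq
    by (rule A_add[OF A_mult[OF RT_A[OF RT_const[OF R_Xpow]] beta_A]
          A_add[OF RT_A[OF c] A_mult[OF RT_A[OF d] F_A]]])
qed

lemma beta_cutoff: "\<beta> + fps_cutoff n \<beta> = fps_X ^ n * fps_shift n \<beta>"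
proof -
  have "fps_X ^ n * fps_shift n \<beta> = (fps_X ^ n * fps_shift n \<beta> + fps_cutoff n \<beta>) + fps_cutoff n \<beta>"
    by (simp only: add.assoc biseries_add_self) simp
  then show ?thesis by (simp only: fps_shift_cutoff')
qed

lemma approx_square: "\<exists>y\<in>A. approx n * approx n = fps_X ^ Suc n * y"
proof
  let ?y = "fps_X ^ Suc n * (fps_const (fps_X ^ n\<^sup>2) ^ 2 * fps_shift (Suc n) \<beta> ^ 2)"
  show "approx n * approx n = fps_X ^ Suc n * ?y"
    unfolding approx_def beta_cutoff by (simp only: power2_eq_square mult_ac)
  have sq: "fps_shift (Suc n) \<beta> ^ 2 \<in> RT"
    using tail_square by (intro RT_square) (simp add: \<beta>_def)
  show "?y \<in> A"
    by (rule RT_A[OF RT_mult[OF RT_power[OF RT_X] RT_mult[OF RT_power[OF RT_const[OF R_Xpow]] sq]]])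
qed

lemma approx_compat:
  "\<exists>y\<in>A. approx (Suc n) * fps_const (fps_X ^ n\<^sup>2) - approx n * fps_const (fps_X ^ (Suc n)\<^sup>2) = fps_X ^ Suc n * y"
proof
  let ?X = "\<lambda>n. fps_const (fps_X ^ n\<^sup>2) :: biseries"
  let ?y = "?X n * (fps_const (fps_cutoff ((Suc n)\<^sup>2) f) + F)"
  have "fps_shift (Suc n) \<beta> = fps_const (tail ((Suc n)\<^sup>2)) + fps_X * fps_shift (Suc (Suc n)) \<beta>"
    by (subst fps_shift_split) (simp add: \<beta>_def)
  then have 1: "\<beta> + fps_cutoff (Suc n) \<beta> = fps_X ^ Suc n * fps_const (tail ((Suc n)\<^sup>2)) + (\<beta> + fps_cutoff (Suc (Suc n)) \<beta>)"
    unfolding beta_cutoff by (simp only: distrib_left) (simp add: mult_ac)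
  have 2: "?X (Suc n) * fps_const (tail ((Suc n)\<^sup>2)) = fps_const (fps_cutoff ((Suc n)\<^sup>2) f) + F"
    by (simp add: Xpow_tail del: power_Suc)
  have "approx (Suc n) * ?X n - approx n * ?X (Suc n)
      = ?X (Suc n) * ?X n * ((\<beta> + fps_cutoff (Suc (Suc n)) \<beta>) - (\<beta> + fps_cutoff (Suc n) \<beta>))"
    unfolding approx_def by (simp only: right_diff_distrib mult_ac)
  also have "(\<beta> + fps_cutoff (Suc (Suc n)) \<beta>) - (\<beta> + fps_cutoff (Suc n) \<beta>)
      = fps_X ^ Suc n * fps_const (tail ((Suc n)\<^sup>2))"
    unfolding 1 by (simp only: diff_add_eq_diff_diff_swap diff_self) (simp add: biseries_uminus)
  also have "?X (Suc n) * ?X n * (fps_X ^ Suc n * fps_const (tail ((Suc n)\<^sup>2)))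
      = fps_X ^ Suc n * (?X n * (?X (Suc n) * fps_const (tail ((Suc n)\<^sup>2))))"
    by (simp only: mult_ac)
  finally show "approx (Suc n) * ?X n - approx n * ?X (Suc n) = fps_X ^ Suc n * ?y"
    by (simp only: 2)
  show "?y \<in> A"
    by (rule A_mult[OF RT_A[OF RT_const[OF R_Xpow]] A_add[OF RT_A[OF RT_const[OF R_cutoff]] F_A]])
qed

subsection \<open>Primes containing the parameter\<close>

lemma R_factor:
  assumes "r \<in> R" "r \<noteq> 0"
  obtains v where "v \<in> R" "v $ 0 \<noteq> 0" "inverse v \<in> R" "v * inverse v = 1" "r = fps_X ^ subdegree r * v"
proof -
  let ?v = "fps_shift (subdegree r) r"
  have eq: "r = fps_X ^ subdegree r * ?v"
    using subdegree_decompose[of r] by (simp only: mult.commute)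
  have v: "?v \<in> R" using assms(1) R_divide_Xpow eq by metis
  have v0: "?v $ 0 \<noteq> 0" using assms(2) by simp
  have "?v * inverse ?v = 1" using inverse_mult_eq_1[OF v0] by (simp only: mult.commute)
  then show ?thesis using that[OF v v0 R_inverse[OF v v0] _ eq] by blast
qed

lemma R_dvd:
  assumes "r \<in> R" "s \<in> R" "s \<noteq> 0" "r = 0 \<or> subdegree s \<le> subdegree r"
  shows "\<exists>q\<in>R. r = q * s"
proof (cases "r = 0")
  case True
  then show ?thesis using R_0 by auto
next
  case False
  obtain v where v: "v \<in> R" "inverse v \<in> R" "v * inverse v = 1" "s = fps_X ^ subdegree s * v"
    using R_factor[OF assms(2,3)] by metis
  obtain w where w: "w \<in> R" "r = fps_X ^ subdegree r * w"
    using R_factor[OF assms(1) False] by metis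
  have "subdegree r = (subdegree r - subdegree s) + subdegree s" using assms(4) False by simp
  then have "r = fps_X ^ (subdegree r - subdegree s) * fps_X ^ subdegree s * w * (v * inverse v)"
    using w(2) v(3) by (metis power_add mult_1_right)
  also have "\<dots> = (fps_X ^ (subdegree r - subdegree s) * w * inverse v) * (fps_X ^ subdegree s * v)"
    by (simp only: mult_ac)
  finally have "r = (fps_X ^ (subdegree r - subdegree s) * w * inverse v) * s" using v(4) by simp
  then show ?thesis using R_mult[OF R_mult[OF R_Xpow w(1)] v(2)] by blast
qed

lemma RT_split:
  assumes "w \<in> RT"
  shows "w = fps_const (w $ 0) + fps_X * fps_shift 1 w" "fps_shift 1 w \<in> RT" "w $ 0 \<in> R"
  using fps_shift_split[of 0 w] assms by (simp_all add: RT_def)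

text \<open>An element lies in a prime ideal if and only if its square does, and the square lies in \<open>R[[t]]\<close>.
  Modulo \<open>t\<close> only the two primes of the valuation ring \<open>R\<close> remain.\<close>

lemma primes_over_X:
  assumes Q: "Q \<subseteq> A" "\<And>x y. \<lbrakk>x \<in> Q; y \<in> Q\<rbrakk> \<Longrightarrow> x + y \<in> Q" "\<And>x y. \<lbrakk>x \<in> A; y \<in> Q\<rbrakk> \<Longrightarrow> x * y \<in> Q"
    "1 \<notin> Q" "\<And>x y. \<lbrakk>x \<in> A; y \<in> A; x * y \<in> Q\<rbrakk> \<Longrightarrow> x \<in> Q \<or> y \<in> Q" "fps_X \<in> Q"
  shows "Q = {x \<in> A. x $ 0 = 0} \<or> Q = {x \<in> A. x $ 0 $ 0 = 0}"
proof -
  have t: "fps_X * y \<in> Q" if "y \<in> A" for y using Q(3)[OF that Q(6)] by (simp add: mult.commute)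
  have sq: "x \<in> Q" if "x \<in> A" "x * x \<in> Q" for x using Q(5)[OF that(1,1,2)] by blast
  have p: "{x \<in> A. x $ 0 = 0} \<subseteq> Q"
  proof
    fix x assume "x \<in> {x \<in> A. x $ 0 = 0}"
    then have x: "x \<in> A" "x $ 0 = 0" by auto
    note s = RT_split[OF A_square[OF x(1)]]
    have "x * x = fps_X * fps_shift 1 (x * x)" using s(1) x(2) by simp
    then show "x \<in> Q" using sq[OF x(1)] t[OF RT_A[OF s(2)]] by simp
  qed
  show ?thesis
  proof (cases "Q \<subseteq> {x \<in> A. x $ 0 = 0}")
    case True
    then show ?thesis using p by blast
  next
    case False
    then obtain x where x: "x \<in> Q" "x $ 0 \<noteq> 0" using Q(1) by blast
    have xA: "x \<in> A" using x(1) Q(1) by blast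
    define r where "r = (x * x) $ 0"
    note s = RT_split[OF A_square[OF xA], folded r_def]
    have r0: "r \<noteq> 0" using x(2) by (simp add: r_def)
    have "x * x + fps_X * fps_shift 1 (x * x)
        = (fps_const r + fps_X * fps_shift 1 (x * x)) + fps_X * fps_shift 1 (x * x)"
      using s(1) by (rule arg_cong)
    then have "fps_const r = x * x + fps_X * fps_shift 1 (x * x)"
      by (simp only: add.assoc biseries_add_self add_0_right)
    then have rQ: "fps_const r \<in> Q"
      using Q(2)[OF Q(3)[OF xA x(1)] t[OF RT_A[OF s(2)]]] by simp
    obtain v where v: "v \<in> R" "inverse v \<in> R" "v * inverse v = 1" "r = fps_X ^ subdegree r * v"
      using R_factor[OF s(3) r0] by metis
    have "fps_const (inverse v) * fps_const r \<in> Q"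
      by (rule Q(3)[OF RT_A[OF RT_const[OF v(2)]] rQ])
    moreover have "inverse v * r = fps_X ^ subdegree r"
      using arg_cong[OF v(4), of "\<lambda>w. inverse v * w"] v(3) by (simp only: mult_ac) simp
    ultimately have "fps_const (fps_X ^ subdegree r) \<in> Q" by simp
    moreover have "fps_const (fps_X ^ n) \<in> Q \<Longrightarrow> fps_const fps_X \<in> Q" for n
    proof (induction n)
      case 0
      then show ?case using Q(4) by simp
    next
      case (Suc n)
      then have "fps_const fps_X * fps_const (fps_X ^ n) \<in> Q" by simp
      then show ?case using Q(5)[OF RT_A[OF RT_const[OF R_X]] RT_A[OF RT_const[OF R_Xpow]]] Suc.IH by blast
    qed
    ultimately have sQ: "fps_const fps_X \<in> Q" by blast
    have "{x \<in> A. x $ 0 $ 0 = 0} \<subseteq> Q"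
    proof
      fix y assume "y \<in> {x \<in> A. x $ 0 $ 0 = 0}"
      then have y: "y \<in> A" "y $ 0 $ 0 = 0" by auto
      let ?c = "(y * y) $ 0"
      note s = RT_split[OF A_square[OF y(1)]]
      have "?c $ 0 = 0" using y(2) by simp
      then have c: "?c = fps_X * fps_shift 1 ?c" using fps_shift_split[of 0 ?c] by simp
      then have "fps_shift 1 ?c \<in> R" using s(3) R_divide_X by metis
      then have "fps_const (fps_shift 1 ?c) * fps_const fps_X \<in> Q"
        by (intro Q(3)[OF RT_A[OF RT_const] sQ])
      moreover have "fps_const (fps_shift 1 ?c) * fps_const fps_X = fps_const ?c"
        using c by (simp only: fps_const_mult mult.commute)
      ultimately have "fps_const ?c \<in> Q" by simp
      then have "y * y \<in> Q" using Q(2)[OF _ t[OF RT_A[OF s(2)]]] s(1) by metis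
      then show "y \<in> Q" by (rule sq[OF y(1)])
    qed
    moreover have "y $ 0 $ 0 = 0" if y: "y \<in> Q" for y
    proof (rule ccontr)
      assume "y $ 0 $ 0 \<noteq> 0"
      then obtain z where "z \<in> A" "y * z = 1" using A_inverse[of y] Q(1) y by blast
      then show False using Q(3)[OF _ y, of z] Q(4) by (simp add: mult.commute)
    qed
    ultimately show ?thesis using Q(1) by blast
  qed
qed

end

section \<open>Finitely generated submodules\<close>

inductive_set fspan :: "'w::comm_ring_1 set \<Rightarrow> 'w set \<Rightarrow> 'w set" for B G where
  zero: "0 \<in> fspan B G"
| step: "\<lbrakk>b \<in> B; g \<in> G; x \<in> fspan B G\<rbrakk> \<Longrightarrow> b * g + x \<in> fspan B G"

definition submod :: "'w::comm_ring_1 set \<Rightarrow> 'w set \<Rightarrow> bool" where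
  "submod B J \<longleftrightarrow> 0 \<in> J \<and> (\<forall>x\<in>J. \<forall>y\<in>J. x + y \<in> J) \<and> (\<forall>b\<in>B. \<forall>x\<in>J. b * x \<in> J)"

definition fin_gen :: "'w::comm_ring_1 set \<Rightarrow> 'w set \<Rightarrow> bool" where
  "fin_gen B J \<longleftrightarrow> (\<exists>G. finite G \<and> G \<subseteq> J \<and> J \<subseteq> fspan B G)"

lemma fspan_mono: "\<lbrakk>x \<in> fspan B G; G \<subseteq> H\<rbrakk> \<Longrightarrow> x \<in> fspan B H"
  by (induction rule: fspan.induct) (auto intro: fspan.intros)

lemma fspan_add: "\<lbrakk>x \<in> fspan B G; y \<in> fspan B G\<rbrakk> \<Longrightarrow> x + y \<in> fspan B G"
  by (induction rule: fspan.induct) (auto intro: fspan.intros simp: add.assoc)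

lemma fspan_subset: "\<lbrakk>submod B J; G \<subseteq> J; x \<in> fspan B G\<rbrakk> \<Longrightarrow> x \<in> J"
  by (rotate_tac 2, induction rule: fspan.induct) (auto simp: submod_def)

locale subring_set =
  fixes B :: "'w::comm_ring_1 set"
  assumes B1: "1 \<in> B" and Badd: "\<lbrakk>x \<in> B; y \<in> B\<rbrakk> \<Longrightarrow> x + y \<in> B"
    and Bmult: "\<lbrakk>x \<in> B; y \<in> B\<rbrakk> \<Longrightarrow> x * y \<in> B" and Bneg: "x \<in> B \<Longrightarrow> - x \<in> B"
begin

lemma B0: "0 \<in> B"
  using Badd[OF B1 Bneg[OF B1]] by simp

lemma fspan_base: "\<lbrakk>b \<in> B; g \<in> G\<rbrakk> \<Longrightarrow> b * g \<in> fspan B G"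
  using fspan.step[OF _ _ fspan.zero, of b B g G] by simp

lemma fspan_scale: "\<lbrakk>x \<in> fspan B G; b \<in> B\<rbrakk> \<Longrightarrow> b * x \<in> fspan B G"
proof (induction rule: fspan.induct)
  case (step c g x)
  have "b * (c * g + x) = (b * c) * g + b * x" by (simp add: algebra_simps)
  then show ?case using step by (auto intro: fspan.step Bmult)
qed (simp add: fspan.zero)

lemma fspan_submod: "submod B (fspan B G)"
  by (simp add: submod_def fspan.zero fspan_add fspan_scale)

lemma submod_diff: "\<lbrakk>submod B J; x \<in> J; y \<in> J\<rbrakk> \<Longrightarrow> x - y \<in> J"
  using Bneg[OF B1] unfolding submod_def by (metis add_uminus_conv_diff mult_minus1)

lemma fspan_insertE:
  assumes "x \<in> fspan B (insert e E)"
  shows "\<exists>b\<in>B. \<exists>y\<in>fspan B E. x = b * e + y"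
  using assms
proof (induction rule: fspan.induct)
  case zero
  then show ?case using B0 fspan.zero by force
next
  case (step c g x)
  then obtain b y where hy: "b \<in> B" "y \<in> fspan B E" "x = b * e + y" by blast
  show ?case
  proof (cases "g = e")
    case True
    have "c * g + x = (c + b) * e + y" using True hy(3) by (simp add: algebra_simps)
    then show ?thesis using Badd[OF step(1) hy(1)] hy(2) by blast
  next
    case False
    then have "c * g + y \<in> fspan B E" using step by (intro fspan.step hy) auto
    moreover have "c * g + x = b * e + (c * g + y)" using hy(3) by (simp add: algebra_simps)
    ultimately show ?thesis using hy(1) by blast
  qed
qed

text \<open>Induction on the number of generators of the ambient module.  The coefficients at one generator
  that occur in the submodule form an ideal; lifts of generators of that ideal, together with
  generators of the part of the submodule that is spanned by the other generators, suffice.\<close>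

lemma submodule_fin_gen:
  assumes noeth: "\<And>J. \<lbrakk>J \<subseteq> B; submod B J\<rbrakk> \<Longrightarrow> fin_gen B J"
    and "finite E"
  shows "\<lbrakk>submod B J; J \<subseteq> fspan B E\<rbrakk> \<Longrightarrow> fin_gen B J"
  using assms(2)
proof (induction E arbitrary: J rule: finite_induct)
  case empty
  then show ?case by (auto simp: fin_gen_def)
next
  case (insert e E)
  note J = insert.prems(1)
  have J0: "0 \<in> J" and Ja: "\<And>x y. \<lbrakk>x \<in> J; y \<in> J\<rbrakk> \<Longrightarrow> x + y \<in> J" and Js: "\<And>b x. \<lbrakk>b \<in> B; x \<in> J\<rbrakk> \<Longrightarrow> b * x \<in> J"
    using J by (auto simp: submod_def)
  define I where "I = {b \<in> B. \<exists>x\<in>fspan B E. b * e + x \<in> J}"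
  have "submod B I"
    unfolding submod_def
  proof (intro conjI ballI)
    show "0 \<in> I" using B0 J0 fspan.zero[of B E] by (force simp: I_def)
    fix b assume "b \<in> I"
    then obtain x where x: "b \<in> B" "x \<in> fspan B E" "b * e + x \<in> J" by (auto simp: I_def)
    { fix c assume "c \<in> I"
      then obtain y where y: "c \<in> B" "y \<in> fspan B E" "c * e + y \<in> J" by (auto simp: I_def)
      have "(b + c) * e + (x + y) \<in> J" using Ja[OF x(3) y(3)] by (simp add: algebra_simps)
      then show "b + c \<in> I" using Badd[OF x(1) y(1)] fspan_add[OF x(2) y(2)] by (auto simp: I_def) }
    fix c assume c: "c \<in> B"
    have "(c * b) * e + c * x \<in> J" using Js[OF c x(3)] by (simp add: algebra_simps)
    then show "c * b \<in> I" using Bmult[OF c x(1)] fspan_scale[OF x(2) c] by (auto simp: I_def)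
  qed
  then have "fin_gen B I" by (intro noeth) (auto simp: I_def)
  then obtain G where G: "finite G" "G \<subseteq> I" "I \<subseteq> fspan B G" by (auto simp: fin_gen_def)
  have "\<forall>b\<in>G. \<exists>x\<in>fspan B E. b * e + x \<in> J" using G(2) by (auto simp: I_def)
  then obtain l where l: "\<And>b. b \<in> G \<Longrightarrow> l b \<in> fspan B E" "\<And>b. b \<in> G \<Longrightarrow> b * e + l b \<in> J" by metis
  let ?L = "(\<lambda>b. b * e + l b) ` G"
  have "submod B (J \<inter> fspan B E)" using J fspan_submod[of E] by (auto simp: submod_def)
  then have "fin_gen B (J \<inter> fspan B E)" by (intro insert.IH) auto
  then obtain H where H: "finite H" "H \<subseteq> J \<inter> fspan B E" "J \<inter> fspan B E \<subseteq> fspan B H"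
    by (auto simp: fin_gen_def)
  have lift: "\<exists>x\<in>fspan B E. b * e + x \<in> fspan B ?L" if "b \<in> fspan B G" for b
    using that
  proof (induction rule: fspan.induct)
    case zero
    then show ?case using fspan.zero[of B E] fspan.zero[of B ?L] by force
  next
    case (step c g b)
    then obtain x where x: "x \<in> fspan B E" "b * e + x \<in> fspan B ?L" by blast
    have "c * (g * e + l g) + (b * e + x) \<in> fspan B ?L"
      by (rule fspan.step[OF step(1) imageI[OF step(2)] x(2)])
    moreover have "c * (g * e + l g) + (b * e + x) = (c * g + b) * e + (c * l g + x)"
      by (simp add: algebra_simps)
    moreover have "c * l g + x \<in> fspan B E"
      by (rule fspan_add[OF fspan_scale[OF l(1)[OF step(2)] step(1)] x(1)])
    ultimately show ?case by metis
  qed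
  have "J \<subseteq> fspan B (?L \<union> H)"
  proof
    fix y assume y: "y \<in> J"
    then obtain b x where x: "b \<in> B" "x \<in> fspan B E" "y = b * e + x"
      using fspan_insertE[of y e E] insert.prems(2) by blast
    then have "b \<in> I" using y by (auto simp: I_def)
    then obtain x' where x': "x' \<in> fspan B E" "b * e + x' \<in> fspan B ?L" using lift G(3) by blast
    have "?L \<subseteq> J" using l(2) by blast
    then have "b * e + x' \<in> J" using fspan_subset[OF J _ x'(2)] by blast
    then have "y - (b * e + x') \<in> J" by (rule submod_diff[OF J y])
    moreover have "y - (b * e + x') = x - x'" using x(3) by simp
    ultimately have "x - x' \<in> fspan B H"
      using H(3) submod_diff[OF fspan_submod x(2) x'(1)] by auto
    then have "(b * e + x') + (x - x') \<in> fspan B (?L \<union> H)"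
      by (intro fspan_add[OF fspan_mono[OF x'(2)] fspan_mono]) auto
    then show "y \<in> fspan B (?L \<union> H)" using x(3) by simp
  qed
  moreover have "?L \<union> H \<subseteq> J" using l(2) H(2) by blast
  moreover have "finite (?L \<union> H)" using G(1) H(1) by simp
  ultimately show ?case unfolding fin_gen_def by (intro exI conjI)
qed

end

section \<open>Noetherianity\<close>

context nonsplit_dvr
begin

lemma RT_subring: "subring_set RT"
  by unfold_locales (auto simp: RT_1 RT_add RT_mult biseries_uminus)

text \<open>Since the leading coefficient of \<open>g\<close> divides the leading coefficient of every element of \<open>J\<close>, the
  division of \<open>y\<close> by \<open>g\<close> can be carried out one coefficient at a time: all remainders stay in \<open>J\<close>.\<close>

lemma RT_divide:
  assumes J: "submod RT J" "J \<subseteq> RT" and g: "g \<in> J" "g \<noteq> 0"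
    and min: "\<And>x. \<lbrakk>x \<in> J; x \<noteq> 0\<rbrakk> \<Longrightarrow> subdegree (g $ subdegree g) \<le> subdegree (x $ subdegree x)"
    and y: "y \<in> J" "\<And>i. i < subdegree g \<Longrightarrow> y $ i = 0"
  shows "\<exists>h\<in>RT. y = h * g"
proof -
  interpret subring_set RT by (rule RT_subring)
  define N where "N = subdegree g"
  define g' where "g' = fps_shift N g"
  have g': "g = fps_X ^ N * g'" using subdegree_decompose[of g] by (simp add: N_def g'_def mult.commute)
  have g'0: "g' $ 0 = g $ subdegree g" "g' $ 0 \<noteq> 0" "g' $ 0 \<in> R"
    using g J(2) by (auto simp: g'_def N_def RT_nth)
  \<comment> \<open>\<open>z k\<close> is the remainder after \<open>k\<close> steps divided by \<open>t\<close> to the power \<open>N + k\<close>.\<close>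
  define q where "q z = (SOME q. q \<in> R \<and> z $ 0 = q * g' $ 0)" for z
  define nxt where "nxt z = fps_shift 1 (z - fps_const (q z) * g')" for z
  define z where "z k = (nxt ^^ k) (fps_shift N y)" for k
  have y0: "y = fps_X ^ N * z 0"
    using y(2) by (intro fps_ext) (auto simp: z_def N_def fps_X_power_mult_nth)
  have qz: "q (z k) \<in> R \<and> z k $ 0 = q (z k) * g' $ 0" if zk: "fps_X ^ (N + k) * z k \<in> J" for k
  proof -
    have zR: "z k $ 0 \<in> R"
      using zk J(2) RT_nth[of "fps_X ^ (N + k) * z k" "N + k"] by (auto simp: fps_X_power_mult_nth)
    have "z k $ 0 = 0 \<or> subdegree (g' $ 0) \<le> subdegree (z k $ 0)"
    proof (cases "z k $ 0 = 0")
      case False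
      then have nz: "z k \<noteq> 0" "subdegree (z k) = 0" by auto
      then have "subdegree (fps_X ^ (N + k) * z k) = N + k" by (simp add: fps_X_power_subdegree)
      then have "(fps_X ^ (N + k) * z k) $ subdegree (fps_X ^ (N + k) * z k) = z k $ 0"
        by (simp add: fps_X_power_mult_nth)
      then show ?thesis using min[OF zk] nz g'0(1) by simp
    qed simp
    then have "\<exists>q. q \<in> R \<and> z k $ 0 = q * g' $ 0" using R_dvd[OF zR g'0(3,2)] by blast
    then show ?thesis unfolding q_def by (rule someI_ex)
  qed
  have nx: "z k = fps_const (q (z k)) * g' + fps_X * z (Suc k)" if zk: "fps_X ^ (N + k) * z k \<in> J" for k
  proof -
    let ?d = "z k - fps_const (q (z k)) * g'"
    have "?d $ 0 = 0" using qz[OF zk] by simp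
    then have "?d = fps_X * fps_shift (Suc 0) ?d" using fps_shift_split[of 0 ?d] by simp
    then have "?d = fps_X * z (Suc k)" by (simp add: z_def nxt_def)
    then show ?thesis by (simp add: algebra_simps)
  qed
  have zJ: "fps_X ^ (N + k) * z k \<in> J" for k
  proof (induction k)
    case 0
    then show ?case using y(1) y0 by simp
  next
    case (Suc k)
    have "fps_X ^ (N + Suc k) * z (Suc k) = fps_X ^ (N + k) * (fps_X * z (Suc k))" by (simp add: mult_ac)
    also have "fps_X * z (Suc k) = z k - fps_const (q (z k)) * g'"
      using nx[OF Suc] by (metis add_diff_cancel_left')
    also have "fps_X ^ (N + k) * (z k - fps_const (q (z k)) * g')
       = fps_X ^ (N + k) * z k - (fps_X ^ k * fps_const (q (z k))) * g"
      unfolding g' by (simp add: algebra_simps power_add)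
    also have "\<dots> \<in> J"
      using J(1) g(1) qz[OF Suc] by (intro submod_diff[OF J(1) Suc])
        (auto simp: submod_def intro!: RT_mult RT_power RT_X RT_const)
    finally show ?case .
  qed
  define h where "h = Abs_fps (\<lambda>k. q (z k))"
  have hRT: "h \<in> RT" using qz zJ by (simp add: RT_def h_def)
  have exp: "z 0 = fps_cutoff k h * g' + fps_X ^ k * z k" for k
  proof (induction k)
    case (Suc k)
    have "fps_cutoff (Suc k) h = fps_cutoff k h + fps_X ^ k * fps_const (q (z k))"
      by (rule fps_ext) (auto simp: h_def fps_X_power_mult_nth less_Suc_eq)
    then have "fps_cutoff (Suc k) h * g' + fps_X ^ Suc k * z (Suc k)
      = fps_cutoff k h * g' + fps_X ^ k * (fps_const (q (z k)) * g' + fps_X * z (Suc k))"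
      by (simp add: algebra_simps)
    also have "\<dots> = fps_cutoff k h * g' + fps_X ^ k * z k" by (simp only: nx[OF zJ[of k], symmetric])
    finally show ?case using Suc by (simp only:)
  qed simp
  have "z 0 = h * g'"
  proof (rule fps_ext)
    fix j
    have "h = fps_X ^ Suc j * fps_shift (Suc j) h + fps_cutoff (Suc j) h" by (simp only: fps_shift_cutoff')
    then have "h * g' = fps_cutoff (Suc j) h * g' + fps_X ^ Suc j * (fps_shift (Suc j) h * g')"
      by (metis add.commute distrib_right mult.assoc)
    moreover have "(fps_X ^ Suc j * u) $ j = 0" for u :: biseries
      by (simp add: fps_X_power_mult_nth del: power_Suc)
    ultimately show "z 0 $ j = (h * g') $ j"
      using exp[of "Suc j"] by (metis fps_add_nth)
  qed
  then have "y = h * g" unfolding y0 g' by (simp add: mult_ac)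
  then show ?thesis using hRT by blast
qed

text \<open>Among all elements of the ideal take \<open>g\<close> with a leading coefficient of minimal valuation.  It
  generates all elements of at least its own order.  Below that order finitely many coefficients
  remain, and each of them needs one more generator.\<close>

lemma RT_noetherian:
  assumes J: "J \<subseteq> RT" "submod RT J"
  shows "fin_gen RT J"
proof (cases "J \<subseteq> {0}")
  case True
  then have "J \<subseteq> fspan RT {}" using fspan.zero by blast
  then show ?thesis unfolding fin_gen_def by blast
next
  case False
  interpret subring_set RT by (rule RT_subring)
  have "\<exists>x. x \<in> J \<and> x \<noteq> 0" using False by blast
  then obtain g where g: "g \<in> J" "g \<noteq> 0"
    and min: "\<And>x. \<lbrakk>x \<in> J; x \<noteq> 0\<rbrakk> \<Longrightarrow> subdegree (g $ subdegree g) \<le> subdegree (x $ subdegree x)"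
    using arg_min_nat_lemma[of "\<lambda>x. x \<in> J \<and> x \<noteq> 0" _ "\<lambda>x. subdegree (x $ subdegree x)"] by blast
  define K where "K n = {y \<in> J. \<forall>i<n. y $ i = 0}" for n
  have top: "fin_gen RT (K (subdegree g))"
    unfolding fin_gen_def
  proof (intro exI conjI)
    show "finite {g}" "{g} \<subseteq> K (subdegree g)" using g by (auto simp: K_def)
    show "K (subdegree g) \<subseteq> fspan RT {g}"
    proof
      fix y assume "y \<in> K (subdegree g)"
      then obtain h where "h \<in> RT" "y = h * g"
        using RT_divide[OF J(2,1) g min, of y] by (auto simp: K_def)
      then show "y \<in> fspan RT {g}" by (simp add: fspan_base)
    qed
  qed
  have step: "fin_gen RT (K n)" if IH: "fin_gen RT (K (Suc n))" for n
  proof (cases "\<exists>y. y \<in> K n \<and> y $ n \<noteq> 0")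
    case False
    then have "K n = K (Suc n)" by (auto simp: K_def less_Suc_eq)
    then show ?thesis using IH by simp
  next
    case True
    then obtain b where b: "b \<in> K n" "b $ n \<noteq> 0"
      and bmin: "\<And>y. \<lbrakk>y \<in> K n; y $ n \<noteq> 0\<rbrakk> \<Longrightarrow> subdegree (b $ n) \<le> subdegree (y $ n)"
      using arg_min_nat_lemma[of "\<lambda>y. y \<in> K n \<and> y $ n \<noteq> 0" _ "\<lambda>y. subdegree (y $ n)"] by blast
    obtain G where G: "finite G" "G \<subseteq> K (Suc n)" "K (Suc n) \<subseteq> fspan RT G"
      using IH by (auto simp: fin_gen_def)
    have bJ: "b \<in> J" using b by (simp add: K_def)
    have "y \<in> fspan RT (insert b G)" if y: "y \<in> K n" for y
    proof -
      have yJ: "y \<in> J" using y by (simp add: K_def)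
      obtain q where q: "q \<in> R" "y $ n = q * b $ n"
        using R_dvd[of "y $ n" "b $ n"] b(2) bmin[OF y] RT_nth yJ bJ J(1) by blast
      have qb: "fps_const q * b \<in> J" using J(2) bJ RT_const[OF q(1)] by (auto simp: submod_def)
      have "y - fps_const q * b \<in> K (Suc n)"
        using submod_diff[OF J(2) yJ qb] q(2) y b(1) by (auto simp: K_def less_Suc_eq)
      then have "y - fps_const q * b \<in> fspan RT (insert b G)" using G(3) fspan_mono by blast
      then have "fps_const q * b + (y - fps_const q * b) \<in> fspan RT (insert b G)"
        by (intro fspan.step RT_const q) auto
      then show ?thesis by simp
    qed
    moreover have "insert b G \<subseteq> K n" using G(2) b(1) by (auto simp: K_def)
    ultimately show ?thesis using G(1) unfolding fin_gen_def by (metis finite_insert subsetI)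
  qed
  have "fin_gen RT (K n)" if "n \<le> subdegree g" for n
    using that by (induction n rule: inc_induct) (auto intro: top step)
  moreover have "K 0 = J" by (simp add: K_def)
  ultimately show ?thesis by (metis le0)
qed

lemma A_noetherian:
  assumes "J \<subseteq> A" "submod RT J"
  shows "fin_gen RT J"
proof (rule subring_set.submodule_fin_gen[OF RT_subring RT_noetherian])
  interpret subring_set RT by (rule RT_subring)
  let ?E = "{1, F, \<beta>, F * \<beta>}"
  show "finite ?E" by simp
  show "J \<subseteq> fspan RT ?E"
  proof
    fix x assume "x \<in> J"
    then have "x \<in> A" using assms(1) by blast
    then obtain x0 x1 x2 x3 where x: "x0 \<in> RT" "x1 \<in> RT" "x2 \<in> RT" "x3 \<in> RT"
      "x = x0 + x1 * F + x2 * \<beta> + x3 * (F * \<beta>)" using A_E by blast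
    have "x0 * 1 + x1 * F + x2 * \<beta> + x3 * (F * \<beta>) \<in> fspan RT ?E"
      by (intro fspan_add fspan_base x) auto
    then show "x \<in> fspan RT ?E" using x(5) by simp
  qed
qed (use assms in auto)

end

section \<open>Encoded subrings\<close>

text \<open>A subring of a type of class \<open>comm_ring_1\<close> as a ring record, transported along an injection into
  another type.  Only the cardinality of the target matters.\<close>

definition encoded_ring :: "('w::comm_ring_1 \<Rightarrow> 'b) \<Rightarrow> 'w set \<Rightarrow> 'b ring" where
  "encoded_ring e A =
     \<lparr>carrier = e ` A, monoid.mult = (\<lambda>x y. e (inv_into UNIV e x * inv_into UNIV e y)), one = e 1, zero = e 0,
      add = (\<lambda>x y. e (inv_into UNIV e x + inv_into UNIV e y))\<rparr>"

locale encoded_subring = subring_set A for A :: "'w::comm_ring_1 set" +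
  fixes e :: "'w \<Rightarrow> 'b"
  assumes inj_e: "inj e"
begin

abbreviation "E \<equiv> encoded_ring e A"

lemma e_eq [simp]: "e x = e y \<longleftrightarrow> x = y"
  using inj_e by (rule inj_eq)

lemma e_mem [simp]: "e x \<in> e ` J \<longleftrightarrow> x \<in> J"
  using inj_e by (rule inj_image_mem_iff)

lemma E_simps [simp]:
  "carrier E = e ` A" "\<one>\<^bsub>E\<^esub> = e 1" "\<zero>\<^bsub>E\<^esub> = e 0"
  "e x \<otimes>\<^bsub>E\<^esub> e y = e (x * y)" "e x \<oplus>\<^bsub>E\<^esub> e y = e (x + y)"
  by (simp_all add: encoded_ring_def inj_e inv_f_f)

lemma E_cring: "cring E"
proof (rule cringI)
  show "abelian_group E"
  proof (rule abelian_groupI)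
    fix x assume "x \<in> carrier E"
    then obtain u where "u \<in> A" "x = e u" by auto
    then show "\<exists>y\<in>carrier E. y \<oplus>\<^bsub>E\<^esub> x = \<zero>\<^bsub>E\<^esub>"
      using Bneg by (intro bexI[of _ "e (- u)"]) auto
  qed (auto simp: B0 Badd algebra_simps)
  show "Group.comm_monoid E"
    by (rule comm_monoidI) (auto simp: B1 Bmult algebra_simps)
qed (auto simp: algebra_simps)

lemma E_uminus: assumes "x \<in> A" shows "\<ominus>\<^bsub>E\<^esub> e x = e (- x)"
proof -
  interpret E: cring E by (rule E_cring)
  show ?thesis using assms Bneg by (intro E.minus_equality) auto
qed

lemma E_minus: "y \<in> A \<Longrightarrow> e x \<ominus>\<^bsub>E\<^esub> e y = e (x - y)"
  by (simp add: a_minus_def E_uminus)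

lemma E_pow: "e x [^]\<^bsub>E\<^esub> (n::nat) = e (x ^ n)"
  by (induction n) (simp_all add: mult.commute)

lemma E_ideal:
  assumes "J \<subseteq> A" "submod A J"
  shows "ideal (e ` J) E"
proof -
  interpret E: cring E by (rule E_cring)
  have neg: "- x \<in> J" if "x \<in> J" for x
    using submod_diff[OF assms(2) _ that, of 0] assms(2) by (simp add: submod_def)
  have mult: "b * x \<in> J" "x * b \<in> J" if "x \<in> J" "b \<in> A" for x b
    using assms(2) that by (simp_all add: submod_def mult.commute[of x])
  show ?thesis
  proof (rule idealI[OF E.ring_axioms])
    show "subgroup (e ` J) (add_monoid E)"
    proof (rule E.add.subgroupI)
      fix x assume "x \<in> e ` J"
      then obtain u where u: "u \<in> J" "x = e u" by auto
      have "\<ominus>\<^bsub>E\<^esub> x = e (- u)" using u assms(1) by (auto intro: E_uminus)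
      then show "\<ominus>\<^bsub>E\<^esub> x \<in> e ` J" using neg[OF u(1)] by simp
    qed (use assms in \<open>auto simp: submod_def\<close>)
  qed (use mult in auto)
qed

lemma E_ideal_preimage:
  assumes "ideal K E"
  shows "submod A {x \<in> A. e x \<in> K}" "e ` {x \<in> A. e x \<in> K} = K"
proof -
  interpret K: ideal K E by fact
  show "submod A {x \<in> A. e x \<in> K}"
    unfolding submod_def
  proof (intro conjI ballI)
    show "0 \<in> {x \<in> A. e x \<in> K}" using B0
      additive_subgroup.zero_closed[OF K.is_additive_subgroup] by simp
    fix x assume x: "x \<in> {x \<in> A. e x \<in> K}"
    { fix y assume "y \<in> {x \<in> A. e x \<in> K}"
      then show "x + y \<in> {x \<in> A. e x \<in> K}" 
        using x additive_subgroup.a_closed[OF K.is_additive_subgroup, of "e x" "e y"] Badd by simp }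
    fix b assume "b \<in> A"
    then show "b * x \<in> {x \<in> A. e x \<in> K}" using x K.I_l_closed[of "e x" "e b"] Bmult by simp
  qed
  show "e ` {x \<in> A. e x \<in> K} = K" using K.a_subset by auto
qed

lemma E_noetherian:
  assumes "\<And>J. \<lbrakk>J \<subseteq> A; submod A J\<rbrakk> \<Longrightarrow> fin_gen A J"
  shows "noetherian_ring E"
proof -
  interpret E: cring E by (rule E_cring)
  show ?thesis
  proof unfold_locales
    fix K assume K: "ideal K E"
    define J where "J = {x \<in> A. e x \<in> K}"
    note J = E_ideal_preimage[OF K, folded J_def]
    obtain G where G: "finite G" "G \<subseteq> J" "J \<subseteq> fspan A G"
      using assms[OF _ J(1)] by (auto simp: J_def fin_gen_def)
    have sub: "e ` G \<subseteq> carrier E" using G(2) by (auto simp: J_def)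
    interpret H: ideal "Idl\<^bsub>E\<^esub> (e ` G)" E by (rule E.genideal_ideal[OF sub])
    have "e x \<in> Idl\<^bsub>E\<^esub> (e ` G)" if "x \<in> fspan A G" for x
      using that
    proof (induction rule: fspan.induct)
      case zero
      then show ?case using additive_subgroup.zero_closed[OF H.is_additive_subgroup] by simp
    next
      case (step b g x)
      have "e g \<in> Idl\<^bsub>E\<^esub> (e ` G)" using E.genideal_self[OF sub] step(2) by blast
      then have "e b \<otimes>\<^bsub>E\<^esub> e g \<in> Idl\<^bsub>E\<^esub> (e ` G)" using step(1) by (intro H.I_l_closed) auto
      then have "(e b \<otimes>\<^bsub>E\<^esub> e g) \<oplus>\<^bsub>E\<^esub> e x \<in> Idl\<^bsub>E\<^esub> (e ` G)" using step.IH 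
        by (rule additive_subgroup.a_closed[OF H.is_additive_subgroup])
      then show ?case by simp
    qed
    then have "K \<subseteq> Idl\<^bsub>E\<^esub> (e ` G)" using G(3) J(2) by blast
    moreover have "Idl\<^bsub>E\<^esub> (e ` G) \<subseteq> K" using G(2) J(2) by (intro E.genideal_minimal[OF K]) blast
    ultimately show "\<exists>G\<subseteq>carrier E. finite G \<and> K = Idl\<^bsub>E\<^esub> G"
      using G(1) sub by (intro exI[of _ "e ` G"]) auto
  qed
qed

lemma E_prime:
  assumes "J \<subseteq> A" "submod A J" "1 \<notin> J"
    "\<And>x y. \<lbrakk>x \<in> A; y \<in> A; x * y \<in> J\<rbrakk> \<Longrightarrow> x \<in> J \<or> y \<in> J"
  shows "e ` J \<in> spec E"
  unfolding spec_def
proof (intro CollectI primeidealI E_ideal E_cring assms(1,2))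
  show "carrier E \<noteq> e ` J"
  proof
    assume "carrier E = e ` J"
    moreover have "e 1 \<in> carrier E" using B1 by simp
    ultimately have "e 1 \<in> e ` J" by (simp only:)
    then show False using assms(3) by simp
  qed
  fix x y assume "x \<in> carrier E" "y \<in> carrier E" and xy: "x \<otimes>\<^bsub>E\<^esub> y \<in> e ` J"
  then obtain u v where u: "u \<in> A" "x = e u" and v: "v \<in> A" "y = e v" by auto
  then show "x \<in> e ` J \<or> y \<in> e ` J" using assms(4)[OF u(1) v(1)] xy by simp
qed

abbreviation "multiples t \<equiv> e ` ((\<lambda>x. t * x) ` A)"

lemma E_principal: "t \<in> A \<Longrightarrow> ideal (multiples t) E"
proof (rule E_ideal)
  assume t: "t \<in> A"
  then show "(\<lambda>x. t * x) ` A \<subseteq> A" using Bmult by auto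
  show "submod A ((\<lambda>x. t * x) ` A)"
    unfolding submod_def
  proof (intro conjI ballI)
    show "0 \<in> (\<lambda>x. t * x) ` A" using B0 by (intro image_eqI[of _ _ 0]) auto
    fix x assume "x \<in> (\<lambda>x. t * x) ` A"
    then obtain u where u: "u \<in> A" "x = t * u" by blast
    { fix y assume "y \<in> (\<lambda>x. t * x) ` A"
      then obtain v where v: "v \<in> A" "y = t * v" by blast
      show "x + y \<in> (\<lambda>x. t * x) ` A"
        using Badd[OF u(1) v(1)] u(2) v(2) by (intro image_eqI[of _ _ "u + v"]) (auto simp: algebra_simps) }
    fix b assume "b \<in> A"
    then show "b * x \<in> (\<lambda>x. t * x) ` A"
      using Bmult[OF _ u(1)] u(2) by (intro image_eqI[of _ _ "b * u"]) (auto simp: algebra_simps)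
  qed
qed

lemma E_ideal_power:
  assumes t: "t \<in> A"
  shows "ideal_power E (multiples t) n = multiples (t ^ n)"
proof (induction n)
  case 0
  then show ?case by simp
next
  case (Suc n)
  have "x \<in> multiples (t ^ Suc n)" if "x \<in> ideal_prod E (multiples (t ^ n)) (multiples t)" for x
    using that
  proof (induction rule: ideal_prod.induct)
    case (prod i j)
    then obtain x y where x: "x \<in> A" "i = e (t ^ n * x)" and y: "y \<in> A" "j = e (t * y)" by auto
    have "i \<otimes>\<^bsub>E\<^esub> j = e (t ^ Suc n * (x * y))" using x(2) y(2) by (simp add: mult_ac)
    then show ?case using Bmult[OF x(1) y(1)] by blast
  next
    case (sum i j)
    then obtain x y where x: "x \<in> A" "i = e (t ^ Suc n * x)" and y: "y \<in> A" "j = e (t ^ Suc n * y)" by blast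
    have "i \<oplus>\<^bsub>E\<^esub> j = e (t ^ Suc n * (x + y))" using x(2) y(2) by (simp add: algebra_simps)
    then show ?case using Badd[OF x(1) y(1)] by blast
  qed
  moreover have "x \<in> ideal_prod E (multiples (t ^ n)) (multiples t)" if x: "x \<in> multiples (t ^ Suc n)" for x
  proof -
    obtain y where y: "y \<in> A" "x = e (t ^ Suc n * y)" using x by blast
    have "x = e (t ^ n * y) \<otimes>\<^bsub>E\<^esub> e (t * 1)" using y(2) by (simp add: mult_ac)
    moreover have "e (t ^ n * y) \<in> multiples (t ^ n)" "e (t * 1) \<in> multiples t"
      using y(1) B1 by blast+
    ultimately show ?thesis by (simp only: ideal_prod.prod)
  qed
  ultimately have "ideal_prod E (multiples (t ^ n)) (multiples t) = multiples (t ^ Suc n)" by blast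
  then show ?case using Suc by (simp only: ideal_power.simps)
qed

end

section \<open>The counterexample\<close>

text \<open>A double power series over the field with two elements is determined by the set of its exponents.\<close>

definition encode :: "biseries \<Rightarrow> nat set" where
  "encode w = {prod_encode (i, j) | i j. w $ i $ j = 1}"

lemma inj_encode: "inj encode"
proof (rule injI, rule fps_ext, rule fps_ext)
  fix w v :: biseries and i j
  assume eq: "encode w = encode v"
  have iff: "prod_encode (i, j) \<in> encode u \<longleftrightarrow> u $ i $ j = 1" for u
    by (auto simp: encode_def)
  have "w $ i $ j = 1 \<longleftrightarrow> v $ i $ j = 1" using iff[of w] iff[of v] eq by simp
  then show "w $ i $ j = v $ i $ j" by (cases "w $ i $ j"; cases "v $ i $ j") simp_all
qed

context nonsplit_dvr
begin

lemma encoded_A: "encoded_subring A encode"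
  by unfold_locales (auto simp: A_1 A_add A_mult A_uminus inj_encode)

interpretation encoded_subring A encode
  by (rule encoded_A)

abbreviation (input) "I \<equiv> multiples fps_X"

lemma E_adic_pair: "adic_pair E I"
  by (intro adic_pair.intro E_cring E_principal A_X)

lemma ipow_mem: "encode x \<in> ideal_power E I n \<longleftrightarrow> (\<exists>y\<in>A. x = fps_X ^ n * y)"
  unfolding E_ideal_power[OF A_X] by auto

lemma E_noetherian_ring: "noetherian_ring E"
proof (rule E_noetherian)
  fix J assume J: "J \<subseteq> A" "submod A J"
  have "submod RT J" using J(2) RT_A by (auto simp: submod_def)
  then obtain G where G: "finite G" "G \<subseteq> J" "J \<subseteq> fspan RT G"
    using A_noetherian[OF J(1)] by (auto simp: fin_gen_def)
  have "x \<in> fspan A G" if "x \<in> fspan RT G" for x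
    using that by (induction rule: fspan.induct) (auto intro: fspan.intros RT_A)
  then show "fin_gen A J" using G unfolding fin_gen_def by blast
qed

text \<open>A compatible system is a sequence of elements whose successive differences are multiples of growing
  powers of \<open>t\<close>; its limit is the sum of the series formed by these differences.\<close>

lemma E_complete: "adically_complete E I"
  unfolding adically_complete_def
proof (intro allI impI)
  interpret P: adic_pair E I by (rule E_adic_pair)
  fix c assume c: "(\<forall>n. c n \<in> carrier (thick E I n)) \<and> (\<forall>n. thick_step E I n (c (Suc n)) = c n)"
  have "\<forall>n. \<exists>x. x \<in> A \<and> c n = to_thick E I n (encode x)"
  proof
    fix n
    have "c n \<in> to_thick E I n ` encode ` A" using c by (simp add: P.thick_carrier)
    then show "\<exists>x. x \<in> A \<and> c n = to_thick E I n (encode x)" by blast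
  qed
  then obtain x where x: "\<And>n. x n \<in> A" "\<And>n. c n = to_thick E I n (encode (x n))" by metis
  have "\<exists>d. d \<in> A \<and> x (Suc n) - x n = fps_X ^ Suc n * d" for n
  proof -
    have "to_thick E I n (encode (x (Suc n))) = to_thick E I n (encode (x n))"
      using c x(1)[of "Suc n"] P.thick_step_to_thick[of "encode (x (Suc n))" n]
      by (simp flip: x(2))
    then have "encode (x (Suc n)) \<ominus>\<^bsub>E\<^esub> encode (x n) \<in> ideal_power E I (Suc n)"
      using x(1) by (subst (asm) P.to_thick_eq_iff) simp_all
    then show ?thesis unfolding E_minus[OF x(1)] ipow_mem by blast
  qed
  then obtain d where d: "\<And>n. d n \<in> A" "\<And>n. x (Suc n) - x n = fps_X ^ Suc n * d n" by metis
  define b where "b n = (case n of 0 \<Rightarrow> x 0 | Suc k \<Rightarrow> d k)" for n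
  have "b n \<in> A" for n using x(1) d(1) by (simp add: b_def split: nat.split)
  then obtain s where s: "\<And>N. s N \<in> A" "\<And>N. s 0 = (\<Sum>n<N. fps_X ^ n * b n) + fps_X ^ N * s N"
    using A_series[of b] by metis
  have xN: "(\<Sum>n<Suc N. fps_X ^ n * b n) = x N" for N
  proof (induction N)
    case (Suc N)
    have "(\<Sum>n<Suc (Suc N). fps_X ^ n * b n) = x N + fps_X ^ Suc N * d N"
      using Suc by (simp only: sum.lessThan_Suc[of _ "Suc N"]) (simp add: b_def)
    then show ?case using d(2)[of N] by (simp only: diff_eq_eq add.commute)
  qed (simp add: b_def)
  show "\<exists>!a. a \<in> carrier E \<and> (\<forall>n. to_thick E I n a = c n)"
  proof (rule ex1I[of _ "encode (s 0)"], intro conjI allI)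
    show "encode (s 0) \<in> carrier E" using s(1) by simp
    fix n
    have "s 0 - x n = fps_X ^ Suc n * s (Suc n)"
      using s(2)[of "Suc n"] by (simp only: xN add_diff_cancel_left')
    then have "encode (s 0) \<ominus>\<^bsub>E\<^esub> encode (x n) \<in> ideal_power E I (Suc n)"
      unfolding E_minus[OF x(1)] ipow_mem using s(1) by blast
    then show "to_thick E I n (encode (s 0)) = c n"
      unfolding x(2) using s(1) x(1) by (subst P.to_thick_eq_iff) simp_all
  next
    fix a assume a: "a \<in> carrier E \<and> (\<forall>n. to_thick E I n a = c n)"
    then obtain y where y: "y \<in> A" "a = encode y" by auto
    have "y $ k = s 0 $ k" for k
    proof -
      have "to_thick E I k (encode y) = to_thick E I k (encode (x k))"
        using a y(2) x(2) by simp
      then have "encode y \<ominus>\<^bsub>E\<^esub> encode (x k) \<in> ideal_power E I (Suc k)"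
        using x(1) y(1) by (subst (asm) P.to_thick_eq_iff) simp_all
      then obtain z where z: "y - x k = fps_X ^ Suc k * z" unfolding E_minus[OF x(1)] ipow_mem by blast
      have "s 0 - x k = fps_X ^ Suc k * s (Suc k)"
        using s(2)[of "Suc k"] by (simp only: xN add_diff_cancel_left')
      then have "y - s 0 = fps_X ^ Suc k * (z - s (Suc k))"
        using z by (simp only: right_diff_distrib) (metis diff_diff_eq2 diff_add_cancel add_diff_cancel_right)
      then have "(y - s 0) $ k = 0" by (simp only: fps_X_power_mult_nth) simp
      then show ?thesis by (simp only: fps_sub_nth right_minus_eq)
    qed
    then show "a = encode (s 0)" using y(2) by (simp add: fps_eq_iff)
  qed
qed

lemma E_noetherian_adic_ring: "noetherian_adic_ring E I"
  unfolding noetherian_adic_ring_def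
  using E_cring E_noetherian_ring E_principal[OF A_X] E_complete by blast

definition "P = {x \<in> A. x $ 0 = 0}"
definition "M = {x \<in> A. x $ 0 $ 0 = 0}"

lemma E_points: "{Q \<in> spec E. I \<subseteq> Q} = {encode ` P, encode ` M}"
proof (intro equalityI subsetI)
  fix Q assume "Q \<in> {Q \<in> spec E. I \<subseteq> Q}"
  then have Q: "Q \<in> spec E" "I \<subseteq> Q" by auto
  interpret Q: primeideal Q E using Q(1) by (simp add: spec_def)
  define J where "J = {x \<in> A. encode x \<in> Q}"
  note J = E_ideal_preimage[OF Q.is_ideal, folded J_def]
  have "J = {x \<in> A. x $ 0 = 0} \<or> J = {x \<in> A. x $ 0 $ 0 = 0}"
  proof (rule primes_over_X)
    show "J \<subseteq> A" by (auto simp: J_def)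
    show "x + y \<in> J" if "x \<in> J" "y \<in> J" for x y using J(1) that by (simp add: submod_def)
    show "x * y \<in> J" if "x \<in> A" "y \<in> J" for x y using J(1) that by (simp add: submod_def)
    show "1 \<notin> J" using spec_proper[OF Q(1)] by (simp add: J_def)
    show "x \<in> J \<or> y \<in> J" if "x \<in> A" "y \<in> A" "x * y \<in> J" for x y
      using Q.I_prime[of "encode x" "encode y"] that by (simp add: J_def)
    have "encode (fps_X * 1) \<in> I" using A_1 by blast
    then show "fps_X \<in> J" using Q(2) A_X by (auto simp: J_def)
  qed
  then show "Q \<in> {encode ` P, encode ` M}" using J(2) by (auto simp: P_def M_def)
next
  have "encode ` P \<in> spec E"
    by (rule E_prime) (auto simp: P_def submod_def A_0 A_add A_mult)
  moreover have "encode ` M \<in> spec E"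
    by (rule E_prime) (auto simp: M_def submod_def A_0 A_add A_mult)
  moreover have "I \<subseteq> encode ` P" "I \<subseteq> encode ` M"
    by (auto simp: P_def M_def A_mult A_X)
  ultimately show "Q \<in> {Q \<in> spec E. I \<subseteq> Q}" if "Q \<in> {encode ` P, encode ` M}" for Q
    using that by auto
qed

lemma E_two_point_pair:
  "two_point_pair E I (encode ` P) (encode ` M)
     (\<lambda>n. encode (approx n)) (\<lambda>n. encode (fps_const (fps_X ^ n\<^sup>2)))"
proof (intro two_point_pair.intro two_point_pair_axioms.intro E_adic_pair E_complete E_points)
  have sA: "fps_const (fps_X ^ n\<^sup>2) \<in> A" for n :: nat by (rule RT_A[OF RT_const[OF R_Xpow]])
  show "x = \<zero>\<^bsub>E\<^esub>" if x: "x \<in> carrier E" "x [^]\<^bsub>E\<^esub> (k::nat) = \<zero>\<^bsub>E\<^esub>" for x k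
  proof -
    obtain u where u: "x = encode u" using x(1) by auto
    have "u ^ k = 0" using x(2) unfolding u E_pow by simp
    then have "u = 0" by (rule power_eq_0_iff[THEN iffD1, THEN conjunct1])
    then show ?thesis by (simp add: u)
  qed
  show "encode ` P \<subset> encode ` M"
  proof
    show "encode ` P \<subseteq> encode ` M" by (auto simp: P_def M_def)
    have "fps_const fps_X \<in> M" "fps_const fps_X \<notin> P"
      using RT_A[OF RT_const[OF R_X]] by (auto simp: P_def M_def)
    then show "encode ` P \<noteq> encode ` M" by (metis e_mem)
  qed
  show "\<exists>y\<in>carrier E. x \<otimes>\<^bsub>E\<^esub> y = \<one>\<^bsub>E\<^esub>" if x: "x \<in> carrier E" "x \<notin> encode ` M" for x
  proof -
    obtain u where u: "u \<in> A" "x = encode u" using x(1) by auto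
    then have "u $ 0 $ 0 \<noteq> 0" using x(2) by (auto simp: M_def)
    then obtain v where "v \<in> A" "u * v = 1" using A_inverse[OF u(1)] by blast
    then show ?thesis using u(2) by (intro bexI[of _ "encode v"]) auto
  qed
  fix n
  show "encode (approx n) \<in> carrier E" "encode (fps_const (fps_X ^ n\<^sup>2)) \<in> carrier E"
    using approx_A sA by auto
  show "encode (fps_const (fps_X ^ n\<^sup>2)) \<notin> encode ` P"
    by (simp add: P_def)
  show "encode (approx n) \<otimes>\<^bsub>E\<^esub> encode (approx n) \<in> ideal_power E I (Suc n)"
    unfolding E_simps ipow_mem by (rule approx_square)
  show "encode (approx (Suc n)) \<otimes>\<^bsub>E\<^esub> encode (fps_const (fps_X ^ n\<^sup>2))
      \<ominus>\<^bsub>E\<^esub> encode (approx n) \<otimes>\<^bsub>E\<^esub> encode (fps_const (fps_X ^ (Suc n)\<^sup>2))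
      \<in> ideal_power E I (Suc n)"
    unfolding E_simps E_minus[OF A_mult[OF approx_A sA]] ipow_mem by (rule approx_compat)
next
  fix u assume u: "u \<in> carrier E" "u \<notin> encode ` P"
  then obtain w where w: "w \<in> A" "u = encode w" by auto
  then have "w $ 0 \<noteq> 0" using u(2) by (auto simp: P_def)
  then have "\<not> (\<exists>y\<in>A. w * approx 0 = fps_X ^ Suc 0 * y)"
    using beta_not_divisible[OF w(1)] by (simp add: approx_0)
  then show "u \<otimes>\<^bsub>E\<^esub> encode (approx 0) \<notin> ideal_power E I (Suc 0)"
    unfolding w(2) E_simps ipow_mem .
qed

end

theorem factA16:
  shows "\<exists>\<X> :: (nat set set, nat set spf_section) top_ringed_space.
           adic_noetherian_formal_scheme TYPE(nat set) \<X> \<and>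
           sheaf_of_ideals \<X> (\<lambda>U. nilradical (sect \<X> U)) \<and>
           \<not> coherent_sheaf \<X> (ideal_module \<X> (\<lambda>U. nilradical (sect \<X> U)))"
proof -
  obtain R f where "nonsplit_dvr R f" using exists_nonsplit_dvr by blast
  then interpret nonsplit_dvr R f .
  let ?E = "encoded_ring encode A" and ?I = "encode ` ((\<lambda>x. fps_X * x) ` A)"
  interpret two_point_pair ?E ?I "encode ` P" "encode ` M"
     "\<lambda>n. encode (approx n)" "\<lambda>n. encode (fps_const (fps_X ^ n\<^sup>2))"
    by (rule E_two_point_pair)
  show ?thesis
  proof (intro exI conjI)
    show "adic_noetherian_formal_scheme TYPE(nat set) (Spf ?E ?I)"
      by (rule Spf_formal_scheme[OF Union_open_mem E_noetherian_adic_ring])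
    show "sheaf_of_ideals (Spf ?E ?I) (\<lambda>U. nilradical (sect (Spf ?E ?I) U))"
      by (rule nilradical_sheaf_of_ideals[OF Union_open_mem])
    show "\<not> coherent_sheaf (Spf ?E ?I) (ideal_module (Spf ?E ?I) (\<lambda>U. nilradical (sect (Spf ?E ?I) U)))"
      by (rule nilradical_not_coherent)
  qed
qed

end
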